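(* Let $\mathcal X=\mathbb R^d$, let $\xi$ be the standard Gaussian density, and suppose the assumptions on $F$ and $\pi$ below (including the quadratic growth of $U$) hold; fix $\sigma>0$. Then for every $\varepsilon>0$ the functional $$V^\sigma_\varepsilon(m):=F(m)+\sigma\int_{\mathbb R^d}\log\frac{(K_\varepsilon*m)(x)}{\pi(x)}\,m(dx)$$ admits a minimizer in $\mathcal P_2(\mathbb R^d)$. Moreover, if for each $\varepsilon>0$, $\mu_\varepsilon\in\mathcal P_2(\mathbb R^d)$ is a minimizer of $V^\sigma_\varepsilon$, then there exist $\varepsilon_k\to0$ and $\mu\in\mathcal P_2(\mathbb R^d)$ such that $\mu_{\varepsilon_k}\to\mu$ weakly, and $\mu$ is a minimizer over $\mathcal P_2(\mathbb R^d)$ of $V^\sigma(m):=F(m)+\sigma\,\mathrm{KL}(m\,|\,\pi)$.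
   Context: $\xi(z)=(2\pi)^{-d/2}e^{-|z|^2/2}$, $\xi_\varepsilon(z)=\varepsilon^{-d}\xi(z/\varepsilon)$, $K_\varepsilon=\xi_\varepsilon*\xi_\varepsilon$, $(K_\varepsilon*m)(x)=\int K_\varepsilon(x-y)m(dy)$. $\mathcal P_2(\mathbb R^d)$: probability measures with finite second moment; $\mathcal W_2$ the 2-Wasserstein distance; $\mathrm{KL}(m|\pi)=\int\log\frac{dm}{d\pi}dm$ if $m\ll\pi$, $+\infty$ otherwise. Flat derivative: $\frac{\delta F}{\delta\mu}$ with $F(m')-F(m)=\int_0^1\int\frac{\delta F}{\delta\mu}(m+\lambda(m'-m),x)(m'-m)(dx)d\lambda$. Assumption on $F:\mathcal P_2(\mathbb R^d)\to\mathbb R$: lower semicontinuous w.r.t. weak convergence in $\mathcal P_2$, bounded below by $F_{\min}$, flat derivative bounded by $C_F$ and satisfying $|\frac{\delta F}{\delta\mu}(\mu,x)-\frac{\delta F}{\delta\mu}(\nu,y)|\le L_F(\mathcal W_2(\mu,\nu)+|x-y|)$. Assumption on $\pi$: $\pi=e^{-U}$ is a probability density on $\mathbb R^d$, $U$ continuous, $\pi$ globally Lipschitz, and there are $C_0,A_0\in\mathbb R$, $C_1,A_1>0$ with $C_0+C_1|x|^2\le U(x)\le A_0+A_1|x|^2$ for all $x$. *)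

theory Defs
  imports "HOL-Probability.Probability"
begin

definition P2 :: "'a::euclidean_space measure set" where
  "P2 = {m. prob_space m \<and> sets m = sets borel \<and> integrable m (\<lambda>x. (norm x)^2)}"

definition couplings :: "'a::euclidean_space measure \<Rightarrow> 'a measure \<Rightarrow> ('a \<times> 'a) measure set" where
  "couplings \<mu> \<nu> = {\<gamma>. prob_space \<gamma> \<and> sets \<gamma> = sets borel \<and>
       distr \<gamma> borel fst = \<mu> \<and> distr \<gamma> borel snd = \<nu>}"

definition W2 :: "'a::euclidean_space measure \<Rightarrow> 'a measure \<Rightarrow> real" where
  "W2 \<mu> \<nu> = sqrt (enn2real (INF \<gamma>\<in>couplings \<mu> \<nu>.
       (\<integral>\<^sup>+ z. ennreal ((norm (fst z - snd z))^2) \<partial>\<gamma>)))"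

definition weak_conv_seq :: "(nat \<Rightarrow> 'a::euclidean_space measure) \<Rightarrow> 'a measure \<Rightarrow> bool" where
  "weak_conv_seq ms m \<longleftrightarrow> (\<forall>f :: 'a \<Rightarrow> real. continuous_on UNIV f \<and> bounded (range f) \<longrightarrow>
       (\<lambda>n. integral\<^sup>L (ms n) f) \<longlonglongrightarrow> integral\<^sup>L m f)"

definition mixm :: "real \<Rightarrow> 'a::euclidean_space measure \<Rightarrow> 'a measure \<Rightarrow> 'a measure" where
  "mixm l m m' = measure_of UNIV (sets borel)
      (\<lambda>A. ennreal (1 - l) * emeasure m A + ennreal l * emeasure m' A)"

definition F_assumption :: "('a::euclidean_space measure \<Rightarrow> real) \<Rightarrow> real \<Rightarrow> real \<Rightarrow> real \<Rightarrow> bool" where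
  "F_assumption F Fmin CF LF \<longleftrightarrow>
     \<comment> \<open>lower semicontinuity w.r.t. weak convergence in P2\<close>
     (\<forall>ms m. (\<forall>n. ms n \<in> P2) \<and> m \<in> P2 \<and> weak_conv_seq ms m \<longrightarrow>
          ereal (F m) \<le> liminf (\<lambda>n. ereal (F (ms n)))) \<and>
     \<comment> \<open>bounded below\<close>
     (\<forall>m\<in>P2. Fmin \<le> F m) \<and>
     \<comment> \<open>existence of a flat derivative with the stated bounds\<close>
     (\<exists>dF :: 'a measure \<Rightarrow> 'a \<Rightarrow> real.
        (\<forall>m\<in>P2. \<forall>m'\<in>P2. F m' - F m =
            integral {0..1} (\<lambda>l. integral\<^sup>L m' (dF (mixm l m m')) - integral\<^sup>L m (dF (mixm l m m')))) \<and>
        (\<forall>m\<in>P2. \<forall>x. \<bar>dF m x\<bar> \<le> CF) \<and>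
        (\<forall>\<mu>\<in>P2. \<forall>\<nu>\<in>P2. \<forall>x y. \<bar>dF \<mu> x - dF \<nu> y\<bar> \<le> LF * (W2 \<mu> \<nu> + norm (x - y))))"

definition pi_assumption :: "('a::euclidean_space \<Rightarrow> real) \<Rightarrow> bool" where
  "pi_assumption U \<longleftrightarrow>
     continuous_on UNIV U \<and>
     (\<integral>\<^sup>+ x. ennreal (exp (- U x)) \<partial>lborel) = 1 \<and>
     (\<exists>L. \<forall>x y. \<bar>exp (- U x) - exp (- U y)\<bar> \<le> L * norm (x - y)) \<and>
     (\<exists>C0 A0 C1 A1. C1 > 0 \<and> A1 > 0 \<and>
        (\<forall>x. C0 + C1 * (norm x)^2 \<le> U x \<and> U x \<le> A0 + A1 * (norm x)^2))"

definition pi_dens :: "('a::euclidean_space \<Rightarrow> real) \<Rightarrow> 'a \<Rightarrow> real" where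
  "pi_dens U x = exp (- U x)"

definition pi_meas :: "('a::euclidean_space \<Rightarrow> real) \<Rightarrow> 'a measure" where
  "pi_meas U = density lborel (\<lambda>x. ennreal (pi_dens U x))"

definition xi :: "'a::euclidean_space \<Rightarrow> real" where
  "xi z = (2 * pi) powr (- real DIM('a) / 2) * exp (- ((norm z)^2) / 2)"

definition xi_eps :: "real \<Rightarrow> 'a::euclidean_space \<Rightarrow> real" where
  "xi_eps \<epsilon> z = \<epsilon> powr (- real DIM('a)) * xi ((1 / \<epsilon>) *\<^sub>R z)"

definition K_eps :: "real \<Rightarrow> 'a::euclidean_space \<Rightarrow> real" where
  "K_eps \<epsilon> x = (\<integral> y. xi_eps \<epsilon> (x - y) * xi_eps \<epsilon> y \<partial>lborel)"

definition K_conv :: "real \<Rightarrow> 'a::euclidean_space measure \<Rightarrow> 'a \<Rightarrow> real" where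
  "K_conv \<epsilon> m x = (\<integral> y. K_eps \<epsilon> (x - y) \<partial>m)"

definition KL :: "'a::euclidean_space measure \<Rightarrow> 'a measure \<Rightarrow> ereal" where
  "KL m p = (if absolutely_continuous p m then
      (let f = (\<lambda>x. ln (enn2real (RN_deriv p m x))) in
        enn2ereal (\<integral>\<^sup>+ x. ennreal (max 0 (f x)) \<partial>m)
        - enn2ereal (\<integral>\<^sup>+ x. ennreal (max 0 (- f x)) \<partial>m))
     else \<infinity>)"

definition V_eps :: "('a::euclidean_space measure \<Rightarrow> real) \<Rightarrow> ('a \<Rightarrow> real) \<Rightarrow> real \<Rightarrow> real \<Rightarrow> 'a measure \<Rightarrow> real" where
  "V_eps F U \<sigma> \<epsilon> m = F m + \<sigma> * (\<integral> x. ln (K_conv \<epsilon> m x / pi_dens U x) \<partial>m)"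

definition V :: "('a::euclidean_space measure \<Rightarrow> real) \<Rightarrow> ('a \<Rightarrow> real) \<Rightarrow> real \<Rightarrow> 'a measure \<Rightarrow> ereal" where
  "V F U \<sigma> m = ereal (F m) + ereal \<sigma> * KL m (pi_meas U)"

end

theory Submission
  imports Defs
begin

text \<open>
  Write \<open>E\<^sub>\<epsilon>(m) = \<integral> ln (K\<^sub>\<epsilon> * m) dm + \<integral> U dm\<close>, so that \<open>V\<^sub>\<epsilon> = F + \<sigma> E\<^sub>\<epsilon>\<close>, and let \<open>\<gamma> = exp (- c |x|\<^sup>2) dx\<close> with \<open>2 c\<close>
  the lower quadratic growth constant of \<open>U\<close>. Since \<open>K\<^sub>\<epsilon>\<close> is \<open>\<xi>\<^sub>\<epsilon>\<close> convolved with itself, applying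
  \<open>ln t \<le> t - 1\<close> twice gives the dual lower bound
  \<open>E\<^sub>\<epsilon>(m) \<ge> \<integral> (\<xi>\<^sub>\<epsilon> * b) dm + \<integral> (U - c |x|\<^sup>2) dm + 1 - \<integral> exp b d\<gamma> - O(\<epsilon>\<^sup>2)\<close>
  for every bounded \<open>b\<close>. With \<open>b = 0\<close> it is coercive in the second moment; applied to the part of \<open>m\<close>
  far from the origin, with \<open>b\<close> a very negative constant, it controls the tails, although \<open>ln (K\<^sub>\<epsilon> * m) + U\<close>
  is not bounded below. Hence \<open>E\<^sub>\<epsilon>\<close> is weakly lower semicontinuous and the direct method yields
  minimizers. As \<open>\<epsilon> \<rightarrow> 0\<close>, the dual bound passes to the limit for bounded Lipschitz \<open>b\<close> and then recovers
  \<open>KL(\<mu> | \<pi>)\<close> as a supremum over \<open>b\<close> (Donsker-Varadhan). In the other direction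
  \<open>E\<^sub>\<epsilon>(m) \<le> KL(m | \<pi>)\<close> for every \<open>\<epsilon>\<close>, by Gibbs' inequality, so constant sequences are recovery sequences.
\<close>

section \<open>Gaussian kernels\<close>

text \<open>Since K_eps * m = \<xi>_eps * (\<xi>_eps * m), Jensen followed by Gibbs would bound the
  entropy from below by that of the smoothed density g = \<xi>_eps * m. Using the linear bound for
  ln in both steps cancels ln g, so the integrability of g ln g never comes up. Bounded second
  moments do not make |x|^2 uniformly integrable, while ln (K_eps * m) may fall like -|x|^2 / eps^2
  far out. A pointwise lower bound therefore cannot control the tails; the dual bound is applied to
  the restricted measure instead. The reference measure is \<gamma> rather than \<pi> because no
  modulus of continuity of U is at hand: a test function b - U would require comparing \<xi>_eps * U
  with U, whereas smoothing |x|^2 costs exactly a constant of order eps^2. What is left over, U - c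
  |x|^2, is continuous and bounded below, so its integral is lower semicontinuous under weak
  convergence.\<close>

lemma xi_eps_eq_exp:
  fixes z :: "'a::euclidean_space"
  assumes "\<epsilon> > 0"
  shows "xi_eps \<epsilon> z = xi_eps \<epsilon> (0::'a) * exp (- (norm z)\<^sup>2 / (2 * \<epsilon>\<^sup>2))"
  using assms by (simp add: xi_eps_def xi_def power_divide field_simps)

text \<open>Separates the coordinates, so that the normalization reduces to that of the
  one-dimensional \<open>normal_density\<close>.\<close>

lemma xi_eps_eq_prod:
  fixes z :: "'a::euclidean_space"
  assumes e: "\<epsilon> > 0"
  shows "xi_eps \<epsilon> z = (\<Prod>b\<in>Basis. normal_density 0 \<epsilon> (z \<bullet> b))"
proof -
  have n: "(norm z)\<^sup>2 = (\<Sum>b\<in>Basis. (z \<bullet> b)\<^sup>2)"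
    by (subst power2_norm_eq_inner, subst euclidean_inner) (simp add: power2_eq_square)
  have "(\<Prod>b\<in>Basis. normal_density 0 \<epsilon> (z \<bullet> b))
      = (\<Prod>b\<in>(Basis::'a set). 1 / sqrt (2 * pi * \<epsilon>\<^sup>2)) * (\<Prod>b\<in>Basis. exp (- (z \<bullet> b)\<^sup>2 / (2 * \<epsilon>\<^sup>2)))"
    unfolding normal_density_def by (simp only: prod.distrib diff_zero)
  also have "(\<Prod>b\<in>Basis. exp (- (z \<bullet> b)\<^sup>2 / (2 * \<epsilon>\<^sup>2))) = exp (- (norm z)\<^sup>2 / (2 * \<epsilon>\<^sup>2))"
    unfolding n by (subst exp_sum[symmetric]) (simp_all add: sum_divide_distrib sum_negf)
  also have "(\<Prod>b\<in>(Basis::'a set). 1 / sqrt (2 * pi * \<epsilon>\<^sup>2)) = (1 / sqrt (2 * pi * \<epsilon>\<^sup>2)) ^ DIM('a)"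
    by simp
  also have "\<dots> = (sqrt (2 * pi * \<epsilon>\<^sup>2)) powr (- real DIM('a))"
    using e by (subst powr_minus, subst powr_realpow) (auto simp: power_divide inverse_eq_divide)
  also have "\<dots> = \<epsilon> powr (- real DIM('a)) * (2 * pi) powr (- real DIM('a) / 2)"
    using e by (simp add: real_sqrt_mult powr_mult powr_half_sqrt[symmetric] powr_powr mult.commute)
  finally show ?thesis
    using e by (simp add: xi_eps_def xi_def power_divide field_simps)
qed

lemma xi_eps_pos: "\<epsilon> > 0 \<Longrightarrow> xi_eps \<epsilon> z > 0"
  by (simp add: xi_eps_def xi_def)

lemma xi_eps_nonneg [simp]: "xi_eps \<epsilon> z \<ge> 0"
  by (simp add: xi_eps_def xi_def)

lemma xi_eps_le:
  assumes "\<epsilon> > 0"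
  shows "xi_eps \<epsilon> (z::'a::euclidean_space) \<le> xi_eps \<epsilon> (0::'a)"
  unfolding xi_eps_eq_exp[OF assms, of z]
  using xi_eps_pos[OF assms, of "0::'a"] by (auto intro!: mult_left_le)

lemma xi_eps_minus [simp]: "xi_eps \<epsilon> (- z) = xi_eps \<epsilon> z"
  by (simp add: xi_eps_def xi_def)

lemma xi_eps_minus_commute: "xi_eps \<epsilon> (x - y) = xi_eps \<epsilon> (y - x)"
  by (metis xi_eps_minus minus_diff_eq)

lemma continuous_xi_eps [continuous_intros]:
  "continuous_on A f \<Longrightarrow> continuous_on A (\<lambda>x. xi_eps \<epsilon> (f x))"
  unfolding xi_eps_def xi_def
  by (intro continuous_intros continuous_on_scaleR[OF continuous_on_const]) auto

lemma measurable_xi_eps [measurable]: "xi_eps \<epsilon> \<in> borel_measurable borel"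
  by (rule borel_measurable_continuous_onI) (auto intro!: continuous_intros)

lemma nn_integral_xi_eps:
  assumes e: "\<epsilon> > 0"
  shows "(\<integral>\<^sup>+z. ennreal (xi_eps \<epsilon> (z::'a::euclidean_space)) \<partial>lborel) = 1"
proof -
  have "(\<integral>\<^sup>+z. ennreal (xi_eps \<epsilon> (z::'a)) \<partial>lborel)
      = (\<integral>\<^sup>+z. (\<Prod>b\<in>(Basis::'a set). ennreal (normal_density 0 \<epsilon> (z \<bullet> b))) \<partial>lborel)"
    by (simp add: xi_eps_eq_prod[OF e] prod_ennreal)
  also have "\<dots> = (\<Prod>b\<in>(Basis::'a set). \<integral>\<^sup>+x. ennreal (normal_density 0 \<epsilon> x) \<partial>lborel)"
    by (rule nn_integral_lborel_prod) auto
  also have "(\<integral>\<^sup>+x. ennreal (normal_density 0 \<epsilon> x) \<partial>lborel) = 1"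
    using e by (subst nn_integral_eq_integral) (auto intro: integrable_normal_density integral_normal_density)
  finally show ?thesis by simp
qed

lemma nn_integral_lborel_translate:
  fixes f :: "'a::euclidean_space \<Rightarrow> ennreal"
  assumes [measurable]: "f \<in> borel_measurable borel"
  shows "(\<integral>\<^sup>+x. f (t + x) \<partial>lborel) = (\<integral>\<^sup>+x. f x \<partial>lborel)"
  by (subst (2) lborel_distr_plus[symmetric, of t]) (simp add: nn_integral_distr)

lemma nn_integral_xi_eps_translate:
  assumes e: "\<epsilon> > 0"
  shows "(\<integral>\<^sup>+z. ennreal (xi_eps \<epsilon> ((z::'a::euclidean_space) - x)) \<partial>lborel) = 1"
  using nn_integral_lborel_translate[of "\<lambda>z. ennreal (xi_eps \<epsilon> z)" "-x"] nn_integral_xi_eps[OF e, where 'a='a]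
  by (simp add: algebra_simps)

lemma nn_integral_lborel_scale:
  fixes f :: "'a::euclidean_space \<Rightarrow> ennreal"
  assumes [measurable]: "f \<in> borel_measurable borel" and c: "c > 0"
  shows "(\<integral>\<^sup>+x. f x \<partial>lborel) = ennreal (c ^ DIM('a)) * (\<integral>\<^sup>+x. f (c *\<^sub>R x) \<partial>lborel)"
  using c by (subst lborel_affine[of c 0]) (simp_all add: nn_integral_density nn_integral_distr nn_integral_cmult)

text \<open>With the mollifier as a probability measure, convolution becomes the mean of f (x + z)
  over z, and product measures replace convolutions throughout.\<close>

definition gauss_meas :: "real \<Rightarrow> 'a::euclidean_space measure" where
  "gauss_meas \<epsilon> = density lborel (\<lambda>z. ennreal (xi_eps \<epsilon> z))"

lemma sets_gauss_meas [simp, measurable_cong]: "sets (gauss_meas \<epsilon>) = sets borel"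
  by (simp add: gauss_meas_def)

lemma space_gauss_meas [simp]: "space (gauss_meas \<epsilon>) = UNIV"
  by (simp add: gauss_meas_def)

lemma prob_space_gauss_meas: "\<epsilon> > 0 \<Longrightarrow> prob_space (gauss_meas \<epsilon> :: 'a::euclidean_space measure)"
  by (rule prob_spaceI) (simp add: gauss_meas_def emeasure_density nn_integral_xi_eps)

lemma nn_integral_gauss_meas:
  assumes [measurable]: "f \<in> borel_measurable borel"
  shows "(\<integral>\<^sup>+z. f z \<partial>gauss_meas \<epsilon>) = (\<integral>\<^sup>+z. ennreal (xi_eps \<epsilon> z) * f z \<partial>lborel)"
  by (simp add: gauss_meas_def nn_integral_density)

text \<open>The Jacobian eps^d cancels the prefactor of \<open>xi_eps\<close>. This makes the second
  moment exactly proportional to eps^2, the source of the error term of the dual bound.\<close>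

lemma gauss_meas_scale:
  assumes e: "\<epsilon> > 0"
  shows "gauss_meas \<epsilon> = distr (gauss_meas 1) borel (\<lambda>z::'a::euclidean_space. \<epsilon> *\<^sub>R z)"
proof (rule measure_eqI)
  fix A :: "'a set" assume "A \<in> sets (gauss_meas \<epsilon>)"
  then have A[measurable]: "A \<in> sets borel" by simp
  have k: "ennreal (\<epsilon> ^ DIM('a)) * ennreal (xi_eps \<epsilon> (\<epsilon> *\<^sub>R z)) = ennreal (xi_eps 1 z)" for z :: 'a
    using e by (simp add: ennreal_mult'[symmetric] xi_eps_def powr_minus powr_realpow field_simps)
  have "emeasure (gauss_meas \<epsilon>) A = (\<integral>\<^sup>+z. ennreal (xi_eps \<epsilon> z) * indicator A z \<partial>lborel)"
    by (simp add: gauss_meas_def emeasure_density)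
  also have "\<dots> = (\<integral>\<^sup>+z. (ennreal (\<epsilon> ^ DIM('a)) * ennreal (xi_eps \<epsilon> (\<epsilon> *\<^sub>R z))) * indicator A (\<epsilon> *\<^sub>R z) \<partial>lborel)"
    by (subst nn_integral_lborel_scale[OF _ e]) (simp_all add: nn_integral_cmult mult.assoc)
  also have "\<dots> = (\<integral>\<^sup>+z. indicator A (\<epsilon> *\<^sub>R z) \<partial>gauss_meas 1)"
    unfolding k by (subst nn_integral_gauss_meas) auto
  also have "\<dots> = (\<integral>\<^sup>+z. indicator ((\<lambda>z. \<epsilon> *\<^sub>R z) -` A) z \<partial>gauss_meas 1)"
    by (intro nn_integral_cong) (simp add: indicator_def)
  also have "\<dots> = emeasure (distr (gauss_meas 1) borel (\<lambda>z. \<epsilon> *\<^sub>R z)) A"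
    by (subst emeasure_distr) (auto intro!: nn_integral_indicator measurable_sets_borel[of _ borel])
  finally show "emeasure (gauss_meas \<epsilon>) A = emeasure (distr (gauss_meas 1) borel (\<lambda>z. \<epsilon> *\<^sub>R z)) A" .
qed simp

lemma nn_integral_exp_neg_sq_finite:
  assumes c: "c > 0"
  shows "(\<integral>\<^sup>+x. ennreal (exp (- c * (norm (x::'a::euclidean_space))\<^sup>2)) \<partial>lborel) < \<infinity>"
proof -
  \<comment> \<open>With 2 e^2 = 1 / c the function is a constant multiple of the normalized density
    \<open>xi_eps e\<close>.\<close>
  define e where "e = 1 / sqrt (2 * c)"
  have e: "e > 0" "e\<^sup>2 = 1 / (2 * c)" using c by (auto simp: e_def power_divide)
  have "exp (- c * (norm x)\<^sup>2) = (1 / xi_eps e (0::'a)) * xi_eps e x" for x :: 'a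
    using xi_eps_pos[OF e(1), of "0::'a"] xi_eps_eq_exp[OF e(1), of x] c e(2) by (simp add: field_simps)
  then have "(\<integral>\<^sup>+x. ennreal (exp (- c * (norm (x::'a))\<^sup>2)) \<partial>lborel)
      = (\<integral>\<^sup>+x. ennreal (1 / xi_eps e (0::'a)) * ennreal (xi_eps e (x::'a)) \<partial>lborel)"
    using xi_eps_pos[OF e(1), of "0::'a"] by (simp add: ennreal_mult'[symmetric])
  also have "\<dots> = ennreal (1 / xi_eps e (0::'a))"
    by (subst nn_integral_cmult) (simp_all add: nn_integral_xi_eps[OF e(1)])
  finally show ?thesis by simp
qed

lemma integrable_exp_neg_sq:
  assumes c: "c > 0"
  shows "integrable lborel (\<lambda>x::'a::euclidean_space. exp (- c * (norm x)\<^sup>2))"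
  using nn_integral_exp_neg_sq_finite[OF c, where 'a='a] by (intro integrableI_nonneg) auto

lemma integrable_norm_sq_exp:
  assumes c: "c > 0"
  shows "integrable lborel (\<lambda>x::'a::euclidean_space. (norm x)\<^sup>2 * exp (- c * (norm x)\<^sup>2))"
proof (rule Bochner_Integration.integrable_bound)
  show "integrable lborel (\<lambda>x::'a. (2 / c) * exp (- (c/2) * (norm x)\<^sup>2))"
    by (intro integrable_mult_right integrable_exp_neg_sq) (use c in auto)
  show "AE x::'a in lborel. norm ((norm x)\<^sup>2 * exp (- c * (norm x)\<^sup>2)) \<le> norm ((2 / c) * exp (- (c/2) * (norm x)\<^sup>2))"
  proof (intro AE_I2)
    fix x :: 'a
    \<comment> \<open>Half of the exponent is spent on absorbing the polynomial factor, by t <= exp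
      t.\<close>
    have "(c/2) * (norm x)\<^sup>2 \<le> exp ((c/2) * (norm x)\<^sup>2)"
      using exp_ge_add_one_self[of "(c/2) * (norm x)\<^sup>2"] by linarith
    then have "(norm x)\<^sup>2 \<le> (2/c) * exp ((c/2) * (norm x)\<^sup>2)" using c by (simp add: field_simps)
    then have "(norm x)\<^sup>2 * exp (- c * (norm x)\<^sup>2) \<le> (2/c) * exp ((c/2) * (norm x)\<^sup>2) * exp (- c * (norm x)\<^sup>2)"
      by (intro mult_right_mono) auto
    also have "\<dots> = (2/c) * exp (- (c/2) * (norm x)\<^sup>2)"
      by (simp add: mult_exp_exp mult.assoc)
    finally show "norm ((norm x)\<^sup>2 * exp (- c * (norm x)\<^sup>2)) \<le> norm ((2 / c) * exp (- (c/2) * (norm x)\<^sup>2))"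
      using c by simp
  qed
qed auto

text \<open>The \<open>itself\<close> argument only fixes the space on which the moment is taken.\<close>

definition gauss_moment :: "'a::euclidean_space itself \<Rightarrow> real" where
  "gauss_moment _ = (\<integral>z. (norm (z::'a))\<^sup>2 \<partial>gauss_meas 1)"

lemma integrable_gauss_sq:
  assumes e: "\<epsilon> > 0"
  shows "integrable (gauss_meas \<epsilon>) (\<lambda>z::'a::euclidean_space. (norm z)\<^sup>2)"
proof -
  have "integrable lborel (\<lambda>z::'a. xi_eps \<epsilon> (0::'a) * ((norm z)\<^sup>2 * exp (- (1 / (2 * \<epsilon>\<^sup>2)) * (norm z)\<^sup>2)))"
    by (intro integrable_mult_right integrable_norm_sq_exp) (use e in auto)
  also have "(\<lambda>z::'a. xi_eps \<epsilon> (0::'a) * ((norm z)\<^sup>2 * exp (- (1 / (2 * \<epsilon>\<^sup>2)) * (norm z)\<^sup>2)))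
      = (\<lambda>z. xi_eps \<epsilon> z * (norm z)\<^sup>2)"
    by (subst (2) xi_eps_eq_exp[OF e]) (auto simp: mult_ac)
  finally show ?thesis
    unfolding gauss_meas_def by (subst integrable_density) (auto simp: xi_eps_pos[OF e] less_imp_le)
qed

lemma integral_gauss_sq:
  assumes e: "\<epsilon> > 0"
  shows "(\<integral>z. (norm (z::'a::euclidean_space))\<^sup>2 \<partial>gauss_meas \<epsilon>) = \<epsilon>\<^sup>2 * gauss_moment TYPE('a)"
  unfolding gauss_moment_def gauss_meas_scale[OF e]
  by (subst integral_distr) (auto simp: power_mult_distrib)

lemma gauss_moment_nonneg: "gauss_moment TYPE('a::euclidean_space) \<ge> 0"
  unfolding gauss_moment_def by (rule integral_nonneg_AE) auto

lemma lborel_uminus: "distr lborel borel uminus = (lborel :: 'a::euclidean_space measure)"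
  by (subst (2) lborel_affine[of "-1" 0]) (auto simp: density_1)

lemma gauss_meas_uminus: "distr (gauss_meas \<epsilon>) borel uminus = (gauss_meas \<epsilon> :: 'a::euclidean_space measure)"
proof (rule measure_eqI)
  fix A :: "'a set" assume "A \<in> sets (distr (gauss_meas \<epsilon>) borel uminus)"
  then have A[measurable]: "A \<in> sets borel" by simp
  have "emeasure (distr (gauss_meas \<epsilon>) borel uminus) A = (\<integral>\<^sup>+x. indicator A x \<partial>distr (gauss_meas \<epsilon>) borel uminus)"
    by simp
  also have "\<dots> = (\<integral>\<^sup>+z. ennreal (xi_eps \<epsilon> z) * indicator A (- z) \<partial>lborel)"
    by (subst nn_integral_distr) (auto simp: nn_integral_gauss_meas)
  also have "\<dots> = (\<integral>\<^sup>+z. ennreal (xi_eps \<epsilon> (-z)) * indicator A (- z) \<partial>lborel)" by simp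
  also have "\<dots> = (\<integral>\<^sup>+z. ennreal (xi_eps \<epsilon> z) * indicator A z \<partial>distr lborel borel uminus)"
    by (subst nn_integral_distr) auto
  also have "\<dots> = (\<integral>\<^sup>+z. ennreal (xi_eps \<epsilon> z) * indicator A z \<partial>lborel)"
    by (simp only: lborel_uminus)
  also have "\<dots> = emeasure (gauss_meas \<epsilon>) A"
    by (simp add: gauss_meas_def emeasure_density)
  finally show "emeasure (distr (gauss_meas \<epsilon>) borel uminus) A = emeasure (gauss_meas \<epsilon>) A" .
qed simp

lemma integrable_gauss_sq_shift:
  assumes e: "\<epsilon> > 0"
  shows "integrable (gauss_meas \<epsilon>) (\<lambda>z::'a::euclidean_space. (norm (x + z))\<^sup>2)"
proof -
  interpret prob_space "gauss_meas \<epsilon> :: 'a measure" by (rule prob_space_gauss_meas[OF e])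
  show ?thesis
  proof (rule Bochner_Integration.integrable_bound)
    show "integrable (gauss_meas \<epsilon>) (\<lambda>z::'a. 2 * (norm x)\<^sup>2 + 2 * (norm z)\<^sup>2)"
      using integrable_gauss_sq[OF e, where 'a='a] by auto
    show "AE z::'a in gauss_meas \<epsilon>. norm ((norm (x + z))\<^sup>2) \<le> norm (2 * (norm x)\<^sup>2 + 2 * (norm z)\<^sup>2)"
    proof (intro AE_I2)
      fix z :: 'a
      have "(norm (x + z))\<^sup>2 + (norm (x - z))\<^sup>2 = 2 * (norm x)\<^sup>2 + 2 * (norm z)\<^sup>2"
        by (simp add: power2_norm_eq_inner algebra_simps inner_commute)
      then have "(norm (x + z))\<^sup>2 \<le> 2 * (norm x)\<^sup>2 + 2 * (norm z)\<^sup>2"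
        using zero_le_power2[of "norm (x - z)"] by linarith
      then show "norm ((norm (x + z))\<^sup>2) \<le> norm (2 * (norm x)\<^sup>2 + 2 * (norm z)\<^sup>2)" by simp
    qed
  qed auto
qed

text \<open>Shifts by z and by -z have the same mean by symmetry of the Gaussian. Adding them, the
  parallelogram identity removes the cross term.\<close>

lemma integral_gauss_sq_shift:
  assumes e: "\<epsilon> > 0"
  shows "(\<integral>z. (norm (x + (z::'a::euclidean_space)))\<^sup>2 \<partial>gauss_meas \<epsilon>) = (norm x)\<^sup>2 + \<epsilon>\<^sup>2 * gauss_moment TYPE('a)"
proof -
  interpret prob_space "gauss_meas \<epsilon> :: 'a measure" by (rule prob_space_gauss_meas[OF e])
  let ?I = "\<lambda>x. \<integral>z. (norm (x + (z::'a)))\<^sup>2 \<partial>gauss_meas \<epsilon>"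
  have s: "?I x = (\<integral>z. (norm (x - z))\<^sup>2 \<partial>gauss_meas \<epsilon>)"
    by (subst gauss_meas_uminus[symmetric], subst integral_distr) auto
  have i2: "integrable (gauss_meas \<epsilon>) (\<lambda>z::'a. (norm (x - z))\<^sup>2)"
    using integrable_gauss_sq_shift[OF e, of "-x"] by (simp add: norm_minus_commute)
  have "?I x + ?I x = (\<integral>z. (norm (x + z))\<^sup>2 + (norm (x - z))\<^sup>2 \<partial>gauss_meas \<epsilon>)"
    using i2 integrable_gauss_sq_shift[OF e, of x] s by simp
  also have "\<dots> = (\<integral>z. 2 * (norm x)\<^sup>2 + 2 * (norm (z::'a))\<^sup>2 \<partial>gauss_meas \<epsilon>)"
    by (intro Bochner_Integration.integral_cong) (auto simp: power2_norm_eq_inner algebra_simps inner_commute)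
  also have "\<dots> = 2 * (norm x)\<^sup>2 + 2 * (\<epsilon>\<^sup>2 * gauss_moment TYPE('a))"
    using integrable_gauss_sq[OF e, where 'a='a] by (simp add: integral_gauss_sq[OF e] prob_space[unfolded space_gauss_meas])
  finally show ?thesis by simp
qed

lemma integrable_xi_eps_mult:
  assumes e: "\<epsilon> > 0"
  shows "integrable lborel (\<lambda>y::'a::euclidean_space. xi_eps \<epsilon> (x - y) * xi_eps \<epsilon> y)"
proof (rule Bochner_Integration.integrable_bound)
  show "integrable lborel (\<lambda>y::'a. xi_eps \<epsilon> (0::'a) * xi_eps \<epsilon> y)"
    by (intro integrable_mult_right integrableI_nonneg) (auto simp: nn_integral_xi_eps[OF e])
  show "AE y::'a in lborel. norm (xi_eps \<epsilon> (x - y) * xi_eps \<epsilon> y) \<le> norm (xi_eps \<epsilon> (0::'a) * xi_eps \<epsilon> y)"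
    by (auto intro!: mult_right_mono xi_eps_le[OF e])
qed auto

lemma ennreal_K_eps:
  assumes e: "\<epsilon> > 0"
  shows "ennreal (K_eps \<epsilon> (x::'a::euclidean_space))
    = (\<integral>\<^sup>+y. ennreal (xi_eps \<epsilon> (x - y)) * ennreal (xi_eps \<epsilon> y) \<partial>lborel)"
  unfolding K_eps_def
  by (subst nn_integral_eq_integral[OF integrable_xi_eps_mult[OF e], symmetric])
     (auto intro!: nn_integral_cong simp: ennreal_mult'')

lemma K_eps_zero_pos:
  assumes e: "\<epsilon> > 0"
  shows "K_eps \<epsilon> (0::'a::euclidean_space) > 0"
proof (rule ccontr)
  have pos: "\<not> xi_eps \<epsilon> y \<le> 0" for y :: 'a
    using xi_eps_pos[OF e, of y] by linarith
  assume "\<not> K_eps \<epsilon> (0::'a) > 0"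
  then have "(\<integral>\<^sup>+y. ennreal (xi_eps \<epsilon> ((0::'a) - y)) * ennreal (xi_eps \<epsilon> y) \<partial>lborel) = 0"
    using ennreal_K_eps[OF e, of "0::'a"] by (simp add: ennreal_neg)
  then have "AE y::'a in lborel. ennreal (xi_eps \<epsilon> ((0::'a) - y)) * ennreal (xi_eps \<epsilon> y) = 0"
    by (subst (asm) nn_integral_0_iff_AE) auto
  then have "AE y::'a in lborel. False"
    by eventually_elim (simp add: ennreal_eq_0_iff pos)
  then have "emeasure (lborel :: 'a measure) UNIV = 0"
    by (subst (asm) AE_iff_null) (auto simp: null_sets_def)
  then show False by simp
qed

text \<open>Recentering the integration variable at x/2 lets the parallelogram identity split the
  exponent into a part in u and a part in x. Thus K_eps is Gaussian with variance 2 eps^2 in each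
  coordinate; its prefactor is carried along as \<open>K_eps \<epsilon> 0\<close>.\<close>

lemma K_eps_eq_exp:
  assumes e: "\<epsilon> > 0"
  shows "K_eps \<epsilon> (x::'a::euclidean_space) = K_eps \<epsilon> (0::'a) * exp (- (norm x)\<^sup>2 / (4 * \<epsilon>\<^sup>2))"
proof -
  have k: "xi_eps \<epsilon> (x - ((1/2) *\<^sub>R x + u)) * xi_eps \<epsilon> ((1/2) *\<^sub>R x + u)
      = xi_eps \<epsilon> (0 - u) * xi_eps \<epsilon> u * exp (- (norm x)\<^sup>2 / (4 * \<epsilon>\<^sup>2))" for u :: 'a
  proof -
    have 1: "x - ((1/2) *\<^sub>R x + u) = (1/2) *\<^sub>R x - u"
      using scaleR_left_distrib[of "1/2" "1/2" x] by (simp add: algebra_simps)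
    have "(norm ((1/2) *\<^sub>R x - u))\<^sup>2 + (norm ((1/2) *\<^sub>R x + u))\<^sup>2 = (norm x)\<^sup>2 / 2 + 2 * (norm u)\<^sup>2"
      by (simp add: power2_norm_eq_inner algebra_simps inner_commute)
    then have q: "(norm ((1/2) *\<^sub>R x + u))\<^sup>2 = (norm x)\<^sup>2 / 2 + 2 * (norm u)\<^sup>2 - (norm ((1/2) *\<^sub>R x - u))\<^sup>2"
      by linarith
    have 2: "- (norm ((1/2) *\<^sub>R x - u))\<^sup>2 / (2 * \<epsilon>\<^sup>2) + - (norm ((1/2) *\<^sub>R x + u))\<^sup>2 / (2 * \<epsilon>\<^sup>2)
      = - (norm u)\<^sup>2 / (2 * \<epsilon>\<^sup>2) + - (norm u)\<^sup>2 / (2 * \<epsilon>\<^sup>2) + - (norm x)\<^sup>2 / (4 * \<epsilon>\<^sup>2)"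
      unfolding q using e by (simp add: field_simps)
    let ?A = "xi_eps \<epsilon> (0::'a)"
    have "xi_eps \<epsilon> ((1/2) *\<^sub>R x - u) * xi_eps \<epsilon> ((1/2) *\<^sub>R x + u)
       = ?A * ?A * exp (- (norm ((1/2) *\<^sub>R x - u))\<^sup>2 / (2 * \<epsilon>\<^sup>2) + - (norm ((1/2) *\<^sub>R x + u))\<^sup>2 / (2 * \<epsilon>\<^sup>2))"
      by (simp only: xi_eps_eq_exp[OF e, of "(1/2) *\<^sub>R x - u"] xi_eps_eq_exp[OF e, of "(1/2) *\<^sub>R x + u"] exp_add mult_ac)
    also have "\<dots> = xi_eps \<epsilon> u * xi_eps \<epsilon> u * exp (- (norm x)\<^sup>2 / (4 * \<epsilon>\<^sup>2))"
      unfolding 2 by (simp only: xi_eps_eq_exp[OF e, of u] exp_add mult_ac)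
    finally show ?thesis unfolding 1 by simp
  qed
  have "K_eps \<epsilon> x = (\<integral>y. xi_eps \<epsilon> (x - y) * xi_eps \<epsilon> y \<partial>distr lborel borel ((+) ((1/2) *\<^sub>R x)))"
    unfolding K_eps_def lborel_distr_plus ..
  also have "\<dots> = (\<integral>u. xi_eps \<epsilon> (x - ((1/2) *\<^sub>R x + u)) * xi_eps \<epsilon> ((1/2) *\<^sub>R x + u) \<partial>lborel)"
    by (subst integral_distr) auto
  also have "\<dots> = K_eps \<epsilon> (0::'a) * exp (- (norm x)\<^sup>2 / (4 * \<epsilon>\<^sup>2))"
    unfolding k K_eps_def by (rule integral_mult_left_zero)
  finally show ?thesis .
qed

lemma K_eps_pos: "\<epsilon> > 0 \<Longrightarrow> K_eps \<epsilon> (x::'a::euclidean_space) > 0"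
  using K_eps_zero_pos[where 'a='a] by (subst K_eps_eq_exp) auto

lemma K_eps_nonneg [simp]: "K_eps \<epsilon> x \<ge> 0"
  unfolding K_eps_def by (intro integral_nonneg_AE) auto

lemma K_eps_le:
  assumes "\<epsilon> > 0"
  shows "K_eps \<epsilon> (x::'a::euclidean_space) \<le> K_eps \<epsilon> (0::'a)"
  unfolding K_eps_eq_exp[OF assms, of x]
  using K_eps_pos[OF assms, of "0::'a"] by (auto intro!: mult_left_le)

lemma continuous_K_eps [continuous_intros]:
  assumes "\<epsilon> > 0" "continuous_on A f"
  shows "continuous_on A (\<lambda>x. K_eps \<epsilon> (f x :: 'a::euclidean_space))"
  by (subst K_eps_eq_exp[OF assms(1)]) (use assms in \<open>auto intro!: continuous_intros\<close>)

text \<open>The derivative is at most 2 c |z| exp (- c z^2) in modulus, and 2 |z| <= 1 + z^2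
  followed by 1 + c z^2 <= exp (c z^2) bounds it by 1 + c. The constant is not sharp.\<close>

lemma exp_neg_sq_lipschitz:
  fixes c u v :: real
  assumes c: "c > 0"
  shows "\<bar>exp (- c * u\<^sup>2) - exp (- c * v\<^sup>2)\<bar> \<le> (1 + c) * \<bar>u - v\<bar>"
proof -
  have main: "\<bar>exp (- c * v\<^sup>2) - exp (- c * u\<^sup>2)\<bar> \<le> (1 + c) * \<bar>v - u\<bar>" if uv: "u < v" for u v
  proof -
    have "\<exists>z>u. z < v \<and> exp (- c * v\<^sup>2) - exp (- c * u\<^sup>2) = (v - u) * (- 2 * c * z * exp (- c * z\<^sup>2))"
      by (rule MVT2[OF uv]) (auto intro!: derivative_eq_intros)
    then obtain z where z: "exp (- c * v\<^sup>2) - exp (- c * u\<^sup>2) = (v - u) * (- 2 * c * z * exp (- c * z\<^sup>2))"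
      by blast
    have "2 * c * \<bar>z\<bar> \<le> c * (1 + z\<^sup>2)"
      using mult_left_mono[of "2 * \<bar>z\<bar>" "1 + z\<^sup>2" c] zero_le_power2[of "1 - \<bar>z\<bar>"] c by (simp add: power2_eq_square algebra_simps)
    also have "\<dots> \<le> (1 + c) * (1 + c * z\<^sup>2)"
      using c by (simp add: algebra_simps)
    also have "\<dots> \<le> (1 + c) * exp (c * z\<^sup>2)"
      using c exp_ge_add_one_self[of "c * z\<^sup>2"] by (intro mult_left_mono) auto
    finally have "2 * c * \<bar>z\<bar> * exp (- c * z\<^sup>2) \<le> (1 + c) * exp (c * z\<^sup>2) * exp (- c * z\<^sup>2)"
      by (rule mult_right_mono) auto
    also have "\<dots> = 1 + c" by (simp add: mult.assoc mult_exp_exp)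
    finally have "\<bar>- 2 * c * z * exp (- c * z\<^sup>2)\<bar> \<le> 1 + c"
      using c by (simp add: abs_mult)
    then have "\<bar>v - u\<bar> * \<bar>- 2 * c * z * exp (- c * z\<^sup>2)\<bar> \<le> \<bar>v - u\<bar> * (1 + c)"
      by (intro mult_left_mono) auto
    then show ?thesis unfolding z abs_mult by (simp add: mult.commute)
  qed
  show ?thesis using main[of u v] main[of v u]
    by (cases u v rule: linorder_cases) (auto simp: abs_minus_commute)
qed

text \<open>Gives the functions \<open>K_conv \<epsilon> m\<close> of all probability measures m one
  common Lipschitz constant. This equicontinuity later turns pointwise convergence into uniform
  convergence on compact sets.\<close>

lemma K_eps_lipschitz:
  assumes e: "\<epsilon> > 0"
  obtains L where "L \<ge> 0" "\<And>x y :: 'a::euclidean_space. \<bar>K_eps \<epsilon> x - K_eps \<epsilon> y\<bar> \<le> L * norm (x - y)"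
proof
  define c where "c = 1 / (4 * \<epsilon>\<^sup>2)"
  have c: "c > 0" using e by (simp add: c_def)
  let ?A = "K_eps \<epsilon> (0::'a)"
  note A = K_eps_zero_pos[OF e, where 'a='a]
  show "?A * (1 + c) \<ge> 0" using A c by auto
  fix x y :: 'a
  have "K_eps \<epsilon> x - K_eps \<epsilon> y = ?A * (exp (- c * (norm x)\<^sup>2) - exp (- c * (norm y)\<^sup>2))"
    by (simp add: K_eps_eq_exp[OF e, of x] K_eps_eq_exp[OF e, of y] c_def algebra_simps)
  then have "\<bar>K_eps \<epsilon> x - K_eps \<epsilon> y\<bar> = ?A * \<bar>exp (- c * (norm x)\<^sup>2) - exp (- c * (norm y)\<^sup>2)\<bar>"
    using A by (simp add: abs_mult)
  also have "\<dots> \<le> ?A * ((1 + c) * \<bar>norm x - norm y\<bar>)"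
    using exp_neg_sq_lipschitz[OF c, of "norm x" "norm y"] A by (intro mult_left_mono) auto
  also have "\<dots> \<le> ?A * ((1 + c) * norm (x - y))"
    using A c by (intro mult_left_mono norm_triangle_ineq3) auto
  finally show "\<bar>K_eps \<epsilon> x - K_eps \<epsilon> y\<bar> \<le> ?A * (1 + c) * norm (x - y)" by (simp add: mult.assoc)
qed

lemma measurable_K_eps [measurable]: "\<epsilon> > 0 \<Longrightarrow> K_eps \<epsilon> \<in> borel_measurable borel"
  by (rule borel_measurable_continuous_onI) (auto intro!: continuous_intros)

section \<open>Smoothing of finite measures: bounds, regularity, mass\<close>

context
  fixes n :: "'a::euclidean_space measure" and \<epsilon> :: real
  assumes fin: "finite_measure n" and sets_n: "sets n = sets borel" and e: "\<epsilon> > 0"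
begin

interpretation n: finite_measure n by (rule fin)

lemma integrable_K_eps: "integrable n (\<lambda>y. K_eps \<epsilon> (x - y))"
  using K_eps_le[OF e, where 'a='a] measurable_K_eps[OF e, where 'a='a] sets_n
  by (intro n.integrable_const_bound[of _ "K_eps \<epsilon> (0::'a)"]) (auto cong: measurable_cong_sets)

lemma ennreal_K_conv: "ennreal (K_conv \<epsilon> n x) = (\<integral>\<^sup>+y. ennreal (K_eps \<epsilon> (x - y)) \<partial>n)"
  unfolding K_conv_def
  by (subst nn_integral_eq_integral[OF integrable_K_eps]) auto

lemma K_conv_nonneg: "K_conv \<epsilon> n x \<ge> 0"
  unfolding K_conv_def by (intro integral_nonneg_AE) auto

lemma K_conv_le: "K_conv \<epsilon> n x \<le> K_eps \<epsilon> (0::'a) * measure n UNIV"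
proof -
  have "K_conv \<epsilon> n x \<le> (\<integral>y. K_eps \<epsilon> (0::'a) \<partial>n)"
    unfolding K_conv_def by (intro integral_mono integrable_K_eps) (auto intro: K_eps_le[OF e])
  then show ?thesis using sets_eq_imp_space_eq[OF sets_n] by (simp add: mult.commute)
qed

lemma K_conv_lipschitz:
  assumes L: "\<And>x y :: 'a. \<bar>K_eps \<epsilon> x - K_eps \<epsilon> y\<bar> \<le> L * norm (x - y)"
  shows "\<bar>K_conv \<epsilon> n x - K_conv \<epsilon> n y\<bar> \<le> L * norm (x - y) * measure n UNIV"
proof -
  have "\<bar>K_conv \<epsilon> n x - K_conv \<epsilon> n y\<bar> = \<bar>\<integral>z. K_eps \<epsilon> (x - z) - K_eps \<epsilon> (y - z) \<partial>n\<bar>"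
    unfolding K_conv_def by (simp add: integrable_K_eps)
  also have "\<dots> \<le> (\<integral>z. \<bar>K_eps \<epsilon> (x - z) - K_eps \<epsilon> (y - z)\<bar> \<partial>n)"
    by (rule integral_abs_bound)
  also have "\<dots> \<le> (\<integral>z. L * norm (x - y) \<partial>n)"
    using L[of "x - z" "y - z" for z]
    by (intro integral_mono integrable_abs Bochner_Integration.integrable_diff integrable_K_eps) auto
  also have "\<dots> = L * norm (x - y) * measure n UNIV"
    using sets_eq_imp_space_eq[OF sets_n] by (simp add: mult.commute)
  finally show ?thesis .
qed

lemma continuous_K_conv: "continuous_on UNIV (K_conv \<epsilon> n)"
proof -
  obtain L where L: "L \<ge> 0" "\<And>x y :: 'a. \<bar>K_eps \<epsilon> x - K_eps \<epsilon> y\<bar> \<le> L * norm (x - y)"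
    using K_eps_lipschitz[OF e] by blast
  have "(L * measure n UNIV)-lipschitz_on UNIV (K_conv \<epsilon> n)"
    using K_conv_lipschitz[OF L(2)] L(1) by (intro lipschitz_onI) (auto simp: dist_norm mult_ac)
  then show ?thesis by (rule lipschitz_on_continuous_on)
qed

lemma measurable_K_conv: "K_conv \<epsilon> n \<in> borel_measurable borel"
  by (rule borel_measurable_continuous_onI[OF continuous_K_conv])

text \<open>This is K_eps * n = \<xi>_eps * (\<xi>_eps * n), obtained from Tonelli, a translation by
  x' and the evenness of \<xi>. The inner integral is the density g on which the entropy bound
  rests.\<close>

lemma K_conv_double:
  "ennreal (K_conv \<epsilon> n x) = (\<integral>\<^sup>+y. ennreal (xi_eps \<epsilon> (y - x)) * (\<integral>\<^sup>+x'. ennreal (xi_eps \<epsilon> (y - x')) \<partial>n) \<partial>lborel)"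
proof -
  interpret P: pair_sigma_finite n lborel by standard
  have [measurable_cong]: "sets n = sets borel" by (rule sets_n)
  have K: "ennreal (K_eps \<epsilon> (x - x')) = (\<integral>\<^sup>+y. ennreal (xi_eps \<epsilon> (y - x)) * ennreal (xi_eps \<epsilon> (y - x')) \<partial>lborel)" for x'
    unfolding ennreal_K_eps[OF e]
    using nn_integral_lborel_translate[of "\<lambda>y. ennreal (xi_eps \<epsilon> (x - x' - y)) * ennreal (xi_eps \<epsilon> y)" "- x'"]
    by (simp add: algebra_simps xi_eps_minus_commute[of \<epsilon> x])
  have "ennreal (K_conv \<epsilon> n x) = (\<integral>\<^sup>+x'. (\<integral>\<^sup>+y. ennreal (xi_eps \<epsilon> (y - x)) * ennreal (xi_eps \<epsilon> (y - x')) \<partial>lborel) \<partial>n)"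
    unfolding ennreal_K_conv K ..
  also have "\<dots> = (\<integral>\<^sup>+y. (\<integral>\<^sup>+x'. ennreal (xi_eps \<epsilon> (y - x)) * ennreal (xi_eps \<epsilon> (y - x')) \<partial>n) \<partial>lborel)"
    by (rule P.Fubini'[symmetric]) measurable
  also have "\<dots> = (\<integral>\<^sup>+y. ennreal (xi_eps \<epsilon> (y - x)) * (\<integral>\<^sup>+x'. ennreal (xi_eps \<epsilon> (y - x')) \<partial>n) \<partial>lborel)"
    by (intro nn_integral_cong nn_integral_cmult) measurable
  finally show ?thesis .
qed

text \<open>Smoothing preserves mass; this is the normalization needed in Gibbs' inequality.\<close>

lemma nn_integral_K_conv: "(\<integral>\<^sup>+x. ennreal (K_conv \<epsilon> n x) \<partial>lborel) = emeasure n UNIV"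
proof -
  interpret P: pair_sigma_finite n "lborel :: 'a measure" by standard
  have [measurable_cong]: "sets n = sets borel" by (rule sets_n)
  have "(\<integral>\<^sup>+x. ennreal (K_conv \<epsilon> n x) \<partial>lborel)
     = (\<integral>\<^sup>+x. (\<integral>\<^sup>+y. ennreal (xi_eps \<epsilon> (y - x)) * (\<integral>\<^sup>+x'. ennreal (xi_eps \<epsilon> (y - x')) \<partial>n) \<partial>lborel) \<partial>lborel)"
    unfolding K_conv_double ..
  also have "\<dots> = (\<integral>\<^sup>+y. (\<integral>\<^sup>+x. ennreal (xi_eps \<epsilon> (y - x)) * (\<integral>\<^sup>+x'. ennreal (xi_eps \<epsilon> (y - x')) \<partial>n) \<partial>lborel) \<partial>lborel)"
    by (rule lborel_pair.Fubini') measurable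
  also have "\<dots> = (\<integral>\<^sup>+y. (\<integral>\<^sup>+x'. ennreal (xi_eps \<epsilon> (y - x')) \<partial>n) \<partial>lborel)"
  proof (intro nn_integral_cong)
    fix y :: 'a
    have "(\<integral>\<^sup>+x. ennreal (xi_eps \<epsilon> (y - x)) * (\<integral>\<^sup>+x'. ennreal (xi_eps \<epsilon> (y - x')) \<partial>n) \<partial>lborel)
       = (\<integral>\<^sup>+x. ennreal (xi_eps \<epsilon> (x - y)) \<partial>lborel) * (\<integral>\<^sup>+x'. ennreal (xi_eps \<epsilon> (y - x')) \<partial>n)"
      by (subst nn_integral_multc) (auto simp: xi_eps_minus_commute[of _ y])
    then show "(\<integral>\<^sup>+x. ennreal (xi_eps \<epsilon> (y - x)) * (\<integral>\<^sup>+x'. ennreal (xi_eps \<epsilon> (y - x')) \<partial>n) \<partial>lborel)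
       = (\<integral>\<^sup>+x'. ennreal (xi_eps \<epsilon> (y - x')) \<partial>n)"
      by (simp add: nn_integral_xi_eps_translate[OF e])
  qed
  also have "\<dots> = (\<integral>\<^sup>+x'. (\<integral>\<^sup>+y. ennreal (xi_eps \<epsilon> (y - x')) \<partial>lborel) \<partial>n)"
    by (rule P.Fubini') measurable
  also have "\<dots> = emeasure n UNIV"
    using sets_eq_imp_space_eq[OF sets_n] by (simp add: nn_integral_xi_eps_translate[OF e])
  finally show ?thesis .
qed

end

lemma P2_D:
  assumes "m \<in> P2"
  shows "prob_space m" "finite_measure m" "sets m = sets borel" "space m = UNIV" "integrable m (\<lambda>x. (norm x)\<^sup>2)"
    "measure m UNIV = 1" "emeasure m UNIV = 1"
proof -
  show 1: "prob_space m" and 2: "sets m = sets borel" and "integrable m (\<lambda>x. (norm x)\<^sup>2)"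
    using assms by (auto simp: P2_def)
  show 3: "space m = UNIV" using sets_eq_imp_space_eq[OF 2] by simp
  interpret prob_space m by (rule 1)
  show "finite_measure m" by (rule finite_measure_axioms)
  show "measure m UNIV = 1" "emeasure m UNIV = 1" using prob_space emeasure_space_1 3 by auto
qed

text \<open>From |x - y|^2 <= 2 |x|^2 + 2 |y|^2 the kernel dominates a product of a function of x
  and a function of y, and the y-factor is integrated out. The constant depends on m, so the bound
  yields integrability of the logarithm but no uniform estimate.\<close>

lemma K_conv_lower:
  assumes m: "m \<in> P2" and e: "\<epsilon> > 0"
  obtains c where "c > 0" "\<And>x::'a::euclidean_space. K_conv \<epsilon> m x \<ge> c * exp (- (norm x)\<^sup>2 / (2 * \<epsilon>\<^sup>2))"
proof -
  note D = P2_D[OF m]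
  interpret prob_space m by (rule D)
  have [measurable_cong]: "sets m = sets borel" by (rule D)
  let ?I = "\<integral>y. exp (- (norm y)\<^sup>2 / (2 * \<epsilon>\<^sup>2)) \<partial>m"
  have int: "integrable m (\<lambda>y. exp (- (norm y)\<^sup>2 / (2 * \<epsilon>\<^sup>2)))"
    by (rule integrable_const_bound[of _ 1]) auto
  have "?I > 0"
    by (rule expectation_greater[OF int]) auto
  note A = K_eps_zero_pos[OF e, where 'a='a]
  show ?thesis
  proof
    show "K_eps \<epsilon> (0::'a) * ?I > 0" using A \<open>?I > 0\<close> by simp
    fix x :: 'a
    have "K_eps \<epsilon> (0::'a) * ?I * exp (- (norm x)\<^sup>2 / (2 * \<epsilon>\<^sup>2))
       = (\<integral>y. K_eps \<epsilon> (0::'a) * exp (- (norm x)\<^sup>2 / (2 * \<epsilon>\<^sup>2)) * exp (- (norm y)\<^sup>2 / (2 * \<epsilon>\<^sup>2)) \<partial>m)"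
      by simp
    also have "\<dots> \<le> (\<integral>y. K_eps \<epsilon> (x - y) \<partial>m)"
    proof (intro integral_mono integrable_mult_right int integrable_K_eps D(2,3) e)
      fix y
      have "(norm (x + y))\<^sup>2 + (norm (x - y))\<^sup>2 = 2 * (norm x)\<^sup>2 + 2 * (norm y)\<^sup>2"
        by (simp add: power2_norm_eq_inner algebra_simps inner_commute)
      then have "(norm (x - y))\<^sup>2 \<le> 2 * (norm x)\<^sup>2 + 2 * (norm y)\<^sup>2"
        using zero_le_power2[of "norm (x + y)"] by linarith
      then have "\<epsilon>\<^sup>2 * (norm (x - y))\<^sup>2 \<le> \<epsilon>\<^sup>2 * (2 * (norm x)\<^sup>2 + 2 * (norm y)\<^sup>2)"
        by (intro mult_left_mono) auto
      then have "- (norm x)\<^sup>2 / (2 * \<epsilon>\<^sup>2) + - (norm y)\<^sup>2 / (2 * \<epsilon>\<^sup>2) \<le> - (norm (x - y))\<^sup>2 / (4 * \<epsilon>\<^sup>2)"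
        using e by (simp add: field_simps)
      then show "K_eps \<epsilon> (0::'a) * exp (- (norm x)\<^sup>2 / (2 * \<epsilon>\<^sup>2)) * exp (- (norm y)\<^sup>2 / (2 * \<epsilon>\<^sup>2)) \<le> K_eps \<epsilon> (x - y)"
        using A by (simp only: K_eps_eq_exp[OF e, of "x - y"] mult.assoc mult_exp_exp mult_le_cancel_left_pos exp_le_cancel_iff)
    qed
    finally show "K_conv \<epsilon> m x \<ge> K_eps \<epsilon> (0::'a) * ?I * exp (- (norm x)\<^sup>2 / (2 * \<epsilon>\<^sup>2))"
      unfolding K_conv_def .
  qed
qed

lemma K_conv_pos:
  assumes m: "m \<in> P2" and e: "\<epsilon> > 0"
  shows "K_conv \<epsilon> m x > 0"
proof -
  obtain c where c: "c > 0" "K_conv \<epsilon> m x \<ge> c * exp (- (norm x)\<^sup>2 / (2 * \<epsilon>\<^sup>2))"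
    using K_conv_lower[OF m e] by blast
  have "c * exp (- (norm x)\<^sup>2 / (2 * \<epsilon>\<^sup>2)) > 0" using c(1) by simp
  then show ?thesis using c(2) by linarith
qed

lemma integrable_quadratic_bound:
  fixes f :: "'a::euclidean_space \<Rightarrow> real"
  assumes m: "m \<in> P2" and f: "f \<in> borel_measurable borel" and b: "\<And>x. \<bar>f x\<bar> \<le> A + B * (norm x)\<^sup>2"
  shows "integrable m f"
proof (rule Bochner_Integration.integrable_bound)
  note D = P2_D[OF m]
  interpret prob_space m by (rule D)
  show "integrable m (\<lambda>x. A + B * (norm x)\<^sup>2)" using D(5) by auto
  show "f \<in> borel_measurable m" using f D(3) by (simp cong: measurable_cong_sets)
  show "AE x in m. norm (f x) \<le> norm (A + B * (norm x)\<^sup>2)" using b by (auto intro!: AE_I2 order_trans[OF b])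
qed

lemma integrable_ln_K_conv:
  assumes m: "m \<in> P2" and e: "\<epsilon> > 0"
  shows "integrable m (\<lambda>x::'a::euclidean_space. ln (K_conv \<epsilon> m x))"
proof -
  note D = P2_D[OF m]
  obtain c where c: "c > 0" "\<And>x. K_conv \<epsilon> m x \<ge> c * exp (- (norm x)\<^sup>2 / (2 * \<epsilon>\<^sup>2))"
    using K_conv_lower[OF m e] by blast
  let ?K = "K_eps \<epsilon> (0::'a)"
  note [measurable] = measurable_K_conv[OF D(2,3) e]
  show ?thesis
  proof (rule integrable_quadratic_bound[OF m, of _ "\<bar>ln c\<bar> + \<bar>ln ?K\<bar>" "1 / (2 * \<epsilon>\<^sup>2)"])
    fix x :: 'a
    have "ln (c * exp (- (norm x)\<^sup>2 / (2 * \<epsilon>\<^sup>2))) \<le> ln (K_conv \<epsilon> m x)"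
      using c by (intro ln_mono) auto
    then have 1: "ln c - (norm x)\<^sup>2 / (2 * \<epsilon>\<^sup>2) \<le> ln (K_conv \<epsilon> m x)"
      using c(1) by (simp add: ln_mult)
    have 2: "ln (K_conv \<epsilon> m x) \<le> ln ?K"
      using K_conv_pos[OF m e] K_conv_le[OF D(2,3) e] D(6) by (intro ln_mono) auto
    have "(norm x)\<^sup>2 / (2 * \<epsilon>\<^sup>2) \<ge> 0" by simp
    with 1 2 have "\<bar>ln (K_conv \<epsilon> m x)\<bar> \<le> \<bar>ln c\<bar> + \<bar>ln ?K\<bar> + (norm x)\<^sup>2 / (2 * \<epsilon>\<^sup>2)" by linarith
    then show "\<bar>ln (K_conv \<epsilon> m x)\<bar> \<le> \<bar>ln c\<bar> + \<bar>ln ?K\<bar> + 1 / (2 * \<epsilon>\<^sup>2) * (norm x)\<^sup>2" by simp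
  qed measurable
qed

section \<open>The dual lower bound for the smoothed entropy\<close>

text \<open>Adding ln s <= s - 1 at s = g/h and at s = exp t / g eliminates ln g.\<close>

lemma two_step_ln_bound:
  fixes g h t :: real
  assumes "g > 0" "h > 0"
  shows "t + 2 \<le> ln h + g / h + exp t / g"
proof -
  have "ln (g / h) \<le> g / h - 1" "ln (exp t / g) \<le> exp t / g - 1"
    using assms by (auto intro!: ln_le_minus_one)
  then show ?thesis using assms by (simp add: ln_div)
qed

text \<open>With \<open>g = \<xi>\<^sub>\<epsilon> * n\<close>, the bound \<open>ln (h x) - \<phi> y \<ge> 2 - g y / h x - exp (\<phi> y) / g y\<close> is integrated
  against \<open>\<xi>\<^sub>\<epsilon>(y - x) dy n(dx)\<close>: the two quotients contribute at most \<open>n(UNIV)\<close> and \<open>Z\<close>. Allowing \<open>h\<close> to exceed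
  \<open>K\<^sub>\<epsilon> * n\<close> is what makes the bound applicable to a part \<open>n\<close> of the measure under consideration.\<close>

lemma entropy_lower_bound:
  fixes n :: "'a::euclidean_space measure" and h \<phi> :: "'a \<Rightarrow> real"
  assumes fin: "finite_measure n" and sets_n: "sets n = sets borel" and e: "\<epsilon> > 0"
    and h[measurable]: "h \<in> borel_measurable borel" and hpos: "\<And>x. h x > 0"
    and hK: "\<And>x. K_conv \<epsilon> n x \<le> h x" and int_h: "integrable n (\<lambda>x. ln (h x))"
    and phi[measurable]: "\<phi> \<in> borel_measurable borel"
    and int_phi: "integrable (n \<Otimes>\<^sub>M gauss_meas \<epsilon>) (\<lambda>p. \<phi> (fst p + snd p))"
    and Z: "(\<integral>\<^sup>+y. ennreal (exp (\<phi> y)) \<partial>lborel) \<le> ennreal Z" "Z \<ge> 0"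
  shows "(\<integral>x. ln (h x) \<partial>n) \<ge> (\<integral>p. \<phi> (fst p + snd p) \<partial>(n \<Otimes>\<^sub>M gauss_meas \<epsilon>)) + measure n UNIV - Z"
proof (cases "emeasure n UNIV = 0")
  \<comment> \<open>The null measure is treated apart: the other case divides by g, which is
    positive only if n has mass.\<close>
  case True
  have sp: "space n = UNIV" using sets_eq_imp_space_eq[OF sets_n] by simp
  have null: "AE x in n. False"
    using True sp by (subst AE_iff_null) (auto simp: null_sets_def sets_n)
  have 1: "(\<integral>x. ln (h x) \<partial>n) = 0" by (rule integral_eq_zero_AE) (use null in eventually_elim, auto)
  interpret N: prob_space "gauss_meas \<epsilon> :: 'a measure" by (rule prob_space_gauss_meas[OF e])
  interpret n: finite_measure n by (rule fin)
  interpret P: pair_sigma_finite n "gauss_meas \<epsilon> :: 'a measure" by standard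
  have 2: "(\<integral>p. \<phi> (fst p + snd p) \<partial>(n \<Otimes>\<^sub>M gauss_meas \<epsilon>)) = 0"
    using P.integral_fst'[OF int_phi] by (subst (asm) integral_eq_zero_AE) (use null in \<open>eventually_elim, auto\<close>)
  show ?thesis using 1 2 True Z(2) by (simp add: measure_def)
next
  case False
  have sp: "space n = UNIV" using sets_eq_imp_space_eq[OF sets_n] by simp
  have [measurable_cong]: "sets n = sets borel" by (rule sets_n)
  let ?N = "gauss_meas \<epsilon> :: 'a measure"
  interpret N: prob_space ?N by (rule prob_space_gauss_meas[OF e])
  interpret n: finite_measure n by (rule fin)
  interpret P: pair_sigma_finite n ?N by standard
  interpret Q: pair_sigma_finite n "lborel :: 'a measure" by standard
  define G where "G y = (\<integral>\<^sup>+x'. ennreal (xi_eps \<epsilon> (y - x')) \<partial>n)" for y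
  have G[measurable]: "G \<in> borel_measurable borel" unfolding G_def by measurable
  define g where "g y = enn2real (G y)" for y
  have g[measurable]: "g \<in> borel_measurable borel" unfolding g_def by measurable
  have Gfin: "G y < \<infinity>" for y
  proof -
    have "G y \<le> (\<integral>\<^sup>+x'. ennreal (xi_eps \<epsilon> (0::'a)) \<partial>n)"
      unfolding G_def by (intro nn_integral_mono ennreal_leI xi_eps_le[OF e])
    also have "\<dots> < \<infinity>"
      by (simp add: ennreal_mult_less_top n.emeasure_eq_measure)
    finally show ?thesis .
  qed
  then have Gg: "G y = ennreal (g y)" for y by (simp add: g_def)
  have pos: "\<not> xi_eps \<epsilon> y \<le> 0" for y :: 'a
    using xi_eps_pos[OF e, of y] by linarith
  have "G y \<noteq> 0" for y
  proof
    assume "G y = 0"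
    then have "AE x' in n. ennreal (xi_eps \<epsilon> (y - x')) = 0"
      unfolding G_def by (subst (asm) nn_integral_0_iff_AE) auto
    then have "AE x' in n. False" by eventually_elim (simp add: ennreal_eq_0_iff pos)
    then have "emeasure n UNIV = 0" using sp by (subst (asm) AE_iff_null) (auto simp: null_sets_def)
    then show False using False by simp
  qed
  then have gpos: "g y > 0" for y
    using Gg[of y] by (metis ennreal_neg linorder_not_le)
  let ?r1 = "\<lambda>p. g (fst p + snd p) / h (fst p)"
  let ?r2 = "\<lambda>p. exp (\<phi> (fst p + snd p)) / g (fst p + snd p)"
  \<comment> \<open>Integrating out z first turns the numerator into K_eps * n by
    \<open>K_conv_double\<close>, so the inner integral is at most 1 by \<open>hK\<close>.\<close>
  have nn1: "(\<integral>\<^sup>+p. ennreal (?r1 p) \<partial>(n \<Otimes>\<^sub>M ?N)) \<le> emeasure n UNIV"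
  proof -
    have "(\<integral>\<^sup>+p. ennreal (?r1 p) \<partial>(n \<Otimes>\<^sub>M ?N)) = (\<integral>\<^sup>+x. (\<integral>\<^sup>+z. ennreal (g (x + z) / h x) \<partial>?N) \<partial>n)"
      by (subst N.nn_integral_fst[symmetric]) auto
    also have "\<dots> \<le> (\<integral>\<^sup>+x. 1 \<partial>n)"
    proof (intro nn_integral_mono)
      fix x
      have "(\<integral>\<^sup>+z. ennreal (g (x + z) / h x) \<partial>?N) = (\<integral>\<^sup>+z. ennreal (xi_eps \<epsilon> z) * (G (x + z) / ennreal (h x)) \<partial>lborel)"
        using hpos[of x] gpos by (subst nn_integral_gauss_meas) (auto simp: Gg divide_ennreal less_imp_le)
      also have "\<dots> = (\<integral>\<^sup>+y. ennreal (xi_eps \<epsilon> (y - x)) * (G y / ennreal (h x)) \<partial>lborel)"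
        by (subst (2) nn_integral_lborel_translate[of _ x, symmetric]) auto
      also have "\<dots> = (\<integral>\<^sup>+y. ennreal (xi_eps \<epsilon> (y - x)) * G y \<partial>lborel) / ennreal (h x)"
        by (subst nn_integral_divide[symmetric]) (auto simp: ennreal_times_divide)
      also have "\<dots> = ennreal (K_conv \<epsilon> n x) / ennreal (h x)"
        unfolding K_conv_double[OF fin sets_n e] G_def ..
      also have "\<dots> = ennreal (K_conv \<epsilon> n x / h x)"
        using hpos[of x] K_conv_nonneg[OF fin sets_n e] by (simp add: divide_ennreal)
      also have "\<dots> \<le> 1" using hpos[of x] hK[of x] by simp
      finally show "(\<integral>\<^sup>+z. ennreal (g (x + z) / h x) \<partial>?N) \<le> 1" .
    qed
    also have "\<dots> = emeasure n UNIV" using sp by simp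
    finally show ?thesis .
  qed
  \<comment> \<open>Here x is integrated first: the kernel then reproduces g, which cancels the
    denominator and leaves exp \<phi>.\<close>
  have nn2: "(\<integral>\<^sup>+p. ennreal (?r2 p) \<partial>(n \<Otimes>\<^sub>M ?N)) \<le> ennreal Z"
  proof -
    let ?q = "\<lambda>y. ennreal (exp (\<phi> y) / g y)"
    have "(\<integral>\<^sup>+p. ennreal (?r2 p) \<partial>(n \<Otimes>\<^sub>M ?N)) = (\<integral>\<^sup>+x. (\<integral>\<^sup>+z. ?q (x + z) \<partial>?N) \<partial>n)"
      by (subst N.nn_integral_fst[symmetric]) auto
    also have "\<dots> = (\<integral>\<^sup>+x. (\<integral>\<^sup>+y. ennreal (xi_eps \<epsilon> (y - x)) * ?q y \<partial>lborel) \<partial>n)"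
    proof (intro nn_integral_cong)
      fix x
      show "(\<integral>\<^sup>+z. ?q (x + z) \<partial>?N) = (\<integral>\<^sup>+y. ennreal (xi_eps \<epsilon> (y - x)) * ?q y \<partial>lborel)"
        by (subst nn_integral_gauss_meas, simp, subst (2) nn_integral_lborel_translate[of _ x, symmetric]) auto
    qed
    also have "\<dots> = (\<integral>\<^sup>+y. (\<integral>\<^sup>+x. ennreal (xi_eps \<epsilon> (y - x)) * ?q y \<partial>n) \<partial>lborel)"
      by (rule Q.Fubini'[symmetric]) measurable
    also have "\<dots> = (\<integral>\<^sup>+y. ennreal (exp (\<phi> y)) \<partial>lborel)"
    proof (intro nn_integral_cong)
      fix y
      have "(\<integral>\<^sup>+x. ennreal (xi_eps \<epsilon> (y - x)) * ?q y \<partial>n) = G y * ?q y"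
        unfolding G_def by (rule nn_integral_multc) measurable
      also have "\<dots> = ennreal (exp (\<phi> y))"
        using gpos[of y] by (simp add: Gg ennreal_mult'[symmetric])
      finally show "(\<integral>\<^sup>+x. ennreal (xi_eps \<epsilon> (y - x)) * ?q y \<partial>n) = ennreal (exp (\<phi> y))" .
    qed
    finally show ?thesis using Z(1) by simp
  qed
  have r1: "integrable (n \<Otimes>\<^sub>M ?N) ?r1"
    using hpos gpos le_less_trans[OF nn1, of \<infinity>]
    by (intro integrableI_nonneg) (auto simp: less_imp_le n.emeasure_eq_measure)
  have r2: "integrable (n \<Otimes>\<^sub>M ?N) ?r2"
    using gpos le_less_trans[OF nn2, of \<infinity>]
    by (intro integrableI_nonneg) (auto simp: less_imp_le)
  have i1: "(\<integral>p. ?r1 p \<partial>(n \<Otimes>\<^sub>M ?N)) \<le> measure n UNIV"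
    using nn1 hpos gpos nn_integral_eq_integral[OF r1]
    by (simp add: less_imp_le n.emeasure_eq_measure)
  have i2: "(\<integral>p. ?r2 p \<partial>(n \<Otimes>\<^sub>M ?N)) \<le> Z"
    using nn2 Z(2) gpos nn_integral_eq_integral[OF r2]
    by (simp add: less_imp_le)
  have dist: "distr (n \<Otimes>\<^sub>M ?N) n fst = n" by (rule N.distr_pair_fst)
  have lh: "integrable (n \<Otimes>\<^sub>M ?N) (\<lambda>p. ln (h (fst p)))"
    using int_h by (subst (asm) dist[symmetric], subst (asm) integrable_distr_eq) auto
  have lhe: "(\<integral>p. ln (h (fst p)) \<partial>(n \<Otimes>\<^sub>M ?N)) = (\<integral>x. ln (h x) \<partial>n)"
    by (subst (2) dist[symmetric], subst integral_distr) auto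
  have "emeasure (n \<Otimes>\<^sub>M ?N) (UNIV \<times> UNIV) = emeasure n UNIV * emeasure ?N UNIV"
    by (rule N.emeasure_pair_measure_Times) auto
  then have em: "emeasure (n \<Otimes>\<^sub>M ?N) (space (n \<Otimes>\<^sub>M ?N)) = emeasure n UNIV"
    using N.emeasure_space_1 by (simp add: space_pair_measure sp)
  then interpret PP: finite_measure "n \<Otimes>\<^sub>M ?N" using n.emeasure_finite[of UNIV] by (intro finite_measureI) auto
  \<comment> \<open>The constant 2 contributes twice the mass of n; one of the two copies pays for
    the first quotient.\<close>
  have "(\<integral>p. \<phi> (fst p + snd p) + 2 \<partial>(n \<Otimes>\<^sub>M ?N)) \<le> (\<integral>p. ln (h (fst p)) + ?r1 p + ?r2 p \<partial>(n \<Otimes>\<^sub>M ?N))"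
    using int_phi lh r1 r2 two_step_ln_bound[OF gpos hpos]
    by (intro integral_mono Bochner_Integration.integrable_add) auto
  also have "\<dots> = (\<integral>x. ln (h x) \<partial>n) + (\<integral>p. ?r1 p \<partial>(n \<Otimes>\<^sub>M ?N)) + (\<integral>p. ?r2 p \<partial>(n \<Otimes>\<^sub>M ?N))"
    using lh r1 r2 by (simp add: lhe)
  also have "(\<integral>p. \<phi> (fst p + snd p) + 2 \<partial>(n \<Otimes>\<^sub>M ?N)) = (\<integral>p. \<phi> (fst p + snd p) \<partial>(n \<Otimes>\<^sub>M ?N)) + 2 * measure n UNIV"
    using int_phi em by (simp add: measure_def)
  finally show ?thesis using i1 i2 by linarith
qed

text \<open>The mass (\<pi>/c)^(d/2) of the reference measure \<gamma>, with \<pi> the number here;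
  the first argument only fixes the space.\<close>

definition gauss_const :: "'a::euclidean_space itself \<Rightarrow> real \<Rightarrow> real" where
  "gauss_const _ c = (\<integral>y. exp (- c * (norm (y::'a))\<^sup>2) \<partial>lborel)"

lemma integrable_exp_bounded_gauss:
  fixes b :: "'a::euclidean_space \<Rightarrow> real"
  assumes [measurable]: "b \<in> borel_measurable borel" and B: "\<And>x. \<bar>b x\<bar> \<le> B" and c: "c > 0"
  shows "integrable lborel (\<lambda>y. exp (b y - c * (norm y)\<^sup>2))"
proof (rule Bochner_Integration.integrable_bound)
  show "integrable lborel (\<lambda>y::'a. exp B * exp (- c * (norm y)\<^sup>2))"
    by (intro integrable_mult_right integrable_exp_neg_sq c)
  show "AE y in lborel. norm (exp (b y - c * (norm y)\<^sup>2)) \<le> norm (exp B * exp (- c * (norm y)\<^sup>2))"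
    using B by (auto simp: mult_exp_exp abs_le_iff intro!: AE_I2)
qed auto

text \<open>Takes \<phi> = b - c |y|^2. The quadratic term makes exp \<phi> integrable for every
  bounded b, and its Gaussian average is known exactly, so that only b remains under the
  smoothing.\<close>

lemma entropy_lower_bound_gauss:
  fixes n :: "'a::euclidean_space measure" and h b :: "'a \<Rightarrow> real"
  assumes fin: "finite_measure n" and sets_n: "sets n = sets borel" and e: "\<epsilon> > 0"
    and h: "h \<in> borel_measurable borel" "\<And>x. h x > 0"
    and hK: "\<And>x. K_conv \<epsilon> n x \<le> h x" and int_h: "integrable n (\<lambda>x. ln (h x))"
    and int2: "integrable n (\<lambda>x. (norm x)\<^sup>2)"
    and b[measurable]: "b \<in> borel_measurable borel" and B: "\<And>x. \<bar>b x\<bar> \<le> B" and c: "c > 0"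
  shows "(\<integral>x. ln (h x) \<partial>n) \<ge> (\<integral>x. (\<integral>z. b (x + z) \<partial>gauss_meas \<epsilon>) \<partial>n) - c * (\<integral>x. (norm x)\<^sup>2 \<partial>n)
     - c * \<epsilon>\<^sup>2 * gauss_moment TYPE('a) * measure n UNIV + measure n UNIV
     - (\<integral>y. exp (b y - c * (norm y)\<^sup>2) \<partial>lborel)"
proof -
  let ?N = "gauss_meas \<epsilon> :: 'a measure"
  interpret N: prob_space ?N by (rule prob_space_gauss_meas[OF e])
  interpret n: finite_measure n by (rule fin)
  interpret P: pair_sigma_finite n ?N by standard
  have sp: "space n = UNIV" using sets_eq_imp_space_eq[OF sets_n] by simp
  have [measurable_cong]: "sets n = sets borel" by (rule sets_n)
  have "emeasure (n \<Otimes>\<^sub>M ?N) (UNIV \<times> UNIV) = emeasure n UNIV * emeasure ?N UNIV"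
    by (rule N.emeasure_pair_measure_Times) auto
  then have em: "emeasure (n \<Otimes>\<^sub>M ?N) (space (n \<Otimes>\<^sub>M ?N)) = emeasure n UNIV"
    using N.emeasure_space_1 by (simp add: space_pair_measure sp)
  then interpret PP: finite_measure "n \<Otimes>\<^sub>M ?N" using n.emeasure_finite[of UNIV] by (intro finite_measureI) auto
  define \<phi> where "\<phi> y = b y - c * (norm y)\<^sup>2" for y
  have ib: "integrable (n \<Otimes>\<^sub>M ?N) (\<lambda>p. b (fst p + snd p))"
    using B by (intro PP.integrable_const_bound[of _ B]) auto
  have distf: "distr (n \<Otimes>\<^sub>M ?N) n fst = n" by (rule N.distr_pair_fst)
  have i1: "integrable (n \<Otimes>\<^sub>M ?N) (\<lambda>p. (norm (fst p))\<^sup>2)"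
    using int2 by (subst (asm) distf[symmetric], subst (asm) integrable_distr_eq) auto
  have i2: "integrable (n \<Otimes>\<^sub>M ?N) (\<lambda>p. (norm (snd p))\<^sup>2)"
  proof (rule integrableI_nonneg)
    have "(\<integral>\<^sup>+p. ennreal ((norm (snd p))\<^sup>2) \<partial>(n \<Otimes>\<^sub>M ?N)) = (\<integral>\<^sup>+x. (\<integral>\<^sup>+z. ennreal ((norm z)\<^sup>2) \<partial>?N) \<partial>n)"
      by (subst N.nn_integral_fst[symmetric]) auto
    also have "\<dots> < \<infinity>" using integrable_gauss_sq[OF e, where 'a='a] n.emeasure_finite[of UNIV]
      by (subst nn_integral_eq_integral) (auto simp: sp ennreal_mult_less_top n.emeasure_eq_measure)
    finally show "(\<integral>\<^sup>+p. ennreal ((norm (snd p))\<^sup>2) \<partial>(n \<Otimes>\<^sub>M ?N)) < \<infinity>" .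
  qed auto
  have i3: "integrable (n \<Otimes>\<^sub>M ?N) (\<lambda>p. (norm (fst p + snd p))\<^sup>2)"
  proof (rule Bochner_Integration.integrable_bound)
    show "integrable (n \<Otimes>\<^sub>M ?N) (\<lambda>p. 2 * (norm (fst p))\<^sup>2 + 2 * (norm (snd p))\<^sup>2)"
      using i1 i2 by auto
    show "AE p in n \<Otimes>\<^sub>M ?N. norm ((norm (fst p + snd p))\<^sup>2) \<le> norm (2 * (norm (fst p))\<^sup>2 + 2 * (norm (snd p))\<^sup>2)"
    proof (intro AE_I2)
      fix p :: "'a \<times> 'a"
      have "(norm (fst p + snd p))\<^sup>2 + (norm (fst p - snd p))\<^sup>2 = 2 * (norm (fst p))\<^sup>2 + 2 * (norm (snd p))\<^sup>2"
        by (simp add: power2_norm_eq_inner algebra_simps inner_commute)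
      then have "(norm (fst p + snd p))\<^sup>2 \<le> 2 * (norm (fst p))\<^sup>2 + 2 * (norm (snd p))\<^sup>2"
        using zero_le_power2[of "norm (fst p - snd p)"] by linarith
      then show "norm ((norm (fst p + snd p))\<^sup>2) \<le> norm (2 * (norm (fst p))\<^sup>2 + 2 * (norm (snd p))\<^sup>2)" by simp
    qed
  qed auto
  have int_phi: "integrable (n \<Otimes>\<^sub>M ?N) (\<lambda>p. \<phi> (fst p + snd p))"
    unfolding \<phi>_def using ib i3 by auto
  have phi: "\<phi> \<in> borel_measurable borel" unfolding \<phi>_def by measurable
  let ?Z = "\<integral>y. exp (b y - c * (norm y)\<^sup>2) \<partial>lborel"
  have Z: "(\<integral>\<^sup>+y. ennreal (exp (\<phi> y)) \<partial>lborel) \<le> ennreal ?Z" "?Z \<ge> 0"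
    unfolding \<phi>_def using integrable_exp_bounded_gauss[OF b B c] by (auto simp: nn_integral_eq_integral)
  have "(\<integral>p. \<phi> (fst p + snd p) \<partial>(n \<Otimes>\<^sub>M ?N))
     = (\<integral>p. b (fst p + snd p) \<partial>(n \<Otimes>\<^sub>M ?N)) - c * (\<integral>p. (norm (fst p + snd p))\<^sup>2 \<partial>(n \<Otimes>\<^sub>M ?N))"
    unfolding \<phi>_def using ib i3 by simp
  also have "(\<integral>p. b (fst p + snd p) \<partial>(n \<Otimes>\<^sub>M ?N)) = (\<integral>x. (\<integral>z. b (x + z) \<partial>?N) \<partial>n)"
    using P.integral_fst'[OF ib] by simp
  also have "(\<integral>p. (norm (fst p + snd p))\<^sup>2 \<partial>(n \<Otimes>\<^sub>M ?N)) = (\<integral>x. (norm x)\<^sup>2 + \<epsilon>\<^sup>2 * gauss_moment TYPE('a) \<partial>n)"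
    using P.integral_fst'[OF i3] by (simp add: integral_gauss_sq_shift[OF e])
  also have "\<dots> = (\<integral>x. (norm x)\<^sup>2 \<partial>n) + \<epsilon>\<^sup>2 * gauss_moment TYPE('a) * measure n UNIV"
    using int2 by (simp add: sp mult.commute)
  finally show ?thesis
    using entropy_lower_bound[OF fin sets_n e h hK int_h phi int_phi Z] by (simp add: algebra_simps)
qed

lemma entropy_coercive:
  assumes m: "(m :: 'a::euclidean_space measure) \<in> P2" and e: "\<epsilon> > 0" and c: "c > 0"
  shows "(\<integral>x. ln (K_conv \<epsilon> m x) \<partial>m) \<ge> - c * (\<integral>x. (norm x)\<^sup>2 \<partial>m)
     - c * \<epsilon>\<^sup>2 * gauss_moment TYPE('a) - gauss_const TYPE('a) c"
  using entropy_lower_bound_gauss[OF P2_D(2,3)[OF m] e measurable_K_conv[OF P2_D(2,3)[OF m] e] K_conv_pos[OF m e]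
    order_refl integrable_ln_K_conv[OF m e] P2_D(5)[OF m], of "\<lambda>_. 0" 0 c] c P2_D(6)[OF m]
  by (simp add: gauss_const_def)

text \<open>The dual bound is applied to n = w m with the larger function h = K_eps * m and with b =
  -\<kappa>. The price \<kappa> is charged only to the mass of n, while the constant coming from
  \<gamma> is damped to exp (-\<kappa>) times its mass.\<close>

lemma entropy_tail:
  fixes w :: "'a::euclidean_space \<Rightarrow> real"
  assumes m: "m \<in> P2" and e: "\<epsilon> > 0" and c: "c > 0"
    and w[measurable]: "w \<in> borel_measurable borel" and w01: "\<And>x. 0 \<le> w x" "\<And>x. w x \<le> 1"
  shows "(\<integral>x. w x * ln (K_conv \<epsilon> m x) \<partial>m) \<ge> - c * (\<integral>x. w x * (norm x)\<^sup>2 \<partial>m)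
     - (\<kappa> + c * \<epsilon>\<^sup>2 * gauss_moment TYPE('a)) * (\<integral>x. w x \<partial>m) - exp (- \<kappa>) * gauss_const TYPE('a) c"
proof -
  note D = P2_D[OF m]
  interpret m: prob_space m by (rule D)
  have [measurable_cong]: "sets m = sets borel" by (rule D)
  note Km[measurable] = measurable_K_conv[OF D(2,3) e]
  define n where "n = density m (\<lambda>x. ennreal (w x))"
  have sn: "sets n = sets borel" unfolding n_def using D(3) by simp
  have spn: "space n = UNIV" using D(4) by (simp add: n_def)
  have iw: "integrable m w" using w01 by (intro m.integrable_const_bound[of _ 1]) auto
  have en: "emeasure n UNIV = ennreal (\<integral>x. w x \<partial>m)"
    using w01 D(4) sets.top[of m] unfolding n_def
    by (subst emeasure_density) (auto simp: nn_integral_eq_integral[OF iw])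
  have fn: "finite_measure n" by (rule finite_measureI) (simp add: spn en)
  have mn: "measure n UNIV = (\<integral>x. w x \<partial>m)" using en w01 by (simp add: measure_def integral_nonneg_AE)
  have hK: "K_conv \<epsilon> n x \<le> K_conv \<epsilon> m x" for x
  proof -
    have "K_conv \<epsilon> n x = (\<integral>y. w y *\<^sub>R K_eps \<epsilon> (x - y) \<partial>m)"
      unfolding K_conv_def n_def using w01 measurable_K_eps[OF e, where 'a='a]
      by (subst integral_density) (auto intro!: AE_I2)
    also have "\<dots> \<le> (\<integral>y. K_eps \<epsilon> (x - y) \<partial>m)"
    proof (rule integral_mono)
      show "integrable m (\<lambda>y. w y *\<^sub>R K_eps \<epsilon> (x - y))"
        using w01 measurable_K_eps[OF e, where 'a='a]
        by (intro Bochner_Integration.integrable_bound[OF integrable_K_eps[OF D(2,3) e, of x]])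
           (auto intro!: AE_I2 simp: abs_mult mult_left_le_one_le)
      show "w y *\<^sub>R K_eps \<epsilon> (x - y) \<le> K_eps \<epsilon> (x - y)" for y
        using w01[of y] by (simp add: mult_left_le_one_le)
    qed (rule integrable_K_eps[OF D(2,3) e])
    finally show ?thesis unfolding K_conv_def .
  qed
  have dens: "integrable n f \<longleftrightarrow> integrable m (\<lambda>x. w x * f x)" "(\<integral>x. f x \<partial>n) = (\<integral>x. w x * f x \<partial>m)"
    if "f \<in> borel_measurable borel" for f :: "'a \<Rightarrow> real"
    unfolding n_def using that w01 by (auto simp: integrable_density integral_density)
  have bnd: "integrable m (\<lambda>x. w x * f x)" if "integrable m f" for f :: "'a \<Rightarrow> real"
    using w01 that by (intro Bochner_Integration.integrable_bound[OF that])
      (auto intro!: AE_I2 simp: abs_mult mult_left_le_one_le)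
  have i1: "integrable n (\<lambda>x. ln (K_conv \<epsilon> m x))" by (subst dens) (auto intro!: bnd integrable_ln_K_conv[OF m e])
  have i2: "integrable n (\<lambda>x. (norm x)\<^sup>2)" by (subst dens) (auto intro!: bnd D)
  interpret N: prob_space "gauss_meas \<epsilon> :: 'a measure" by (rule prob_space_gauss_meas[OF e])
  have k: "(\<integral>y. exp (- \<kappa> - c * (norm (y::'a))\<^sup>2) \<partial>lborel) = exp (- \<kappa>) * gauss_const TYPE('a) c"
    unfolding gauss_const_def by (subst integral_mult_right_zero[symmetric]) (simp add: mult_exp_exp)
  have "(\<integral>x. w x \<partial>m) \<ge> 0" using w01 by (simp add: integral_nonneg_AE)
  then show ?thesis
    using entropy_lower_bound_gauss[OF fn sn e Km K_conv_pos[OF m e] hK i1 i2, of "\<lambda>_. - \<kappa>" "\<bar>\<kappa>\<bar>" c] c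
    by (simp add: dens mn k N.prob_space[unfolded space_gauss_meas] spn algebra_simps)
qed

section \<open>Weak compactness of measures with bounded second moments\<close>

text \<open>Prokhorov's theorem on Euclidean space is reduced to Helly's theorem on the line: for a continuous
  surjection \<open>p\<close> from the line (a Schoenberg curve, scaled on successive intervals so as to fill growing cubes)
  with Borel section \<open>s\<close>, the measures are pushed forward by \<open>s\<close>, and the limit is pushed back by \<open>p\<close>.
  \<open>tri\<close> is the triangle wave of period 2.\<close>

definition tri :: "real \<Rightarrow> real" where "tri t = arccos (cos (pi * t)) / pi"

lemma continuous_tri: "continuous_on UNIV tri"
  unfolding tri_def by (auto intro!: continuous_intros)

lemma tri_id: "0 \<le> t \<Longrightarrow> t \<le> 1 \<Longrightarrow> tri t = t"
  by (simp add: tri_def arccos_cos mult_left_le)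

lemma tri_periodic: "tri (2 * real k + t) = tri t"
proof -
  have "cos (pi * (2 * real k + t)) = cos (2 * real k * pi + pi * t)"
    by (simp add: algebra_simps)
  also have "\<dots> = cos (pi * t)"
    by (simp only: cos_add cos_2npi sin_2npi mult_1 mult_zero_left diff_zero)
  finally show ?thesis by (simp add: tri_def)
qed

text \<open>Schoenberg's plateau function: it is constantly 0 over the first third of [0, 1] and
  constantly 1 over the last, so at a Cantor point it ignores all later ternary digits.\<close>

definition digit_wave :: "real \<Rightarrow> real" where "digit_wave t = max 0 (min 1 (3 * tri t - 1))"

lemma continuous_digit_wave: "continuous_on UNIV digit_wave"
  unfolding digit_wave_def by (intro continuous_intros continuous_tri)

lemma digit_wave_bounds: "0 \<le> digit_wave t" "digit_wave t \<le> 1"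
  by (auto simp: digit_wave_def)

lemma digit_wave_periodic: "digit_wave (2 * real k + t) = digit_wave t"
  by (simp add: digit_wave_def tri_periodic)

text \<open>\<open>digit_wave (3^m t)\<close> reads the \<open>m\<close>-th ternary digit of a point \<open>t\<close> of the Cantor set; the coordinates
  take these digits in turn as binary digits.\<close>

definition schoenberg_coord :: "nat \<Rightarrow> nat \<Rightarrow> real \<Rightarrow> real" where
  "schoenberg_coord d j t = (\<Sum>n. (1/2) ^ Suc n * digit_wave (3 ^ (d * n + j) * t))"

lemma continuous_schoenberg_coord: "continuous_on UNIV (schoenberg_coord d j)"
proof -
  have "uniform_limit UNIV (\<lambda>N t. \<Sum>n<N. (1/2) ^ Suc n * digit_wave (3 ^ (d * n + j) * t))
     (\<lambda>t. \<Sum>n. (1/2) ^ Suc n * digit_wave (3 ^ (d * n + j) * t)) sequentially"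
    by (rule Weierstrass_m_test[where M = "\<lambda>n. (1/2) ^ Suc n"])
       (auto simp: abs_mult digit_wave_bounds mult_left_le intro: summable_mult)
  then have "continuous_on UNIV (\<lambda>t. \<Sum>n. (1/2) ^ Suc n * digit_wave (3 ^ (d * n + j) * t))"
    by (rule uniform_limit_theorem[rotated])
       (auto intro!: always_eventually continuous_intros continuous_on_compose2[OF continuous_digit_wave])
  then show ?thesis by (simp add: schoenberg_coord_def[abs_def])
qed

lemma schoenberg_coord_periodic: "schoenberg_coord d j (2 * real k + t) = schoenberg_coord d j t"
proof -
  have "digit_wave (3 ^ i * (2 * real k + t)) = digit_wave (3 ^ i * t)" for i
    using digit_wave_periodic[of "3 ^ i * k" "3 ^ i * t"] by (simp add: algebra_simps)
  then show ?thesis by (simp add: schoenberg_coord_def)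
qed

lemma binary_expansion:
  fixes y :: real
  assumes y: "0 \<le> y" "y < 1"
  obtains a :: "nat \<Rightarrow> nat" where "\<And>n. a n \<le> 1" "(\<lambda>n. (1/2) ^ Suc n * real (a n)) sums y"
proof -
  define z where "z n = \<lfloor>2 ^ n * y\<rfloor>" for n :: nat
  \<comment> \<open>The binary digit, as a difference of consecutive integer parts. The partial sums
    telescope to z N / 2^N, starting from z 0 = 0, which is where y < 1 enters.\<close>
  define a where "a n = z (Suc n) - 2 * z n" for n
  have zb: "real_of_int (z n) \<le> 2 ^ n * y" "2 ^ n * y < real_of_int (z n) + 1" for n
    unfolding z_def by linarith+
  have a: "0 \<le> a n \<and> a n \<le> 1" for n
  proof -
    have "2 * real_of_int (z n) < real_of_int (z (Suc n)) + 1" "real_of_int (z (Suc n)) < 2 * real_of_int (z n) + 2"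
      using zb[of n] zb[of "Suc n"] by auto
    then show ?thesis unfolding a_def by linarith
  qed
  have part: "(\<Sum>n<N. (1/2) ^ Suc n * real_of_int (a n)) = real_of_int (z N) / 2 ^ N" for N
  proof (induction N)
    case 0
    have "z 0 = 0" unfolding z_def using y by (simp add: floor_eq_iff)
    then show ?case by simp
  next
    case (Suc N)
    then show ?case by (simp add: a_def field_simps power_divide)
  qed
  have "(\<lambda>N. real_of_int (z N) / 2 ^ N) \<longlonglongrightarrow> y"
  proof (rule LIMSEQ_I)
    fix r :: real assume r: "0 < r"
    obtain N where N: "(1/2 :: real) ^ N < r" using real_arch_pow_inv[OF r, of "1/2"] by auto
    have "norm (real_of_int (z n) / 2 ^ n - y) < r" if n: "n \<ge> N" for n
    proof -
      have eq: "y - real_of_int (z n) / 2 ^ n = (2 ^ n * y - real_of_int (z n)) / 2 ^ n"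
        by (simp add: field_simps)
      have "y - real_of_int (z n) / 2 ^ n < 1 / 2 ^ n" "y - real_of_int (z n) / 2 ^ n \<ge> 0"
        unfolding eq using zb[of n] by (auto intro!: divide_strict_right_mono)
      then have "y - real_of_int (z n) / 2 ^ n < (1/2) ^ n" "y - real_of_int (z n) / 2 ^ n \<ge> 0"
        by (simp_all add: power_divide)
      moreover have "(1/2 :: real) ^ n \<le> (1/2) ^ N" using n by (intro power_decreasing) auto
      ultimately show ?thesis using N unfolding real_norm_def by linarith
    qed
    then show "\<exists>no. \<forall>n\<ge>no. norm (real_of_int (z n) / 2 ^ n - y) < r" by blast
  qed
  then have "(\<lambda>n. (1/2) ^ Suc n * real_of_int (a n)) sums y" unfolding sums_def part .
  moreover have "real (nat (a n)) = real_of_int (a n)" for n using a[of n] by simp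
  ultimately show ?thesis using a by (intro that[of "\<lambda>n. nat (a n)"]) (auto simp: nat_le_iff)
qed

text \<open>All ternary digits of t are 0 or 2. Hence the integer part of 3^m t is an even number 2
  k and disappears by periodicity; the rest is (2 c m + r) / 3 with r in [0, 1], which lies on the
  plateau of value c m.\<close>

lemma ternary_digit_wave:
  fixes c :: "nat \<Rightarrow> nat"
  assumes c: "\<And>n. c n \<le> 1"
  defines "t \<equiv> (\<Sum>n. 2 * real (c n) * (1/3) ^ Suc n)"
  shows "0 \<le> t" "t \<le> 1" "digit_wave (3 ^ m * t) = real (c m)"
proof -
  let ?f = "\<lambda>c n. 2 * real (c n) * (1/3 :: real) ^ Suc n"
  have g: "(\<lambda>n. 2 * (1/3 :: real) ^ Suc n) sums 1"
    using sums_mult[OF geometric_sums[of "1/3 :: real"], of "2/3"] by (simp add: mult.assoc)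
  have bound: "summable (?f c) \<and> 0 \<le> suminf (?f c) \<and> suminf (?f c) \<le> 1" if c: "\<And>n. c n \<le> 1" for c :: "nat \<Rightarrow> nat"
  proof -
    have le: "?f c n \<le> 2 * (1/3) ^ Suc n" for n
      using c[of n] by (intro mult_right_mono) auto
    have s: "summable (?f c)"
      by (rule summable_comparison_test'[OF sums_summable[OF g], of 0]) (use le in auto)
    show ?thesis
      using s suminf_le[OF le s sums_summable[OF g]] sums_unique[OF g] by (auto intro!: suminf_nonneg)
  qed
  show "0 \<le> t" "t \<le> 1" using bound[OF c] by (auto simp: t_def)
  have s: "summable (?f c)" using bound[OF c] by simp
  define r where "r = (\<Sum>n. ?f (\<lambda>n. c (n + Suc m)) n)"
  have r: "0 \<le> r" "r \<le> 1" using bound[of "\<lambda>n. c (n + Suc m)"] c by (auto simp: r_def)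
  define k where "k = (\<Sum>i<m. c i * 3 ^ (m - Suc i))"
  have "t = (\<Sum>n. ?f c (n + Suc m)) + (\<Sum>i<Suc m. ?f c i)"
    unfolding t_def by (rule suminf_split_initial_segment[OF s])
  also have "(\<Sum>n. ?f c (n + Suc m)) = (1/3) ^ Suc m * r"
    unfolding r_def
    by (subst suminf_mult[symmetric]) (use bound[of "\<lambda>n. c (n + Suc m)"] c in \<open>auto simp: power_add mult_ac\<close>)
  finally have "3 ^ m * t = r / 3 + (\<Sum>i<m. 3 ^ m * ?f c i) + 3 ^ m * ?f c m"
    by (simp add: algebra_simps sum_distrib_left power_divide)
  also have "(\<Sum>i<m. 3 ^ m * ?f c i) = 2 * real k"
    unfolding k_def of_nat_sum sum_distrib_left
  proof (intro sum.cong refl)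
    fix i assume "i \<in> {..<m}"
    then have "(3::real) ^ m = 3 ^ Suc i * 3 ^ (m - Suc i)" by (subst power_add[symmetric]) simp
    then show "3 ^ m * ?f c i = 2 * real (c i * 3 ^ (m - Suc i))"
      by (simp add: power_divide field_simps)
  qed
  also have "3 ^ m * ?f c m = 2 * real (c m) / 3" by (simp add: power_divide)
  finally have "3 ^ m * t = 2 * real k + (r / 3 + 2 * real (c m) / 3)" by simp
  then have "digit_wave (3 ^ m * t) = digit_wave (r / 3 + 2 * real (c m) / 3)"
    by (simp only: digit_wave_periodic)
  moreover have "c m = 0 \<or> c m = 1" using c[of m] by auto
  ultimately show "digit_wave (3 ^ m * t) = real (c m)"
    using r by (auto simp: digit_wave_def tri_id max_def min_def)
qed

lemma schoenberg_coord_surj: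
  assumes d: "d > 0" and y: "\<And>j. j < d \<Longrightarrow> 0 \<le> y j \<and> y j < 1"
  obtains t where "0 \<le> t" "t \<le> 1" "\<And>j. j < d \<Longrightarrow> schoenberg_coord d j t = y j"
proof -
  have "\<forall>j. \<exists>a :: nat \<Rightarrow> nat. j < d \<longrightarrow> (\<forall>n. a n \<le> 1) \<and> (\<lambda>n. (1/2) ^ Suc n * real (a n)) sums y j"
    using y binary_expansion by metis
  then obtain a :: "nat \<Rightarrow> nat \<Rightarrow> nat" where
    a: "\<And>j n. j < d \<Longrightarrow> a j n \<le> 1" "\<And>j. j < d \<Longrightarrow> (\<lambda>n. (1/2) ^ Suc n * real (a j n)) sums y j"
    by metis
  \<comment> \<open>Interleaving: position d n + j carries the n-th binary digit of the j-th
    coordinate.\<close>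
  define c where "c m = a (m mod d) (m div d)" for m
  have c: "c m \<le> 1" for m using a(1) d by (simp add: c_def)
  define t where "t = (\<Sum>n. 2 * real (c n) * (1/3) ^ Suc n)"
  note t = ternary_digit_wave[of c, OF c, folded t_def]
  show ?thesis
  proof
    show "0 \<le> t" "t \<le> 1" by (fact t)+
    fix j assume j: "j < d"
    have "c (d * n + j) = a j n" for n using j by (simp add: c_def)
    then show "schoenberg_coord d j t = y j"
      unfolding schoenberg_coord_def t(3) using sums_unique[OF a(2)[OF j]] by simp
  qed
qed

lemma curve_onto_euclidean_space:
  obtains p :: "real \<Rightarrow> 'a::euclidean_space" where "continuous_on UNIV p"
    "\<And>x k. norm x < real k \<Longrightarrow> \<exists>t. 0 \<le> t \<and> t \<le> 2 * real k + 1 \<and> p t = x"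
proof -
  let ?d = "DIM('a)"
  obtain idx :: "'a \<Rightarrow> nat" where idx: "bij_betw idx Basis {0..<?d}"
    using ex_bij_betw_finite_nat[of "Basis :: 'a set"] by auto
  define S :: "real \<Rightarrow> 'a" where "S t = (\<Sum>b\<in>Basis. (2 * schoenberg_coord ?d (idx b) t - 1) *\<^sub>R b)" for t
  \<comment> \<open>The scale factor is constantly k on [2 k, 2 k + 1], where S runs through a full
    copy of the unit curve, and it interpolates continuously in between. So this interval suffices
    to reach every point of norm below k.\<close>
  define p where "p t = ((t - tri t) / 2) *\<^sub>R S t" for t
  show ?thesis
  proof
    have "continuous_on UNIV S" unfolding S_def
      by (intro continuous_intros continuous_on_compose2[OF continuous_schoenberg_coord]) auto
    then show "continuous_on UNIV p" unfolding p_def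
      by (intro continuous_intros continuous_on_compose2[OF continuous_tri]) auto
    fix x :: 'a and k :: nat
    assume x: "norm x < real k"
    then have k: "real k > 0" using norm_ge_zero[of x] by linarith
    define y where "y j = ((x \<bullet> inv_into Basis idx j) / real k + 1) / 2" for j
    have y: "0 \<le> y j \<and> y j < 1" if "j < ?d" for j
    proof -
      have "inv_into Basis idx j \<in> Basis"
        using bij_betw_imp_surj_on[OF idx] that by (intro inv_into_into) auto
      then have "\<bar>x \<bullet> inv_into Basis idx j\<bar> < real k" using Basis_le_norm x le_less_trans by blast
      then show ?thesis using k by (simp add: y_def field_simps abs_less_iff)
    qed
    obtain t where t: "0 \<le> t" "t \<le> 1" "\<And>j. j < ?d \<Longrightarrow> schoenberg_coord ?d j t = y j"
      using schoenberg_coord_surj[of ?d y] y by auto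
    have "S (2 * real k + t) = (\<Sum>b\<in>Basis. ((x \<bullet> b) / real k) *\<^sub>R b)"
      unfolding S_def
    proof (intro sum.cong refl)
      fix b :: 'a assume b: "b \<in> Basis"
      have "idx b < ?d" using bij_betw_apply[OF idx b] by simp
      moreover have "inv_into Basis idx (idx b) = b"
        using bij_betw_imp_inj_on[OF idx] b by (rule inv_into_f_f)
      ultimately have *: "schoenberg_coord ?d (idx b) (2 * real k + t) = ((x \<bullet> b) / real k + 1) / 2"
        by (simp add: schoenberg_coord_periodic t(3) y_def)
      have "2 * ((v + 1) / 2) - 1 = v" for v :: real by (simp add: field_simps)
      then have u: "2 * schoenberg_coord ?d (idx b) (2 * real k + t) - 1 = (x \<bullet> b) / real k" unfolding * .
      show "(2 * schoenberg_coord ?d (idx b) (2 * real k + t) - 1) *\<^sub>R b = ((x \<bullet> b) / real k) *\<^sub>R b"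
        by (simp only: u)
    qed
    also have "\<dots> = (1 / real k) *\<^sub>R (\<Sum>b\<in>Basis. (x \<bullet> b) *\<^sub>R b)"
      by (simp add: scaleR_sum_right)
    also have "\<dots> = (1 / real k) *\<^sub>R x" by (simp add: euclidean_representation)
    finally have "p (2 * real k + t) = x"
      using k t by (simp add: p_def tri_periodic tri_id)
    then show "\<exists>t. 0 \<le> t \<and> t \<le> 2 * real k + 1 \<and> p t = x"
      using t by (intro exI[of _ "2 * real k + t"]) auto
  qed
qed

text \<open>The sublevel set \<open>{s \<le> a}\<close> of the first hitting time \<open>s\<close> is the compact set \<open>p ` {0..a}\<close>.\<close>

lemma borel_section:
  fixes p :: "real \<Rightarrow> 'a::euclidean_space"
  assumes p: "continuous_on UNIV p"
    and surj: "\<And>x k. norm x < real k \<Longrightarrow> \<exists>t. 0 \<le> t \<and> t \<le> 2 * real k + 1 \<and> p t = x"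
  obtains s where "s \<in> borel_measurable borel" "\<And>x. p (s x) = x" "\<And>x. 0 \<le> s x"
    "\<And>x k. norm x < real k \<Longrightarrow> s x \<le> 2 * real k + 1"
proof
  define A where "A x = {t. 0 \<le> t \<and> p t = x}" for x
  define s where "s x = Inf (A x)" for x
  have bdd: "bdd_below (A x)" for x unfolding A_def by (rule bdd_belowI[of _ 0]) auto
  have ne: "A x \<noteq> {}" for x
  proof -
    obtain k :: nat where "norm x < real k" using reals_Archimedean2 by blast
    then show ?thesis using surj unfolding A_def by blast
  qed
  have cl: "closed (A x)" for x
  proof -
    have "closed ({0..} \<inter> p -` {x})"
      by (intro closed_Int closed_vimage p) auto
    also have "{0..} \<inter> p -` {x} = A x" by (auto simp: A_def)
    finally show ?thesis .
  qed
  have sA: "s x \<in> A x" for x unfolding s_def by (rule closed_contains_Inf[OF ne bdd cl])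
  then show "p (s x) = x" "0 \<le> s x" for x by (auto simp: A_def)
  have le: "s x \<le> t" if "t \<ge> 0" "p t = x" for x t
    unfolding s_def by (rule cInf_lower[OF _ bdd]) (use that in \<open>auto simp: A_def\<close>)
  show "s x \<le> 2 * real k + 1" if "norm x < real k" for x k
    using surj[OF that] le by force
  show "s \<in> borel_measurable borel"
  proof (rule borel_measurableI_le)
    fix a
    have "{x \<in> space borel. s x \<le> a} = p ` {0..a}"
    proof (intro equalityI subsetI)
      fix x assume "x \<in> {x \<in> space borel. s x \<le> a}"
      then show "x \<in> p ` {0..a}" using sA[of x] by (intro image_eqI[of _ _ "s x"]) (auto simp: A_def)
    next
      fix x assume "x \<in> p ` {0..a}"
      then obtain t where "0 \<le> t" "t \<le> a" "p t = x" by auto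
      then show "x \<in> {x \<in> space borel. s x \<le> a}" using le[of t x] by simp
    qed
    moreover have "closed (p ` {0..a})"
      by (intro compact_imp_closed compact_continuous_image continuous_on_subset[OF p]) auto
    ultimately show "{x \<in> space borel. s x \<le> a} \<in> sets borel" by simp
  qed
qed

text \<open>Monotone convergence along min (g, N). Used where the integrability of g is the
  conclusion and cannot be presupposed: for the second moment of a weak limit and for the positive
  part of a log-density.\<close>

lemma nn_integral_le_of_truncations:
  fixes g :: "'b \<Rightarrow> real"
  assumes m: "finite_measure m" and [measurable]: "g \<in> borel_measurable m"
    and g: "\<And>x. g x \<ge> 0" and b: "\<And>N::nat. (\<integral>x. min (g x) (real N) \<partial>m) \<le> M"
  shows "(\<integral>\<^sup>+x. ennreal (g x) \<partial>m) \<le> ennreal M"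
proof -
  interpret m: finite_measure m by (rule m)
  have "(\<integral>\<^sup>+x. ennreal (g x) \<partial>m) = (\<integral>\<^sup>+x. (SUP N. ennreal (min (g x) (real N))) \<partial>m)"
  proof (intro nn_integral_cong)
    fix x
    obtain N where "g x < real N" using reals_Archimedean2 by blast
    then show "ennreal (g x) = (SUP N. ennreal (min (g x) (real N)))"
      by (intro antisym SUP_upper2[of N] SUP_least ennreal_leI) auto
  qed
  also have "\<dots> = (SUP N. (\<integral>\<^sup>+x. ennreal (min (g x) (real N)) \<partial>m))"
    by (rule nn_integral_monotone_convergence_SUP) (auto simp: incseq_def le_fun_def intro!: ennreal_leI)
  also have "\<dots> \<le> ennreal M"
  proof (rule SUP_least)
    fix N :: nat
    have "integrable m (\<lambda>x. min (g x) (real N))"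
      using g by (intro m.integrable_const_bound[of _ "real N"]) auto
    then have "(\<integral>\<^sup>+x. ennreal (min (g x) (real N)) \<partial>m) = ennreal (\<integral>x. min (g x) (real N) \<partial>m)"
      using g by (intro nn_integral_eq_integral) auto
    then show "(\<integral>\<^sup>+x. ennreal (min (g x) (real N)) \<partial>m) \<le> ennreal M" using b by (simp add: ennreal_leI)
  qed
  finally show ?thesis .
qed

text \<open>An unbounded g cannot be inserted into weak convergence, but its truncations can, and
  the bound M survives for each of them.\<close>

lemma weak_limit_nn_integral_le:
  fixes g :: "'a::euclidean_space \<Rightarrow> real"
  assumes w: "weak_conv_seq ms m" and m: "finite_measure m" "sets m = sets borel"
    and ms: "\<And>n. finite_measure (ms n)" "\<And>n. sets (ms n) = sets borel"
    and g: "continuous_on UNIV g" "\<And>x. g x \<ge> 0" "\<And>n. integrable (ms n) g" "\<And>n. (\<integral>x. g x \<partial>ms n) \<le> M"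
  shows "(\<integral>\<^sup>+x. ennreal (g x) \<partial>m) \<le> ennreal M"
proof -
  interpret m: finite_measure m by (rule m)
  have gm[measurable]: "g \<in> borel_measurable borel" by (rule borel_measurable_continuous_onI[OF g(1)])
  have [measurable_cong]: "sets m = sets borel" by (rule m)
  have b: "(\<integral>x. min (g x) (real N) \<partial>m) \<le> M" for N :: nat
  proof (rule LIMSEQ_le_const2)
    show "(\<lambda>n. \<integral>x. min (g x) (real N) \<partial>ms n) \<longlonglongrightarrow> (\<integral>x. min (g x) (real N) \<partial>m)"
    proof (rule w[unfolded weak_conv_seq_def, rule_format], intro conjI)
      show "continuous_on UNIV (\<lambda>x. min (g x) (real N))" by (intro continuous_intros g(1))
      show "bounded (range (\<lambda>x. min (g x) (real N)))" using g(2)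
        by (auto intro!: boundedI[of _ "real N"])
    qed
    show "\<exists>N'. \<forall>n\<ge>N'. (\<integral>x. min (g x) (real N) \<partial>ms n) \<le> M"
    proof (intro exI allI impI)
      fix n
      have "(\<integral>x. min (g x) (real N) \<partial>ms n) \<le> (\<integral>x. g x \<partial>ms n)"
      proof (rule integral_mono)
        show "integrable (ms n) (\<lambda>x. min (g x) (real N))"
          using g(2) ms(2)[of n] by (intro Bochner_Integration.integrable_bound[OF g(3)[of n]]) (auto cong: measurable_cong_sets)
      qed (auto intro: g)
      also have "\<dots> \<le> M" by (rule g)
      finally show "(\<integral>x. min (g x) (real N) \<partial>ms n) \<le> M" .
    qed
  qed
  show ?thesis
    by (rule nn_integral_le_of_truncations[OF m(1) _ g(2) b]) simp
qed

lemma P2_weakly_compact: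
  fixes ms :: "nat \<Rightarrow> 'a::euclidean_space measure"
  assumes ms: "\<And>n. ms n \<in> P2" and M: "\<And>n. (\<integral>x. (norm x)\<^sup>2 \<partial>ms n) \<le> M"
  obtains r m where "strict_mono r" "m \<in> P2" "weak_conv_seq (ms \<circ> r) m"
proof -
  obtain p :: "real \<Rightarrow> 'a" where p: "continuous_on UNIV p"
    "\<And>x k. norm x < real k \<Longrightarrow> \<exists>t. 0 \<le> t \<and> t \<le> 2 * real k + 1 \<and> p t = x"
    using curve_onto_euclidean_space by blast
  obtain s where s[measurable]: "s \<in> borel_measurable borel" and sp: "\<And>x. p (s x) = x"
    and s0: "\<And>x. 0 \<le> s x" and sk: "\<And>x k. norm x < real k \<Longrightarrow> s x \<le> 2 * real k + 1"
    using borel_section[OF p] by blast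
  have pm[measurable]: "p \<in> borel_measurable borel" by (rule borel_measurable_continuous_onI[OF p(1)])
  note D = P2_D[OF ms]
  define \<nu> where "\<nu> n = distr (ms n) borel s" for n
  have sm: "s \<in> measurable (ms n) borel" for n using s D(3)[of n] by (simp cong: measurable_cong_sets)
  have rd: "real_distribution (\<nu> n)" for n
    unfolding \<nu>_def using prob_space.real_distribution_distr[OF D(1) sm] .
  \<comment> \<open>Tightness on the line by Markov's inequality: the ball of radius k is sent by s
    into [0, 2 k + 1]. The choice of k makes |M| / k^2 smaller than \<delta>, using k > 1.\<close>
  have "\<exists>a b::real. a < b \<and> (\<forall>n. measure (\<nu> n) {a<..b} > 1 - \<delta>)" if \<delta>: "\<delta> > 0" for \<delta>
  proof -
    obtain k :: nat where "\<bar>M\<bar> / \<delta> + 1 < real k" using reals_Archimedean2 by blast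
    then have k: "\<bar>M\<bar> / \<delta> + 1 < real k" .
    have "\<bar>M\<bar> / \<delta> \<ge> 0" "\<bar>M\<bar> / \<delta> < real k" using \<delta> k by auto
    then have k1: "real k > 1" "\<bar>M\<bar> < \<delta> * real k" using \<delta> k by (linarith, simp add: field_simps)
    \<comment> \<open>The interval starts at -1 because it is open on the left and s may take the
      value 0.\<close>
    have "measure (\<nu> n) {-1<..2 * real k + 1} > 1 - \<delta>" for n
    proof -
      interpret m: prob_space "ms n" by (rule D)
      have [measurable_cong]: "sets (ms n) = sets borel" by (rule D)
      have "measure (ms n) {x \<in> space (ms n). (norm x)\<^sup>2 \<ge> (real k)\<^sup>2} \<le> (\<integral>x. (norm x)\<^sup>2 \<partial>ms n) / (real k)\<^sup>2"
        by (rule integral_Markov_inequality_measure[where A="{}"]) (use D(5)[of n] k1 in auto)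
      also have "\<dots> \<le> \<bar>M\<bar> / (real k)\<^sup>2"
        using M[of n] by (intro divide_right_mono) auto
      also have "\<dots> < \<delta>"
      proof -
        have "\<delta> * real k \<le> \<delta> * (real k)\<^sup>2" using k1 \<delta> by (simp add: power2_eq_square)
        then show ?thesis using k1 by (simp add: pos_divide_less_eq)
      qed
      finally have 1: "measure (ms n) {x \<in> space (ms n). (norm x)\<^sup>2 \<ge> (real k)\<^sup>2} < \<delta>" .
      have 2: "measure (ms n) {x \<in> space (ms n). \<not> (norm x)\<^sup>2 \<ge> (real k)\<^sup>2} = 1 - measure (ms n) {x \<in> space (ms n). (norm x)\<^sup>2 \<ge> (real k)\<^sup>2}"
        by (rule m.prob_neg) auto
      have "measure (ms n) {x \<in> space (ms n). \<not> (norm x)\<^sup>2 \<ge> (real k)\<^sup>2} \<le> measure (ms n) (s -` {-1<..2 * real k + 1} \<inter> space (ms n))"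
      proof (rule m.finite_measure_mono)
        have "s x \<in> {-1<..2 * real k + 1}" if "\<not> (norm x)\<^sup>2 \<ge> (real k)\<^sup>2" for x
        proof -
          have "norm x < real k" using that by (meson not_le of_nat_0_le_iff power_mono)
          then show ?thesis using sk s0[of x] by auto
        qed
        then show "{x \<in> space (ms n). \<not> (norm x)\<^sup>2 \<ge> (real k)\<^sup>2} \<subseteq> s -` {-1<..2 * real k + 1} \<inter> space (ms n)" by auto
        show "s -` {-1<..2 * real k + 1} \<inter> space (ms n) \<in> sets (ms n)" using sm by (rule measurable_sets) auto
      qed
      also have "\<dots> = measure (\<nu> n) {-1<..2 * real k + 1}"
        unfolding \<nu>_def using sm by (subst measure_distr) auto
      finally show ?thesis using 1 2 by linarith
    qed
    then show ?thesis by (intro exI[of _ "-1"] exI[of _ "2 * real k + 1"]) auto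
  qed
  then have "tight \<nu>" unfolding tight_def using rd by blast
  from tight_imp_convergent_subsubsequence[OF this strict_mono_id]
  obtain r Q where r: "strict_mono (r :: nat \<Rightarrow> nat)" and Q: "real_distribution Q" "weak_conv_m (\<nu> \<circ> id \<circ> r) Q"
    by blast
  interpret Q: real_distribution Q by (rule Q)
  define m where "m = distr Q borel p"
  have pQ: "p \<in> measurable Q borel" using pm by (simp cong: measurable_cong_sets)
  have sm': "sets m = sets borel" by (simp add: m_def)
  have prm: "prob_space m" unfolding m_def by (rule Q.prob_space_distr[OF pQ])
  have w: "weak_conv_seq (ms \<circ> r) m"
    unfolding weak_conv_seq_def
  proof (intro allI impI)
    fix f :: "'a \<Rightarrow> real" assume f: "continuous_on UNIV f \<and> bounded (range f)"
    then obtain B where B: "\<And>x. norm (f x) \<le> B" by (auto simp: bounded_iff)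
    have fm[measurable]: "f \<in> borel_measurable borel" using f by (intro borel_measurable_continuous_onI) auto
    \<comment> \<open>The section s is only Borel, but it cancels: f (p (s x)) = f x. Weak
      convergence on the line is needed for the continuous function f o p alone.\<close>
    have cont: "isCont (\<lambda>t. f (p t)) t" for t
    proof -
      have "continuous_on UNIV (\<lambda>t. f (p t))" using f p(1) by (intro continuous_on_compose2[of UNIV f UNIV p]) auto
      then show ?thesis by (simp add: continuous_on_eq_continuous_at)
    qed
    have "(\<lambda>n. integral\<^sup>L ((\<nu> \<circ> id \<circ> r) n) (\<lambda>t. f (p t))) \<longlonglongrightarrow> integral\<^sup>L Q (\<lambda>t. f (p t))"
      by (rule weak_conv_imp_integral_bdd_continuous_conv[OF _ Q(1) Q(2) cont B]) (simp add: rd)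
    moreover have "integral\<^sup>L ((\<nu> \<circ> id \<circ> r) n) (\<lambda>t. f (p t)) = integral\<^sup>L ((ms \<circ> r) n) f" for n
      using sm[of "r n"] by (simp add: \<nu>_def integral_distr sp)
    moreover have "integral\<^sup>L Q (\<lambda>t. f (p t)) = integral\<^sup>L m f"
      unfolding m_def using pQ by (simp add: integral_distr)
    ultimately show "(\<lambda>n. integral\<^sup>L ((ms \<circ> r) n) f) \<longlonglongrightarrow> integral\<^sup>L m f" by simp
  qed
  interpret m: prob_space m by (rule prm)
  have "(\<integral>\<^sup>+x. ennreal ((norm x)\<^sup>2) \<partial>m) \<le> ennreal M"
    by (rule weak_limit_nn_integral_le[OF w m.finite_measure_axioms sm'])
       (use D M in \<open>auto intro!: continuous_intros\<close>)
  then have "integrable m (\<lambda>x. (norm x)\<^sup>2)"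
    using sm' by (intro integrableI_nonneg) (auto cong: measurable_cong_sets intro: le_less_trans)
  then have "m \<in> P2" using prm sm' by (simp add: P2_def)
  then show ?thesis using that r w by blast
qed

section \<open>Lower semicontinuity for fixed smoothing parameter\<close>

lemma weak_conv_seq_K_conv:
  assumes w: "weak_conv_seq ms m" and e: "\<epsilon> > 0"
  shows "(\<lambda>n. K_conv \<epsilon> (ms n) x) \<longlonglongrightarrow> K_conv \<epsilon> m (x::'a::euclidean_space)"
  unfolding K_conv_def
proof (rule w[unfolded weak_conv_seq_def, rule_format], intro conjI)
  show "continuous_on UNIV (\<lambda>y. K_eps \<epsilon> (x - y))" by (intro continuous_intros e)
  show "bounded (range (\<lambda>y. K_eps \<epsilon> (x - y)))"
    using K_eps_le[OF e, where 'a='a] by (auto intro!: boundedI[of _ "K_eps \<epsilon> (0::'a)"])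
qed

text \<open>Pointwise convergence on a finite r-net of S, plus the Lipschitz constant common to all
  the smoothed densities: three errors of at most \<eta>/4 each. The 1 in the denominator of r
  covers L = 0.\<close>

lemma K_conv_uniform_on_compact:
  assumes w: "weak_conv_seq ms m" and ms: "\<And>n. ms n \<in> P2" and m: "m \<in> P2" and e: "\<epsilon> > 0"
    and S: "compact (S :: 'a::euclidean_space set)" and \<eta>: "\<eta> > 0"
  shows "\<forall>\<^sub>F n in sequentially. \<forall>x\<in>S. \<bar>K_conv \<epsilon> (ms n) x - K_conv \<epsilon> m x\<bar> < \<eta>"
proof -
  obtain L where L: "L \<ge> 0" "\<And>x y :: 'a. \<bar>K_eps \<epsilon> x - K_eps \<epsilon> y\<bar> \<le> L * norm (x - y)"
    using K_eps_lipschitz[OF e] by blast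
  define r where "r = \<eta> / (4 * (L + 1))"
  have r: "r > 0" "L * r \<le> \<eta> / 4" using L(1) \<eta> by (auto simp: r_def field_simps)
  have lip: "\<bar>K_conv \<epsilon> \<mu> x - K_conv \<epsilon> \<mu> t\<bar> \<le> \<eta> / 4" if "\<mu> \<in> P2" "norm (x - t) < r" for \<mu> :: "'a measure" and x t
  proof -
    have "\<bar>K_conv \<epsilon> \<mu> x - K_conv \<epsilon> \<mu> t\<bar> \<le> L * norm (x - t)"
      using K_conv_lipschitz[OF P2_D(2,3)[OF that(1)] e L(2), of x t] P2_D(6)[OF that(1)] by simp
    also have "\<dots> \<le> L * r" using that L by (intro mult_left_mono) auto
    finally show ?thesis using r by simp
  qed
  obtain T where T: "finite T" "S \<subseteq> (\<Union>t\<in>T. ball t r)"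
    using S r(1) unfolding compact_eq_totally_bounded by blast
  have "\<forall>\<^sub>F n in sequentially. \<forall>t\<in>T. \<bar>K_conv \<epsilon> (ms n) t - K_conv \<epsilon> m t\<bar> < \<eta> / 4"
  proof (rule eventually_ball_finite[OF T(1)], intro ballI)
    fix t
    show "\<forall>\<^sub>F n in sequentially. \<bar>K_conv \<epsilon> (ms n) t - K_conv \<epsilon> m t\<bar> < \<eta> / 4"
      using tendstoD[OF weak_conv_seq_K_conv[OF w e, of t], of "\<eta> / 4"] \<eta> by (simp add: dist_real_def)
  qed
  then show ?thesis
  proof eventually_elim
    case (elim n)
    show ?case
    proof
      fix x assume "x \<in> S"
      then obtain t where t: "t \<in> T" "norm (x - t) < r" using T(2) by (auto simp: dist_norm norm_minus_commute)
      show "\<bar>K_conv \<epsilon> (ms n) x - K_conv \<epsilon> m x\<bar> < \<eta>"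
        using lip[OF ms t(2), of n] lip[OF m t(2)] bspec[OF elim t(1)] \<eta> by linarith
    qed
  qed
qed

lemma ln_K_conv_uniform_on_compact:
  assumes w: "weak_conv_seq ms m" and ms: "\<And>n. ms n \<in> P2" and m: "m \<in> P2" and e: "\<epsilon> > 0"
    and S: "compact (S :: 'a::euclidean_space set)" and \<eta>: "\<eta> > 0"
  shows "\<forall>\<^sub>F n in sequentially. \<forall>x\<in>S. ln (K_conv \<epsilon> (ms n) x) \<ge> ln (K_conv \<epsilon> m x) - \<eta>"
proof (cases "S = {}")
  case False
  obtain x0 where x0: "x0 \<in> S" "\<And>x. x \<in> S \<Longrightarrow> K_conv \<epsilon> m x0 \<le> K_conv \<epsilon> m x"
    using continuous_attains_inf[OF S False continuous_on_subset[OF continuous_K_conv[OF P2_D(2,3)[OF m] e]]] by auto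
  define k where "k = K_conv \<epsilon> m x0"
  have k: "k > 0" using K_conv_pos[OF m e] by (simp add: k_def)
  \<comment> \<open>The first bound keeps the approximating density above k/2, the second makes the
    relative error d / (k/2) at most \<eta>.\<close>
  define d where "d = min (k / 2) (\<eta> * k / 2)"
  have d: "d > 0" using k \<eta> by (simp add: d_def)
  show ?thesis
    using K_conv_uniform_on_compact[OF w ms m e S d]
  proof eventually_elim
    case (elim n)
    show ?case
    proof
      fix x assume x: "x \<in> S"
      let ?a = "K_conv \<epsilon> (ms n) x" and ?b = "K_conv \<epsilon> m x"
      have ab: "\<bar>?a - ?b\<bar> < d" "?b \<ge> k" using elim x x0(2) by (auto simp: k_def)
      then have a: "?a \<ge> k / 2" unfolding d_def by linarith
      have "ln ?b - ln ?a = ln (?b / ?a)" using a ab k by (simp add: ln_div)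
      also have "\<dots> \<le> ?b / ?a - 1" using a ab k by (intro ln_le_minus_one) auto
      also have "\<dots> = (?b - ?a) / ?a" using a k by (simp add: field_simps)
      also have "\<dots> \<le> d / (k / 2)" using a ab k d by (intro frac_le) auto
      also have "\<dots> \<le> \<eta>" using k by (simp add: d_def field_simps)
      finally show "ln ?a \<ge> ln ?b - \<eta>" by simp
    qed
  qed
qed simp

section \<open>Cutoff functions\<close>

definition cutoff :: "real \<Rightarrow> 'a::euclidean_space \<Rightarrow> real" where
  "cutoff R x = max 0 (min 1 (2 - norm x / R))"

lemma continuous_cutoff: "R > 0 \<Longrightarrow> continuous_on UNIV (cutoff R)"
  unfolding cutoff_def by (intro continuous_intros) auto

lemma cutoff_bounds [simp]: "0 \<le> cutoff R x" "cutoff R x \<le> 1" by (auto simp: cutoff_def)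

lemma cutoff_eq_0: "R > 0 \<Longrightarrow> norm x \<ge> 2 * R \<Longrightarrow> cutoff R x = 0"
  by (auto simp: cutoff_def field_simps max_def min_def)

lemma cutoff_eq_1: "R > 0 \<Longrightarrow> norm x \<le> R \<Longrightarrow> cutoff R x = 1"
  by (auto simp: cutoff_def field_simps max_def min_def)

text \<open>A pointwise Markov inequality: integrated against m, it bounds the tail mass by the
  second moment over R^2.\<close>

lemma cutoff_complement_le: "R > 0 \<Longrightarrow> 1 - cutoff R x \<le> (norm x)\<^sup>2 / R\<^sup>2"
proof (cases "norm x \<le> R")
  case False
  assume R: "R > 0"
  have "R\<^sup>2 \<le> (norm x)\<^sup>2" using False R by (intro power_mono) auto
  then have "1 \<le> (norm x)\<^sup>2 / R\<^sup>2" using R by simp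
  then show ?thesis using cutoff_bounds(1)[of R x] by linarith
qed (auto simp: cutoff_eq_1)

lemma cutoff_tendsto: "(\<lambda>k. cutoff (real (Suc k)) x) \<longlonglongrightarrow> 1"
proof (rule tendsto_eventually)
  obtain N :: nat where "norm x \<le> real N" using real_arch_simple by blast
  then show "\<forall>\<^sub>F k in sequentially. cutoff (real (Suc k)) x = 1"
    by (intro eventually_sequentiallyI[of N] cutoff_eq_1) auto
qed

lemma bounded_continuous_times_cutoff:
  fixes f :: "'a::euclidean_space \<Rightarrow> real"
  assumes R: "R > 0" and f: "continuous_on UNIV f"
  shows "continuous_on UNIV (\<lambda>x. cutoff R x * f x)" "bounded (range (\<lambda>x. cutoff R x * f x))"
proof -
  show "continuous_on UNIV (\<lambda>x. cutoff R x * f x)" by (intro continuous_intros continuous_cutoff R f)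
  have "compact (f ` cball 0 (2 * R))" by (intro compact_continuous_image continuous_on_subset[OF f]) auto
  then obtain B where B: "\<And>x. x \<in> cball 0 (2 * R) \<Longrightarrow> \<bar>f x\<bar> \<le> B"
    using compact_imp_bounded bounded_iff by (metis imageI real_norm_def)
  have B0: "B \<ge> 0" using B[of 0] R by simp
  have "\<bar>cutoff R x * f x\<bar> \<le> B" for x
  proof (cases "norm x \<le> 2 * R")
    case True
    then have "cutoff R x * \<bar>f x\<bar> \<le> 1 * B" using B[of x] cutoff_bounds by (intro mult_mono) auto
    then show ?thesis using cutoff_bounds(1)[of R x] by (simp add: abs_mult)
  next
    case False
    then show ?thesis using B0 R by (simp add: cutoff_eq_0)
  qed
  then show "bounded (range (\<lambda>x. cutoff R x * f x))" by (auto intro!: boundedI)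
qed

text \<open>The growth constant is halved: one copy of \<open>c |x|\<^sup>2\<close> pays for the entropy, the other one gives coercivity.\<close>

definition quad_potential :: "('a::euclidean_space \<Rightarrow> real) \<Rightarrow> real \<Rightarrow> real \<Rightarrow> bool" where
  "quad_potential U C c \<longleftrightarrow> c > 0 \<and> continuous_on UNIV U \<and> (\<integral>\<^sup>+x. ennreal (exp (- U x)) \<partial>lborel) = 1 \<and>
     (\<forall>x. U x \<ge> C + 2 * c * (norm x)\<^sup>2) \<and> (\<exists>A B. \<forall>x. \<bar>U x\<bar> \<le> A + B * (norm x)\<^sup>2)"

lemma pi_assumption_quad_potential:
  assumes "pi_assumption U"
  obtains C c where "quad_potential U C c"
proof -
  obtain C0 A0 C1 A1 where C: "C1 > 0" "A1 > 0" "\<And>x. C0 + C1 * (norm x)\<^sup>2 \<le> U x" "\<And>x. U x \<le> A0 + A1 * (norm x)\<^sup>2"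
    using assms unfolding pi_assumption_def by blast
  have "\<bar>U x\<bar> \<le> (\<bar>C0\<bar> + \<bar>A0\<bar>) + A1 * (norm x)\<^sup>2" for x
  proof -
    have "C1 * (norm x)\<^sup>2 \<ge> 0" "A1 * (norm x)\<^sup>2 \<ge> 0" using C by auto
    then show ?thesis using C(3,4)[of x] by linarith
  qed
  then have "quad_potential U C0 (C1 / 2)"
    using assms C unfolding quad_potential_def pi_assumption_def by auto
  then show ?thesis using that by blast
qed

definition smoothed_energy :: "('a::euclidean_space \<Rightarrow> real) \<Rightarrow> real \<Rightarrow> 'a measure \<Rightarrow> real" where
  "smoothed_energy U \<epsilon> m = (\<integral>x. ln (K_conv \<epsilon> m x) \<partial>m) + (\<integral>x. U x \<partial>m)"

context
  fixes U :: "'a::euclidean_space \<Rightarrow> real" and C c :: real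
  assumes U: "quad_potential U C c"
begin

lemma quad_potentialD: "c > 0" "continuous_on UNIV U" "U \<in> borel_measurable borel"
  "(\<integral>\<^sup>+x. ennreal (exp (- U x)) \<partial>lborel) = 1" "U x \<ge> C + 2 * c * (norm x)\<^sup>2"
  using U by (auto simp: quad_potential_def intro: borel_measurable_continuous_onI)

lemma integrable_potential:
  assumes m: "m \<in> P2"
  shows "integrable m U"
proof -
  obtain A B where "\<And>x. \<bar>U x\<bar> \<le> A + B * (norm x)\<^sup>2" using U by (auto simp: quad_potential_def)
  then show ?thesis by (rule integrable_quadratic_bound[OF m quad_potentialD(3)])
qed

lemma V_eps_eq:
  assumes m: "m \<in> P2" and e: "\<epsilon> > 0"
  shows "V_eps F U \<sigma> \<epsilon> m = F m + \<sigma> * smoothed_energy U \<epsilon> m"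
proof -
  have "ln (K_conv \<epsilon> m x / pi_dens U x) = ln (K_conv \<epsilon> m x) + U x" for x
    using K_conv_pos[OF m e, of x] by (simp add: ln_div pi_dens_def)
  then show ?thesis
    unfolding V_eps_def smoothed_energy_def
    using integrable_ln_K_conv[OF m e] integrable_potential[OF m] by simp
qed

lemma smoothed_energy_coercive:
  assumes m: "m \<in> P2" and e: "\<epsilon> > 0"
  shows "smoothed_energy U \<epsilon> m \<ge> C + c * (\<integral>x. (norm x)\<^sup>2 \<partial>m) - c * \<epsilon>\<^sup>2 * gauss_moment TYPE('a) - gauss_const TYPE('a) c"
proof -
  interpret prob_space m by (rule P2_D(1)[OF m])
  have "(\<integral>x. C + 2 * c * (norm x)\<^sup>2 \<partial>m) \<le> (\<integral>x. U x \<partial>m)"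
    using P2_D(5)[OF m] by (intro integral_mono integrable_potential[OF m] quad_potentialD) auto
  also have "(\<integral>x. C + 2 * c * (norm x)\<^sup>2 \<partial>m) = C + 2 * c * (\<integral>x. (norm x)\<^sup>2 \<partial>m)"
    using P2_D(5)[OF m] by (simp add: prob_space)
  finally show ?thesis
    unfolding smoothed_energy_def using entropy_coercive[OF m e quad_potentialD(1)] by linarith
qed

text \<open>The quadratic growth of U more than compensates the term - c |x|^2 of
  \<open>entropy_tail\<close>. Both remaining errors become small if \<kappa> is taken large first
  and R afterwards, since R has to beat \<kappa> M.\<close>

lemma smoothed_energy_tail:
  assumes m: "m \<in> P2" and e: "\<epsilon> > 0" and M: "(\<integral>x. (norm x)\<^sup>2 \<partial>m) \<le> M" and R: "R > 0" and \<kappa>: "\<kappa> > 0"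
  shows "(\<integral>x. (1 - cutoff R x) * (ln (K_conv \<epsilon> m x) + U x) \<partial>m)
     \<ge> - (\<bar>C\<bar> + c * \<epsilon>\<^sup>2 * gauss_moment TYPE('a) + \<kappa>) * M / R\<^sup>2 - exp (- \<kappa>) * gauss_const TYPE('a) c"
proof -
  note D = P2_D[OF m]
  interpret prob_space m by (rule D)
  have [measurable_cong]: "sets m = sets borel" by (rule D)
  let ?w = "\<lambda>x::'a. 1 - cutoff R x"
  have wm[measurable]: "?w \<in> borel_measurable borel"
    by (intro borel_measurable_diff borel_measurable_const borel_measurable_continuous_onI continuous_cutoff R)
  have w: "0 \<le> ?w x" "?w x \<le> 1" for x using cutoff_bounds[of R x] by auto
  have bnd: "integrable m (\<lambda>x. ?w x * f x)" if "integrable m f" for f :: "'a \<Rightarrow> real"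
    using w that by (intro Bochner_Integration.integrable_bound[OF that])
      (auto intro!: AE_I2 simp: abs_mult mult_left_le_one_le)
  have iw: "integrable m ?w" using w by (intro integrable_const_bound[of _ 1]) auto
  let ?a = "\<integral>x. ?w x \<partial>m" and ?q = "\<integral>x. ?w x * (norm x)\<^sup>2 \<partial>m"
  have a0: "?a \<ge> 0" using w by (simp add: integral_nonneg_AE)
  have q0: "?q \<ge> 0" using w by (intro integral_nonneg_AE AE_I2 mult_nonneg_nonneg) auto
  have "?a \<le> (\<integral>x. (norm x)\<^sup>2 / R\<^sup>2 \<partial>m)"
    using D(5) by (intro integral_mono iw cutoff_complement_le R) auto
  also have "\<dots> \<le> M / R\<^sup>2" using M by (simp add: divide_right_mono)
  finally have aM: "?a \<le> M / R\<^sup>2" .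
  let ?D = "\<bar>C\<bar> + c * \<epsilon>\<^sup>2 * gauss_moment TYPE('a) + \<kappa>"
  have D0: "?D \<ge> 0" using quad_potentialD(1) gauss_moment_nonneg[where 'a='a] \<kappa> by (intro add_nonneg_nonneg mult_nonneg_nonneg) auto
  have "(\<integral>x. C * ?w x + 2 * c * (?w x * (norm x)\<^sup>2) \<partial>m) \<le> (\<integral>x. ?w x * U x \<partial>m)"
  proof (intro integral_mono)
    show "C * ?w x + 2 * c * (?w x * (norm x)\<^sup>2) \<le> ?w x * U x" for x
      using mult_left_mono[OF quad_potentialD(5)[of x] w(1)[of x]] by (simp add: algebra_simps)
  qed (use bnd[OF D(5)] bnd[OF integrable_potential[OF m]] iw in auto)
  also have "(\<integral>x. C * ?w x + 2 * c * (?w x * (norm x)\<^sup>2) \<partial>m) = C * ?a + 2 * c * ?q"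
    using bnd[OF D(5)] iw by (simp only: Bochner_Integration.integral_add integrable_mult_right integral_mult_right_zero)
  finally have u: "(\<integral>x. ?w x * U x \<partial>m) \<ge> C * ?a + 2 * c * ?q" .
  have "(\<integral>x. ?w x * (ln (K_conv \<epsilon> m x) + U x) \<partial>m) = (\<integral>x. ?w x * ln (K_conv \<epsilon> m x) \<partial>m) + (\<integral>x. ?w x * U x \<partial>m)"
    using bnd[OF integrable_ln_K_conv[OF m e]] bnd[OF integrable_potential[OF m]]
    by (simp only: distrib_left Bochner_Integration.integral_add)
  also have "\<dots> \<ge> C * ?a + 2 * c * ?q + (- c * ?q - (\<kappa> + c * \<epsilon>\<^sup>2 * gauss_moment TYPE('a)) * ?a - exp (- \<kappa>) * gauss_const TYPE('a) c)"
    using u entropy_tail[OF m e quad_potentialD(1) wm w, of \<kappa>] by linarith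
  also (xtrans) have "C * ?a + 2 * c * ?q + (- c * ?q - (\<kappa> + c * \<epsilon>\<^sup>2 * gauss_moment TYPE('a)) * ?a - exp (- \<kappa>) * gauss_const TYPE('a) c)
     \<ge> - ?D * ?a - exp (- \<kappa>) * gauss_const TYPE('a) c"
  proof -
    have "c * ?q \<ge> 0" using quad_potentialD(1) q0 by simp
    moreover have "C * ?a \<ge> - \<bar>C\<bar> * ?a" using a0 by (intro mult_right_mono) auto
    ultimately show ?thesis by (simp add: algebra_simps)
  qed
  also (xtrans) have "- ?D * ?a - exp (- \<kappa>) * gauss_const TYPE('a) c \<ge> - ?D * M / R\<^sup>2 - exp (- \<kappa>) * gauss_const TYPE('a) c"
    using mult_left_mono[OF aM D0] unfolding times_divide_eq_right mult_minus_left divide_minus_left by linarith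
  finally show ?thesis .
qed

text \<open>The margin \<delta> is split into five parts: two for the tail errors (through \<kappa>
  and R), one for cutting off at the limit measure, one for weak convergence of the cut-off
  integrals, and one for the uniform comparison of logarithms on the ball of radius 2 R.\<close>

lemma smoothed_energy_lsc:
  assumes w: "weak_conv_seq ms m" and ms: "\<And>n. ms n \<in> P2" and m: "m \<in> P2" and e: "\<epsilon> > 0"
    and M: "\<And>n. (\<integral>x. (norm x)\<^sup>2 \<partial>ms n) \<le> M" and \<delta>: "\<delta> > 0"
  shows "\<forall>\<^sub>F n in sequentially. smoothed_energy U \<epsilon> (ms n) \<ge> smoothed_energy U \<epsilon> m - \<delta>"
proof -
  note D = P2_D[OF m] and Ds = P2_D[OF ms]
  let ?Z = "gauss_const TYPE('a) c"
  have "((\<lambda>\<kappa>. exp (- \<kappa>) * ?Z) \<longlongrightarrow> 0 * ?Z) at_top"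
    by (intro tendsto_mult tendsto_const filterlim_compose[OF exp_at_bot] filterlim_uminus_at_bot_at_top)
  then have "\<forall>\<^sub>F \<kappa> in at_top. exp (- \<kappa>) * ?Z < \<delta> / 5" by (intro order_tendstoD(2)) (use \<delta> in auto)
  then obtain \<kappa> where \<kappa>: "\<kappa> > 0" "exp (- \<kappa>) * ?Z < \<delta> / 5"
    using eventually_conj[OF eventually_gt_at_top[of "0::real"]] by (metis (mono_tags, lifting) eventually_happens trivial_limit_at_top_linorder)
  let ?D = "\<bar>C\<bar> + c * \<epsilon>\<^sup>2 * gauss_moment TYPE('a) + \<kappa>"
  define T where "T n x = ln (K_conv \<epsilon> (ms n) x) + U x" for n x
  define T' where "T' x = ln (K_conv \<epsilon> m x) + U x" for x
  have cT': "continuous_on UNIV T'" unfolding T'_def using K_conv_pos[OF m e]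
    by (intro continuous_intros quad_potentialD continuous_K_conv D(2,3) e) (auto simp: less_imp_neq[symmetric])
  have iT: "integrable (ms n) (T n)" for n
    unfolding T_def by (intro Bochner_Integration.integrable_add integrable_ln_K_conv integrable_potential ms e)
  have iT': "integrable m T'"
    unfolding T'_def by (intro Bochner_Integration.integrable_add integrable_ln_K_conv integrable_potential m e)
  have E: "smoothed_energy U \<epsilon> (ms n) = (\<integral>x. T n x \<partial>ms n)" for n
    unfolding smoothed_energy_def T_def using integrable_ln_K_conv[OF ms e] integrable_potential[OF ms] by simp
  have E': "smoothed_energy U \<epsilon> m = (\<integral>x. T' x \<partial>m)"
    unfolding smoothed_energy_def T'_def using integrable_ln_K_conv[OF m e] integrable_potential[OF m] by simp
  have cm: "cutoff (real (Suc k)) \<in> borel_measurable (borel :: 'a measure)" for k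
    by (intro borel_measurable_continuous_onI continuous_cutoff) simp
  have lim1: "(\<lambda>k. \<integral>x. cutoff (real (Suc k)) x * T' x \<partial>m) \<longlonglongrightarrow> (\<integral>x. T' x \<partial>m)"
  proof (rule integral_dominated_convergence[where w="\<lambda>x. \<bar>T' x\<bar>"])
    show "AE x in m. (\<lambda>k. cutoff (real (Suc k)) x * T' x) \<longlonglongrightarrow> T' x"
      by (intro AE_I2) (use tendsto_mult[OF cutoff_tendsto tendsto_const] in fastforce)
    show "AE x in m. norm (cutoff (real (Suc k)) x * T' x) \<le> \<bar>T' x\<bar>" for k
      using cutoff_bounds by (auto intro!: AE_I2 simp: abs_mult mult_left_le_one_le)
    show "(\<lambda>x. cutoff (real (Suc k)) x * T' x) \<in> borel_measurable m" for k
      using cm[of k] iT' D(3) by (intro borel_measurable_times) (auto cong: measurable_cong_sets)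
  qed (use iT' in auto)
  have lim2: "(\<lambda>k. ?D * M / (real (Suc k))\<^sup>2) \<longlonglongrightarrow> 0"
    by (intro real_tendsto_divide_at_top[OF tendsto_const] filterlim_pow_at_top filterlim_compose[OF filterlim_real_sequentially filterlim_Suc]) auto
  have "\<forall>\<^sub>F k in sequentially. (\<integral>x. cutoff (real (Suc k)) x * T' x \<partial>m) > (\<integral>x. T' x \<partial>m) - \<delta> / 5 \<and> ?D * M / (real (Suc k))\<^sup>2 < \<delta> / 5"
    by (intro eventually_conj order_tendstoD(1)[OF lim1] order_tendstoD(2)[OF lim2]) (use \<delta> in auto)
  then obtain k where k: "(\<integral>x. cutoff (real (Suc k)) x * T' x \<partial>m) > (\<integral>x. T' x \<partial>m) - \<delta> / 5" "?D * M / (real (Suc k))\<^sup>2 < \<delta> / 5"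
    using eventually_happens'[OF sequentially_bot] by blast
  define R where "R = real (Suc k)"
  have R: "R > 0" by (simp add: R_def)
  note kR = k[folded R_def]
  \<comment> \<open>The integrand involves the limit density only, so it is one fixed bounded
    continuous function. The dependence of the logarithm on n is dealt with by
    \<open>ev2\<close>.\<close>
  have lim3: "(\<lambda>n. \<integral>x. cutoff R x * T' x \<partial>ms n) \<longlonglongrightarrow> (\<integral>x. cutoff R x * T' x \<partial>m)"
    using w bounded_continuous_times_cutoff[OF R cT'] unfolding weak_conv_seq_def by blast
  have ev1: "\<forall>\<^sub>F n in sequentially. (\<integral>x. cutoff R x * T' x \<partial>ms n) > (\<integral>x. cutoff R x * T' x \<partial>m) - \<delta> / 5"
    by (rule order_tendstoD(1)[OF lim3]) (use \<delta> in simp)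
  have ev2: "\<forall>\<^sub>F n in sequentially. \<forall>x\<in>cball 0 (2 * R). ln (K_conv \<epsilon> (ms n) x) \<ge> ln (K_conv \<epsilon> m x) - \<delta> / 5"
    by (rule ln_K_conv_uniform_on_compact[OF w ms m e]) (use \<delta> in auto)
  show ?thesis using ev1 ev2
  proof eventually_elim
    case (elim n)
    interpret mn: prob_space "ms n" by (rule Ds)
    have cR: "cutoff R \<in> borel_measurable (ms n)"
      using cm[of k] Ds(3)[of n] by (simp add: R_def cong: measurable_cong_sets)
    have ic: "integrable (ms n) (\<lambda>x. cutoff R x * T n x)"
      using cR iT[of n]
      by (intro Bochner_Integration.integrable_bound[OF iT[of n]]) (auto intro!: AE_I2 simp: abs_mult mult_left_le_one_le)
    obtain B where B: "\<And>x. norm (cutoff R x * T' x) \<le> B"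
      using bounded_continuous_times_cutoff(2)[OF R cT'] by (auto simp: bounded_iff)
    have ic': "integrable (ms n) (\<lambda>x. cutoff R x * T' x)"
      using B borel_measurable_continuous_onI[OF bounded_continuous_times_cutoff(1)[OF R cT']] Ds(3)[of n]
      by (intro mn.integrable_const_bound[of _ B]) (auto cong: measurable_cong_sets)
    have "(\<integral>x. cutoff R x * T' x - \<delta> / 5 \<partial>ms n) \<le> (\<integral>x. cutoff R x * T n x \<partial>ms n)"
    proof (intro integral_mono)
      fix x
      show "cutoff R x * T' x - \<delta> / 5 \<le> cutoff R x * T n x"
      proof (cases "norm x \<le> 2 * R")
        case True
        then have "T' x - \<delta> / 5 \<le> T n x" using elim(2) by (simp add: T_def T'_def)
        then have "cutoff R x * (T' x - \<delta> / 5) \<le> cutoff R x * T n x" using cutoff_bounds by (intro mult_left_mono) auto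
        moreover have "cutoff R x * (\<delta> / 5) \<le> 1 * (\<delta> / 5)" using cutoff_bounds \<delta> by (intro mult_right_mono) auto
        ultimately show ?thesis by (simp add: algebra_simps)
      next
        case False
        then show ?thesis using R \<delta> by (simp add: cutoff_eq_0)
      qed
    qed (use ic ic' in auto)
    then have 1: "(\<integral>x. cutoff R x * T' x \<partial>ms n) - \<delta> / 5 \<le> (\<integral>x. cutoff R x * T n x \<partial>ms n)"
      using ic' by (simp add: mn.prob_space)
    have 2: "(\<integral>x. (1 - cutoff R x) * T n x \<partial>ms n) \<ge> - ?D * M / R\<^sup>2 - exp (- \<kappa>) * ?Z"
      unfolding T_def by (rule smoothed_energy_tail[OF ms e M R \<kappa>(1)])
    have "(\<integral>x. (1 - cutoff R x) * T n x \<partial>ms n) = (\<integral>x. T n x \<partial>ms n) - (\<integral>x. cutoff R x * T n x \<partial>ms n)"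
      using ic iT[of n] by (simp add: left_diff_distrib)
    moreover have "- ?D * M / R\<^sup>2 = - (?D * M / R\<^sup>2)" by (simp only: mult_minus_left minus_divide_left)
    ultimately show ?case unfolding E E' using 1 2 elim(1) kR \<kappa>(2) by linarith
  qed
qed

end

section \<open>Comparison with the relative entropy and existence of minimizers\<close>

lemma F_assumption_lsc:
  assumes "F_assumption F Fmin CF LF" "\<And>n. ms n \<in> P2" "m \<in> P2" "weak_conv_seq ms m" "\<delta> > 0"
  shows "\<forall>\<^sub>F n in sequentially. F (ms n) > F m - \<delta>"
proof -
  have "ereal (F m) \<le> liminf (\<lambda>n. ereal (F (ms n)))"
    using assms unfolding F_assumption_def by blast
  moreover have "ereal (F m - \<delta>) < ereal (F m)" using assms(5) by simp
  ultimately have "ereal (F m - \<delta>) < liminf (\<lambda>n. ereal (F (ms n)))" by (rule less_le_trans[rotated])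
  then have "\<forall>\<^sub>F n in sequentially. ereal (F m - \<delta>) < ereal (F (ms n))" by (rule less_LiminfD)
  then show ?thesis by simp
qed

lemma F_assumption_bound: "F_assumption F Fmin CF LF \<Longrightarrow> m \<in> P2 \<Longrightarrow> Fmin \<le> F m"
  unfolding F_assumption_def by blast

section \<open>Relative entropy through its positive and negative parts\<close>

lemma KL_eq_integral:
  assumes "absolutely_continuous p m" "integrable m (\<lambda>x. ln (enn2real (RN_deriv p m x)))"
  shows "KL m p = ereal (\<integral>x. ln (enn2real (RN_deriv p m x)) \<partial>m)"
proof -
  let ?f = "\<lambda>x. ln (enn2real (RN_deriv p m x))"
  have i: "integrable m (\<lambda>x. max 0 (?f x))" "integrable m (\<lambda>x. max 0 (- ?f x))"
    using assms(2) by auto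
  have "(\<integral>x. ?f x \<partial>m) = (\<integral>x. max 0 (?f x) - max 0 (- ?f x) \<partial>m)"
    by (intro Bochner_Integration.integral_cong) auto
  also have "\<dots> = (\<integral>x. max 0 (?f x) \<partial>m) - (\<integral>x. max 0 (- ?f x) \<partial>m)"
    using i by simp
  finally have eq: "(\<integral>x. ?f x \<partial>m) = (\<integral>x. max 0 (?f x) \<partial>m) - (\<integral>x. max 0 (- ?f x) \<partial>m)" .
  have "(\<integral>\<^sup>+x. ennreal (max 0 (?f x)) \<partial>m) = ennreal (\<integral>x. max 0 (?f x) \<partial>m)"
    "(\<integral>\<^sup>+x. ennreal (max 0 (- ?f x)) \<partial>m) = ennreal (\<integral>x. max 0 (- ?f x) \<partial>m)"
    by (rule nn_integral_eq_integral; use i in simp)+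
  moreover have "(\<integral>x. max 0 (?f x) \<partial>m) \<ge> 0" "(\<integral>x. max 0 (- ?f x) \<partial>m) \<ge> 0"
    by (auto intro: integral_nonneg_AE)
  ultimately show ?thesis
    unfolding KL_def Let_def eq using assms(1) by (simp only: if_True simp_thms enn2ereal_ennreal ereal_minus)
qed

text \<open>From - ln r <= 1/r - 1 multiplied by r. It bounds negative parts of log-densities once
  they are integrated against the reference measure.\<close>

lemma ln_neg_part_times_le:
  fixes r :: real
  assumes "r \<ge> 0" shows "r * max 0 (- ln r) \<le> 1"
proof (cases "r = 0")
  case False
  then have r: "r > 0" using assms by simp
  have "- ln r \<le> 1 / r - 1" using ln_le_minus_one[of "1 / r"] r by (simp add: ln_div)
  then have "r * (- ln r) \<le> r * (1 / r - 1)" using r by (intro mult_left_mono) auto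
  then show ?thesis using r by (simp add: max_def algebra_simps)
qed simp

text \<open>The derivative is finite almost everywhere, so passing to reals through
  \<open>enn2real\<close>, as \<open>KL\<close> does, loses nothing.\<close>

lemma RN_deriv_real_density:
  assumes p: "prob_space p" and m: "prob_space m" and s: "sets m = sets p" and ac: "absolutely_continuous p m"
  shows "m = density p (\<lambda>x. ennreal (enn2real (RN_deriv p m x)))"
proof -
  interpret p: prob_space p by (rule p)
  interpret m: prob_space m by (rule m)
  have "AE x in p. RN_deriv p m x \<noteq> \<infinity>"
    by (rule p.RN_deriv_finite[OF m.sigma_finite_measure_axioms ac s])
  then have "density p (\<lambda>x. ennreal (enn2real (RN_deriv p m x))) = density p (RN_deriv p m)"
    by (intro density_cong) (auto elim!: eventually_mono simp: less_top)
  then show ?thesis using p.density_RN_deriv[OF ac s] by simp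
qed

text \<open>Rewritten over p, the integrand is r times the negative part of ln r. The bound keeps
  the difference in \<open>KL\<close> from being infinity minus infinity.\<close>

lemma KL_neg_part_le:
  assumes p: "prob_space p" and m: "prob_space m" and s: "sets m = sets p" and ac: "absolutely_continuous p m"
  shows "(\<integral>\<^sup>+x. ennreal (max 0 (- ln (enn2real (RN_deriv p m x)))) \<partial>m) \<le> 1"
proof -
  interpret p: prob_space p by (rule p)
  let ?r = "\<lambda>x. enn2real (RN_deriv p m x)"
  have "(\<integral>\<^sup>+x. ennreal (max 0 (- ln (?r x))) \<partial>m) = (\<integral>\<^sup>+x. ennreal (max 0 (- ln (?r x))) \<partial>density p (\<lambda>x. ennreal (?r x)))"
    using RN_deriv_real_density[OF assms] by simp
  also have "\<dots> = (\<integral>\<^sup>+x. ennreal (?r x) * ennreal (max 0 (- ln (?r x))) \<partial>p)"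
    by (rule nn_integral_density) auto
  also have "\<dots> \<le> (\<integral>\<^sup>+x. 1 \<partial>p)"
  proof (intro nn_integral_mono)
    fix x
    have "ennreal (?r x) * ennreal (max 0 (- ln (?r x))) = ennreal (?r x * max 0 (- ln (?r x)))"
      by (rule ennreal_mult[symmetric]) auto
    also have "\<dots> \<le> ennreal 1" by (intro ennreal_leI ln_neg_part_times_le) simp
    finally show "ennreal (?r x) * ennreal (max 0 (- ln (?r x))) \<le> 1" by simp
  qed
  also have "\<dots> = 1" by (simp add: p.emeasure_space_1)
  finally show ?thesis .
qed

lemma sets_pi_meas: "sets (pi_meas U) = sets borel" by (simp add: pi_meas_def)

context
  fixes U :: "'a::euclidean_space \<Rightarrow> real" and C c :: real
  assumes U: "quad_potential U C c"
begin

lemma prob_space_pi_meas: "prob_space (pi_meas U)"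
  using quad_potentialD(3,4)[OF U] by (intro prob_spaceI) (simp add: pi_meas_def pi_dens_def emeasure_density)

lemma pi_meas_P2: "pi_meas U \<in> P2"
proof -
  note [measurable] = quad_potentialD(3)[OF U]
  have "integrable lborel (\<lambda>x. exp (- U x) * (norm x)\<^sup>2)"
  proof (rule Bochner_Integration.integrable_bound)
    show "integrable lborel (\<lambda>x::'a. exp (- C) * ((norm x)\<^sup>2 * exp (- (2 * c) * (norm x)\<^sup>2)))"
      by (intro integrable_mult_right integrable_norm_sq_exp) (use quad_potentialD(1)[OF U] in simp)
    have "exp (- U x) * (norm x)\<^sup>2 \<le> exp (- C) * ((norm x)\<^sup>2 * exp (- (2 * c) * (norm x)\<^sup>2))" for x
    proof -
      have "exp (- U x) * (norm x)\<^sup>2 \<le> exp (- C - (2 * c) * (norm x)\<^sup>2) * (norm x)\<^sup>2"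
        using quad_potentialD(5)[OF U, of x] by (intro mult_right_mono) auto
      then show ?thesis by (simp add: exp_diff exp_minus field_simps)
    qed
    then show "AE x in lborel. norm (exp (- U x) * (norm x)\<^sup>2) \<le> norm (exp (- C) * ((norm x)\<^sup>2 * exp (- (2 * c) * (norm x)\<^sup>2)))"
      by (auto simp: abs_mult)
  qed auto
  then have "integrable (pi_meas U) (\<lambda>x. (norm x)\<^sup>2)"
    unfolding pi_meas_def pi_dens_def by (subst integrable_density) auto
  then show ?thesis using prob_space_pi_meas sets_pi_meas by (simp add: P2_def)
qed

text \<open>Gibbs' inequality: ln q <= q - 1 for the quotient q of the smoothed density by the
  density of m. Its m-integral is at most the total mass 1 of K_eps * m; there may be a loss, as the
  set where r vanishes is not seen by m.\<close>

lemma smoothed_energy_le_integral_ln: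
  assumes m: "m \<in> P2" and e: "\<epsilon> > 0" and r[measurable]: "r \<in> borel_measurable borel" and r0: "\<And>x. r x \<ge> 0"
    and mr: "m = density (pi_meas U) (\<lambda>x. ennreal (r x))" and int: "integrable m (\<lambda>x. ln (r x))"
  shows "smoothed_energy U \<epsilon> m \<le> (\<integral>x. ln (r x) \<partial>m)"
proof -
  note D = P2_D[OF m]
  interpret prob_space m by (rule D)
  have [measurable_cong]: "sets m = sets borel" by (rule D)
  note [measurable] = quad_potentialD(3)[OF U] measurable_K_conv[OF D(2,3) e]
  let ?q = "\<lambda>x. K_conv \<epsilon> m x * exp (U x) / r x"
  have q0: "?q x \<ge> 0" for x using r0[of x] K_conv_nonneg[OF D(2,3) e, of x] by simp
  have m_lb: "m = density lborel (\<lambda>x. ennreal (exp (- U x)) * ennreal (r x))"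
    by (subst mr) (simp add: pi_meas_def pi_dens_def density_density_eq)
  have dens: "(\<integral>\<^sup>+x. f x \<partial>m) = (\<integral>\<^sup>+x. (ennreal (exp (- U x)) * ennreal (r x)) * f x \<partial>lborel)"
    if "f \<in> borel_measurable borel" for f
    by (subst m_lb, rule nn_integral_density) (use that in auto)
  have "(\<integral>\<^sup>+x. ennreal (?q x) \<partial>m) = (\<integral>\<^sup>+x. (ennreal (exp (- U x)) * ennreal (r x)) * ennreal (?q x) \<partial>lborel)"
    by (rule dens) auto
  also have "\<dots> \<le> (\<integral>\<^sup>+x. ennreal (K_conv \<epsilon> m x) \<partial>lborel)"
  proof (intro nn_integral_mono)
    fix x
    have "(ennreal (exp (- U x)) * ennreal (r x)) * ennreal (?q x) = ennreal (exp (- U x) * r x * ?q x)"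
      using r0[of x] q0[of x] by (simp add: ennreal_mult'[symmetric])
    also have "exp (- U x) * r x * ?q x \<le> K_conv \<epsilon> m x"
      using K_conv_nonneg[OF D(2,3) e, of x] by (cases "r x = 0") (auto simp: exp_minus field_simps)
    finally show "(ennreal (exp (- U x)) * ennreal (r x)) * ennreal (?q x) \<le> ennreal (K_conv \<epsilon> m x)"
      by (simp add: ennreal_leI)
  qed
  also have "\<dots> = ennreal 1" using nn_integral_K_conv[OF D(2,3) e] D(7) by simp
  finally have nn: "(\<integral>\<^sup>+x. ennreal (?q x) \<partial>m) \<le> ennreal 1" .
  have iq: "integrable m ?q"
    using q0 le_less_trans[OF nn, of \<infinity>] by (intro integrableI_nonneg) auto
  have "ennreal (\<integral>x. ?q x \<partial>m) \<le> ennreal 1"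
    using nn nn_integral_eq_integral[OF iq] q0 by simp
  then have i1: "(\<integral>x. ?q x \<partial>m) \<le> 1" by (subst (asm) ennreal_le_iff) auto
  have "AE x in density lborel (\<lambda>x. ennreal (exp (- U x)) * ennreal (r x)). r x > 0"
    using r0 by (subst AE_density) (auto intro!: AE_I2 simp: less_le)
  then have rpos: "AE x in m. r x > 0" by (subst m_lb)
  have "(\<integral>x. ln (K_conv \<epsilon> m x) + U x \<partial>m) \<le> (\<integral>x. ln (r x) + (?q x - 1) \<partial>m)"
  proof (intro integral_mono_AE)
    show "AE x in m. ln (K_conv \<epsilon> m x) + U x \<le> ln (r x) + (?q x - 1)"
      using rpos
    proof eventually_elim
      case (elim x)
      have "ln (?q x) \<le> ?q x - 1" using elim K_conv_pos[OF m e] by (intro ln_le_minus_one) auto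
      moreover have "ln (?q x) = ln (K_conv \<epsilon> m x) + U x - ln (r x)"
        using elim K_conv_pos[OF m e, of x] by (simp add: ln_div ln_mult)
      ultimately show ?case by linarith
    qed
  qed (use int iq integrable_ln_K_conv[OF m e] integrable_potential[OF U m] in auto)
  also have "\<dots> = (\<integral>x. ln (r x) \<partial>m) + ((\<integral>x. ?q x \<partial>m) - 1)"
    using int iq by (simp add: prob_space)
  finally show ?thesis
    using i1 integrable_ln_K_conv[OF m e] integrable_potential[OF U m] by (simp add: smoothed_energy_def)
qed

text \<open>The density r = 1 gives a competitor whose energy is bounded independently of eps; it
  yields second-moment bounds on minimizers uniform in eps.\<close>

lemma smoothed_energy_pi_meas_le:
  assumes e: "\<epsilon> > 0"
  shows "smoothed_energy U \<epsilon> (pi_meas U) \<le> 0"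
  using smoothed_energy_le_integral_ln[OF pi_meas_P2 e, of "\<lambda>_. 1"] by (simp add: density_1)

text \<open>If m has no density, or if the positive part of the logarithm is not integrable, the
  right side is infinite; the latter uses that the negative part is always integrable.\<close>

lemma smoothed_energy_le_KL:
  assumes m: "m \<in> P2" and e: "\<epsilon> > 0"
  shows "ereal (smoothed_energy U \<epsilon> m) \<le> KL m (pi_meas U)"
proof (cases "absolutely_continuous (pi_meas U) m")
  case False
  then show ?thesis by (simp add: KL_def)
next
  case ac: True
  note D = P2_D[OF m]
  have s: "sets m = sets (pi_meas U)" by (simp add: D sets_pi_meas)
  let ?f = "\<lambda>x. ln (enn2real (RN_deriv (pi_meas U) m x))"
  have fm[measurable]: "RN_deriv (pi_meas U) m \<in> borel_measurable borel"
    using borel_measurable_RN_deriv[of "pi_meas U" m] sets_pi_meas[of U] by (simp cong: measurable_cong_sets)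
  have fmm: "?f \<in> borel_measurable m" using D(3) by (simp cong: measurable_cong_sets)
  have neg: "(\<integral>\<^sup>+x. ennreal (max 0 (- ?f x)) \<partial>m) \<le> 1"
    by (rule KL_neg_part_le[OF prob_space_pi_meas D(1) s ac])
  then have negf: "(\<integral>\<^sup>+x. ennreal (max 0 (- ?f x)) \<partial>m) < \<infinity>" by (rule le_less_trans) simp
  show ?thesis
  proof (cases "(\<integral>\<^sup>+x. ennreal (max 0 (?f x)) \<partial>m) = \<infinity>")
    case True
    obtain a where "(\<integral>\<^sup>+x. ennreal (max 0 (- ?f x)) \<partial>m) = ennreal a" "a \<ge> 0"
      using negf less_top_ennreal infinity_ennreal_def by metis
    then have "KL m (pi_meas U) = \<infinity>"
      unfolding KL_def Let_def using True ac by (simp only: if_True simp_thms enn2ereal_ennreal) simp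
    then show ?thesis by simp
  next
    case False
    have "integrable m (\<lambda>x. max 0 (?f x))"
      using False fmm by (intro integrableI_nonneg) (auto simp: top.not_eq_extremum)
    moreover have "integrable m (\<lambda>x. max 0 (- ?f x))"
      using negf fmm by (intro integrableI_nonneg) auto
    ultimately have "integrable m (\<lambda>x. max 0 (?f x) - max 0 (- ?f x))" by (rule Bochner_Integration.integrable_diff)
    moreover have "(\<lambda>x. max 0 (?f x) - max 0 (- ?f x)) = ?f" by auto
    ultimately have int: "integrable m ?f" by simp
    show ?thesis
      unfolding KL_eq_integral[OF ac int]
      using smoothed_energy_le_integral_ln[OF m e _ _ RN_deriv_real_density[OF prob_space_pi_meas D(1) s ac] int]
      by simp
  qed
qed

text \<open>Turns a bound on values into a bound on second moments, for minimizing sequences as well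
  as for families of minimizers.\<close>

lemma V_eps_lower:
  assumes hF: "F_assumption F Fmin CF LF" and \<sigma>: "\<sigma> > 0" and m: "m \<in> P2" and e: "\<epsilon> > 0"
  shows "\<sigma> * c * (\<integral>x. (norm x)\<^sup>2 \<partial>m)
     \<le> V_eps F U \<sigma> \<epsilon> m - (Fmin + \<sigma> * (C - c * \<epsilon>\<^sup>2 * gauss_moment TYPE('a) - gauss_const TYPE('a) c))"
proof -
  have "\<sigma> * (C + c * (\<integral>x. (norm x)\<^sup>2 \<partial>m) - c * \<epsilon>\<^sup>2 * gauss_moment TYPE('a) - gauss_const TYPE('a) c) \<le> \<sigma> * smoothed_energy U \<epsilon> m"
    using smoothed_energy_coercive[OF U m e] \<sigma> by (intro mult_left_mono) auto
  then show ?thesis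
    using F_assumption_bound[OF hF m] by (simp add: V_eps_eq[OF U m e] algebra_simps)
qed

lemma V_eps_minimizer_exists:
  assumes hF: "F_assumption F Fmin CF LF" and \<sigma>: "\<sigma> > 0" and e: "\<epsilon> > 0"
  shows "\<exists>\<mu>\<in>P2. \<forall>m\<in>P2. V_eps F U \<sigma> \<epsilon> \<mu> \<le> V_eps F U \<sigma> \<epsilon> m"
proof -
  let ?v = "V_eps F U \<sigma> \<epsilon>"
  define lb where "lb = Fmin + \<sigma> * (C - c * \<epsilon>\<^sup>2 * gauss_moment TYPE('a) - gauss_const TYPE('a) c)"
  have c: "c > 0" by (rule quad_potentialD[OF U])
  have low: "\<sigma> * c * (\<integral>x. (norm x)\<^sup>2 \<partial>m) \<le> ?v m - lb" if "m \<in> P2" for m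
    unfolding lb_def by (rule V_eps_lower[OF hF \<sigma> that e])
  have "lb \<le> ?v m" if "m \<in> P2" for m
  proof -
    have "\<sigma> * c * (\<integral>x. (norm x)\<^sup>2 \<partial>m) \<ge> 0" using \<sigma> c by (intro mult_nonneg_nonneg integral_nonneg_AE) auto
    then show ?thesis using low[OF that] by linarith
  qed
  then have bdd: "bdd_below (?v ` P2)" by (intro bdd_belowI2)
  define I where "I = Inf (?v ` P2)"
  have ne: "?v ` P2 \<noteq> {}" using pi_meas_P2 by blast
  have "\<exists>m\<in>P2. ?v m < I + 1 / real (Suc n)" for n
    using cInf_lessD[OF ne, of "I + 1 / real (Suc n)"] by (auto simp: I_def)
  then obtain ms where ms: "\<And>n. ms n \<in> P2" "\<And>n. ?v (ms n) < I + 1 / real (Suc n)" by metis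
  define M where "M = (I + 1 - lb) / (\<sigma> * c)"
  have M: "(\<integral>x. (norm x)\<^sup>2 \<partial>ms n) \<le> M" for n
  proof -
    have "1 / real (Suc n) \<le> 1" by simp
    then have "\<sigma> * c * (\<integral>x. (norm x)\<^sup>2 \<partial>ms n) \<le> I + 1 - lb" using low[OF ms(1)[of n]] ms(2)[of n] by linarith
    then show ?thesis using \<sigma> c by (simp add: M_def field_simps)
  qed
  obtain r m where r: "strict_mono r" and m: "m \<in> P2" and w: "weak_conv_seq (ms \<circ> r) m"
    by (rule P2_weakly_compact[OF ms(1) M])
  have msr: "(ms \<circ> r) n \<in> P2" for n using ms(1) by simp
  have Mr: "(\<integral>x. (norm x)\<^sup>2 \<partial>(ms \<circ> r) n) \<le> M" for n using M by simp
  have "?v m \<le> I"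
  proof (rule field_le_epsilon)
    fix \<delta> :: real assume \<delta>: "\<delta> > 0"
    \<comment> \<open>One \<eta> is spent on F, one on the gap to the infimum, and \<sigma> \<eta>
      on the energy.\<close>
    define \<eta> where "\<eta> = \<delta> / (2 + \<sigma>)"
    have \<eta>: "\<eta> > 0" "\<eta> * (2 + \<sigma>) = \<delta>" using \<delta> \<sigma> by (auto simp: \<eta>_def)
    have "\<forall>\<^sub>F n in sequentially. 1 / real (Suc n) < \<eta>"
      by (rule order_tendstoD(2)[OF LIMSEQ_Suc[OF lim_1_over_n]]) (use \<eta> in auto)
    then have "\<forall>\<^sub>F n in sequentially. F ((ms \<circ> r) n) > F m - \<eta> \<and> smoothed_energy U \<epsilon> ((ms \<circ> r) n) \<ge> smoothed_energy U \<epsilon> m - \<eta> \<and> 1 / real (Suc n) < \<eta>"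
      by (intro eventually_conj F_assumption_lsc[OF hF msr m w \<eta>(1)] smoothed_energy_lsc[OF U w msr m e Mr \<eta>(1)])
    then obtain n where n: "F (ms (r n)) > F m - \<eta>" "smoothed_energy U \<epsilon> (ms (r n)) \<ge> smoothed_energy U \<epsilon> m - \<eta>" "1 / real (Suc n) < \<eta>"
      using eventually_happens'[OF sequentially_bot] by fastforce
    have "1 / real (Suc (r n)) \<le> 1 / real (Suc n)" using seq_suble[OF r, of n] by (simp add: frac_le)
    then have "F (ms (r n)) + \<sigma> * smoothed_energy U \<epsilon> (ms (r n)) < I + \<eta>"
      using ms(2)[of "r n"] n(3) V_eps_eq[OF U ms(1) e, of F \<sigma> "r n"] by linarith
    moreover have "\<sigma> * smoothed_energy U \<epsilon> (ms (r n)) \<ge> \<sigma> * (smoothed_energy U \<epsilon> m - \<eta>)"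
      using n(2) \<sigma> by (intro mult_left_mono) auto
    ultimately show "?v m \<le> I + \<delta>"
      unfolding V_eps_eq[OF U m e] using n(1) \<eta>(2) by (simp add: algebra_simps)
  qed
  then show ?thesis
    using m cInf_lower[OF _ bdd] unfolding I_def by (meson imageI order_trans)
qed

end

section \<open>The limit of vanishing smoothing\<close>

text \<open>Fatou's lemma for weak convergence: a truncation min (g, N) with nearly the full
  integral under m is bounded and continuous, and it lies below g.\<close>

lemma weak_liminf_nonneg:
  fixes g :: "'a::euclidean_space \<Rightarrow> real"
  assumes w: "weak_conv_seq ms m" and m: "finite_measure m" "sets m = sets borel"
    and ms: "\<And>n. finite_measure (ms n)" "\<And>n. sets (ms n) = sets borel"
    and g: "continuous_on UNIV g" "\<And>x. g x \<ge> 0" "integrable m g" "\<And>n. integrable (ms n) g" and \<delta>: "\<delta> > 0"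
  shows "\<forall>\<^sub>F n in sequentially. (\<integral>x. g x \<partial>ms n) > (\<integral>x. g x \<partial>m) - \<delta>"
proof -
  have gm[measurable]: "g \<in> borel_measurable borel" by (rule borel_measurable_continuous_onI[OF g(1)])
  have [measurable_cong]: "sets m = sets borel" "\<And>n. sets (ms n) = sets borel" by (rule m ms)+
  have "(\<lambda>N. \<integral>x. min (g x) (real N) \<partial>m) \<longlonglongrightarrow> (\<integral>x. g x \<partial>m)"
  proof (rule integral_dominated_convergence[where w = g])
    show "AE x in m. (\<lambda>N. min (g x) (real N)) \<longlonglongrightarrow> g x"
    proof (intro AE_I2 tendsto_eventually)
      fix x
      obtain N :: nat where "g x \<le> real N" using real_arch_simple by blast
      then show "\<forall>\<^sub>F N in sequentially. min (g x) (real N) = g x"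
        by (intro eventually_sequentiallyI[of N]) (auto simp: min_def)
    qed
  qed (use g in auto)
  then have "\<forall>\<^sub>F N in sequentially. (\<integral>x. min (g x) (real N) \<partial>m) > (\<integral>x. g x \<partial>m) - \<delta>"
    by (rule order_tendstoD(1)) (use \<delta> in simp)
  then obtain N :: nat where N: "(\<integral>x. min (g x) (real N) \<partial>m) > (\<integral>x. g x \<partial>m) - \<delta>"
    using eventually_happens'[OF sequentially_bot] by blast
  have "(\<lambda>n. \<integral>x. min (g x) (real N) \<partial>ms n) \<longlonglongrightarrow> (\<integral>x. min (g x) (real N) \<partial>m)"
  proof (rule w[unfolded weak_conv_seq_def, rule_format], intro conjI)
    show "continuous_on UNIV (\<lambda>x. min (g x) (real N))" by (intro continuous_intros g(1))
    show "bounded (range (\<lambda>x. min (g x) (real N)))" using g(2)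
      by (auto intro!: boundedI[of _ "real N"])
  qed
  from order_tendstoD(1)[OF this N] show ?thesis
  proof eventually_elim
    case (elim n)
    have "(\<integral>x. min (g x) (real N) \<partial>ms n) \<le> (\<integral>x. g x \<partial>ms n)"
    proof (rule integral_mono)
      show "integrable (ms n) (\<lambda>x. min (g x) (real N))"
        using g(2) by (intro Bochner_Integration.integrable_bound[OF g(4)[of n]]) auto
    qed (auto intro: g)
    then show ?case using elim by simp
  qed
qed

text \<open>The test class of the dual bound: boundedness is for weak convergence, and the Lipschitz
  constant controls \<xi>_eps * b - b uniformly in x.\<close>

definition bounded_lipschitz :: "('a::euclidean_space \<Rightarrow> real) \<Rightarrow> bool" where
  "bounded_lipschitz b \<longleftrightarrow> (\<exists>B. \<forall>x. \<bar>b x\<bar> \<le> B) \<and> (\<exists>L\<ge>0. \<forall>x y. \<bar>b x - b y\<bar> \<le> L * norm (x - y))"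

lemma bounded_lipschitz_continuous:
  assumes "bounded_lipschitz b" shows "continuous_on UNIV b"
proof -
  obtain L where "L \<ge> 0" "\<And>x y. \<bar>b x - b y\<bar> \<le> L * norm (x - y)"
    using assms unfolding bounded_lipschitz_def by blast
  then have "L-lipschitz_on UNIV b" by (intro lipschitz_onI) (auto simp: dist_norm)
  then show ?thesis by (rule lipschitz_on_continuous_on)
qed

lemma bounded_lipschitz_measurable [measurable_dest]: "bounded_lipschitz b \<Longrightarrow> b \<in> borel_measurable borel"
  by (intro borel_measurable_continuous_onI bounded_lipschitz_continuous)

lemma bounded_lipschitz_add:
  assumes "bounded_lipschitz f" "bounded_lipschitz g"
  shows "bounded_lipschitz (\<lambda>x. f x + g x)"
proof -
  obtain B1 L1 where 1: "\<And>x. \<bar>f x\<bar> \<le> B1" "L1 \<ge> 0" "\<And>x y. \<bar>f x - f y\<bar> \<le> L1 * norm (x - y)"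
    using assms(1) unfolding bounded_lipschitz_def by blast
  obtain B2 L2 where 2: "\<And>x. \<bar>g x\<bar> \<le> B2" "L2 \<ge> 0" "\<And>x y. \<bar>g x - g y\<bar> \<le> L2 * norm (x - y)"
    using assms(2) unfolding bounded_lipschitz_def by blast
  have "\<bar>f x + g x\<bar> \<le> B1 + B2" for x using 1(1)[of x] 2(1)[of x] by linarith
  moreover have "\<bar>(f x + g x) - (f y + g y)\<bar> \<le> (L1 + L2) * norm (x - y)" for x y
    using 1(3)[of x y] 2(3)[of x y] unfolding distrib_right by linarith
  ultimately show ?thesis unfolding bounded_lipschitz_def using 1(2) 2(2) by (meson add_nonneg_nonneg)
qed

lemma bounded_lipschitz_scale:
  assumes "bounded_lipschitz f"
  shows "bounded_lipschitz (\<lambda>x. f x * a)"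
proof -
  obtain B L where 1: "\<And>x. \<bar>f x\<bar> \<le> B" "L \<ge> 0" "\<And>x y. \<bar>f x - f y\<bar> \<le> L * norm (x - y)"
    using assms(1) unfolding bounded_lipschitz_def by blast
  have "\<bar>f x * a\<bar> \<le> B * \<bar>a\<bar>" for x using 1(1)[of x] by (simp add: abs_mult mult_right_mono)
  moreover have "\<bar>f x * a - f y * a\<bar> \<le> (L * \<bar>a\<bar>) * norm (x - y)" for x y
  proof -
    have "\<bar>f x * a - f y * a\<bar> = \<bar>f x - f y\<bar> * \<bar>a\<bar>" by (simp only: left_diff_distrib[symmetric] abs_mult)
    then show ?thesis using mult_right_mono[OF 1(3)[of x y], of "\<bar>a\<bar>"] by (simp add: mult_ac)
  qed
  ultimately show ?thesis unfolding bounded_lipschitz_def using 1(2) by (meson abs_ge_zero mult_nonneg_nonneg)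
qed

lemma bounded_lipschitz_clamp:
  assumes "bounded_lipschitz f" "B \<ge> 0"
  shows "bounded_lipschitz (\<lambda>x. max (- B) (min B (f x)))"
proof -
  obtain L where 1: "L \<ge> 0" "\<And>x y. \<bar>f x - f y\<bar> \<le> L * norm (x - y)"
    using assms(1) unfolding bounded_lipschitz_def by blast
  have "\<bar>max (- B) (min B (f x))\<bar> \<le> B" for x using assms(2) by auto
  moreover have "\<bar>max (- B) (min B (f x)) - max (- B) (min B (f y))\<bar> \<le> L * norm (x - y)" for x y
    using 1(2)[of x y] by linarith
  ultimately show ?thesis unfolding bounded_lipschitz_def using 1(1) by blast
qed

lemma bounded_lipschitz_bump:
  assumes d: "d > 0"
  shows "bounded_lipschitz (\<lambda>x. max 0 (1 - infdist x K / d))"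
proof -
  have "\<bar>max 0 (1 - infdist x K / d)\<bar> \<le> 1" for x using d infdist_nonneg[of x K] by (auto simp: max_def)
  moreover have "\<bar>max 0 (1 - infdist x K / d) - max 0 (1 - infdist y K / d)\<bar> \<le> (1 / d) * norm (x - y)" for x y
  proof -
    have "\<bar>max 0 (1 - infdist x K / d) - max 0 (1 - infdist y K / d)\<bar> \<le> \<bar>infdist x K / d - infdist y K / d\<bar>" by linarith
    also have "\<dots> = \<bar>infdist x K - infdist y K\<bar> / d" using d by (simp add: diff_divide_distrib[symmetric])
    also have "\<dots> \<le> norm (x - y) / d" using d infdist_triangle_abs[of x K y] by (intro divide_right_mono) (auto simp: dist_norm)
    finally show ?thesis by simp
  qed
  ultimately show ?thesis unfolding bounded_lipschitz_def using d by (meson divide_nonneg_pos zero_le_one)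
qed

text \<open>Regularity gives a compact K inside A and an open V around A with V - K of small
  measure. A distance bump equal to 1 on K and 0 off V differs from the indicator only on V -
  K.\<close>

lemma indicator_approx_bounded_lipschitz:
  fixes \<nu> :: "'a::euclidean_space measure"
  assumes fin: "finite_measure \<nu>" and s: "sets \<nu> = sets borel" and A: "A \<in> sets borel" and e: "e > 0"
  obtains g where "bounded_lipschitz g" "(\<integral>x. \<bar>indicator A x - g x\<bar> \<partial>\<nu>) \<le> e"
proof -
  interpret finite_measure \<nu> by (rule fin)
  have [measurable_cong]: "sets \<nu> = sets borel" by (rule s)
  have sp: "space \<nu> = UNIV" using sets_eq_imp_space_eq[OF s] by simp
  note [measurable] = A
  have "emeasure \<nu> (space \<nu>) \<noteq> \<infinity>" by simp
  note reg = inner_regular[OF s this A] outer_regular[OF s this A]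
  have "\<exists>K. K \<subseteq> A \<and> compact K \<and> measure \<nu> A < measure \<nu> K + e/2"
  proof (cases "measure \<nu> A = 0")
    case True then show ?thesis using e by (intro exI[of _ "{}"]) auto
  next
    case False
    then have "measure \<nu> A > 0" by (simp add: zero_less_measure_iff)
    then have "ennreal (measure \<nu> A - e/2) < emeasure \<nu> A"
      using e unfolding emeasure_eq_measure by (intro ennreal_lessI) auto
    then obtain K where "K \<subseteq> A" "compact K" "ennreal (measure \<nu> A - e/2) < emeasure \<nu> K"
      unfolding reg(1) less_SUP_iff by blast
    moreover from this(3) have "measure \<nu> A - e/2 < measure \<nu> K"
      unfolding emeasure_eq_measure by (metis ennreal_leI not_le)
    ultimately show ?thesis by (intro exI[of _ K]) auto
  qed
  then obtain K where K: "K \<subseteq> A" "compact K" and mK: "measure \<nu> A < measure \<nu> K + e/2" by blast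
  have "emeasure \<nu> A < ennreal (measure \<nu> A + e/2)"
    using e unfolding emeasure_eq_measure by (intro ennreal_lessI) (auto intro: add_nonneg_pos)
  then obtain V where V: "A \<subseteq> V" "open V" "emeasure \<nu> V < ennreal (measure \<nu> A + e/2)"
    unfolding reg(2) INF_less_iff by blast
  then have mV: "measure \<nu> V < measure \<nu> A + e/2"
    unfolding emeasure_eq_measure by (metis ennreal_leI not_le)
  have Km[measurable]: "K \<in> sets borel" and Vm[measurable]: "V \<in> sets borel"
    using K V by (auto intro: borel_compact borel_open)
  have diff: "measure \<nu> (V - K) = measure \<nu> V - measure \<nu> K"
    using K V by (intro finite_measure_Diff) auto
  have "\<exists>g. bounded_lipschitz g \<and> (\<forall>x. \<bar>indicator A x - g x\<bar> \<le> indicator (V - K) x)"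
  proof (cases "K = {}")
    \<comment> \<open>\<open>infdist\<close> to the empty set is 0, so the bump would be constantly
      1; the zero function is taken instead.\<close>
    case True
    have "bounded_lipschitz (\<lambda>_::'a. 0)" unfolding bounded_lipschitz_def by auto
    moreover have "\<bar>indicator A x - 0\<bar> \<le> (indicator (V - K) x :: real)" for x
      using True V by (auto simp: indicator_def)
    ultimately show ?thesis by blast
  next
    case False
    obtain d where d: "d > 0" "\<And>x y. x \<in> K \<Longrightarrow> y \<in> - V \<Longrightarrow> d \<le> dist x y"
      using separate_compact_closed[of K "- V"] K(1,2) V(1,2) by (metis Compl_disjoint2 closed_Compl disjoint_eq_subset_Compl double_complement order_trans)
    let ?g = "\<lambda>x. max 0 (1 - infdist x K / d)"
    have "\<bar>indicator A x - ?g x\<bar> \<le> indicator (V - K) x" for x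
    proof -
      consider "x \<in> K" | "x \<notin> V" | "x \<in> V - K" by blast
      then show ?thesis
      proof cases
        case 1
        then show ?thesis using K(1) by (auto simp: indicator_def)
      next
        case 2
        have "d \<le> infdist x K"
          unfolding infdist_notempty[OF False] using d(2) 2 False by (intro cINF_greatest) (auto simp: dist_commute)
        then have "1 - infdist x K / d \<le> 0" using d by simp
        then show ?thesis using 2 V by (auto simp: indicator_def max_def)
      next
        case 3
        have "0 \<le> ?g x" "?g x \<le> 1" using d infdist_nonneg[of x K] by (auto simp: max_def)
        then show ?thesis using 3 by (auto simp: indicator_def)
      qed
    qed
    then show ?thesis using bounded_lipschitz_bump[OF d(1)] by blast
  qed
  then obtain g where g: "bounded_lipschitz g" "\<And>x. \<bar>indicator A x - g x\<bar> \<le> indicator (V - K) x" by blast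
  note [measurable] = bounded_lipschitz_measurable[OF g(1)]
  have "(\<integral>x. \<bar>indicator A x - g x\<bar> \<partial>\<nu>) \<le> (\<integral>x. indicator (V - K) x \<partial>\<nu>)"
  proof (rule integral_mono)
    show "integrable \<nu> (\<lambda>x. \<bar>indicator A x - g x\<bar>)"
    proof (rule integrable_const_bound[of _ 1])
      show "AE x in \<nu>. norm \<bar>indicator A x - g x\<bar> \<le> 1"
      proof (intro AE_I2)
        fix x
        have "(indicator (V - K) x :: real) \<le> 1" by (auto simp: indicator_def)
        then show "norm \<bar>indicator A x - g x\<bar> \<le> 1" using g(2)[of x] unfolding real_norm_def by linarith
      qed
    qed measurable
    show "integrable \<nu> (indicator (V - K) :: 'a \<Rightarrow> real)"
      by (rule integrable_real_indicator) (auto simp: emeasure_eq_measure)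
  qed (rule g(2))
  also have "\<dots> = measure \<nu> (V - K)" by (simp add: sp)
  also have "\<dots> \<le> e" using diff mK mV by linarith
  finally show ?thesis using that g(1) by blast
qed

lemma L1_approx_bounded_lipschitz:
  fixes \<nu> :: "'a::euclidean_space measure" and f :: "'a \<Rightarrow> real"
  assumes fin: "finite_measure \<nu>" and s: "sets \<nu> = sets borel" and f: "integrable \<nu> f"
  shows "\<forall>e>0. \<exists>g. bounded_lipschitz g \<and> (\<integral>x. \<bar>f x - g x\<bar> \<partial>\<nu>) \<le> e"
  using f
proof (induction rule: integrable_induct)
  case (base A c)
  have A: "A \<in> sets borel" using base s by simp
  show ?case
  proof (intro allI impI)
    fix e :: real assume e: "e > 0"
    obtain g where g: "bounded_lipschitz g" "(\<integral>x. \<bar>indicator A x - g x\<bar> \<partial>\<nu>) \<le> e / (\<bar>c\<bar> + 1)"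
      using indicator_approx_bounded_lipschitz[OF fin s A, of "e / (\<bar>c\<bar> + 1)"] e by (metis abs_ge_zero add_nonneg_pos divide_pos_pos zero_less_one)
    have "(\<integral>x. \<bar>indicator A x *\<^sub>R c - g x * c\<bar> \<partial>\<nu>) = (\<integral>x. \<bar>c\<bar> * \<bar>indicator A x - g x\<bar> \<partial>\<nu>)"
      by (intro Bochner_Integration.integral_cong) (auto simp: abs_mult[symmetric] algebra_simps)
    also have "\<dots> = \<bar>c\<bar> * (\<integral>x. \<bar>indicator A x - g x\<bar> \<partial>\<nu>)" by simp
    also have "\<dots> \<le> \<bar>c\<bar> * (e / (\<bar>c\<bar> + 1))" using g(2) by (intro mult_left_mono) auto
    also have "\<dots> \<le> e" using e by (simp add: field_simps)
    finally show "\<exists>g. bounded_lipschitz g \<and> (\<integral>x. \<bar>indicator A x *\<^sub>R c - g x\<bar> \<partial>\<nu>) \<le> e"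
      using bounded_lipschitz_scale[OF g(1), of c] by blast
  qed
next
  case (add f1 f2)
  interpret finite_measure \<nu> by (rule fin)
  have [measurable_cong]: "sets \<nu> = sets borel" by (rule s)
  have int: "integrable \<nu> g" if g: "bounded_lipschitz g" for g
  proof -
    obtain B where "\<And>x. \<bar>g x\<bar> \<le> B" using g unfolding bounded_lipschitz_def by blast
    then show ?thesis using bounded_lipschitz_measurable[OF g] by (intro integrable_const_bound[of _ B]) auto
  qed
  show ?case
  proof (intro allI impI)
    fix e :: real assume e: "e > 0"
    obtain g1 where g1: "bounded_lipschitz g1" "(\<integral>x. \<bar>f1 x - g1 x\<bar> \<partial>\<nu>) \<le> e/2" using add e half_gt_zero by blast
    obtain g2 where g2: "bounded_lipschitz g2" "(\<integral>x. \<bar>f2 x - g2 x\<bar> \<partial>\<nu>) \<le> e/2" using add e half_gt_zero by blast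
    have "(\<integral>x. \<bar>f1 x + f2 x - (g1 x + g2 x)\<bar> \<partial>\<nu>) \<le> (\<integral>x. \<bar>f1 x - g1 x\<bar> + \<bar>f2 x - g2 x\<bar> \<partial>\<nu>)"
      using add int[OF g1(1)] int[OF g2(1)] by (intro integral_mono) auto
    also have "\<dots> \<le> e" using add int[OF g1(1)] int[OF g2(1)] g1(2) g2(2) by simp
    finally show "\<exists>g. bounded_lipschitz g \<and> (\<integral>x. \<bar>f1 x + f2 x - g x\<bar> \<partial>\<nu>) \<le> e"
      using bounded_lipschitz_add[OF g1(1) g2(1)] by blast
  qed
next
  case (lim f u)
  interpret finite_measure \<nu> by (rule fin)
  have [measurable_cong]: "sets \<nu> = sets borel" by (rule s)
  have int: "integrable \<nu> g" if g: "bounded_lipschitz g" for g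
  proof -
    obtain B where "\<And>x. \<bar>g x\<bar> \<le> B" using g unfolding bounded_lipschitz_def by blast
    then show ?thesis using bounded_lipschitz_measurable[OF g] by (intro integrable_const_bound[of _ B]) auto
  qed
  \<comment> \<open>The induction supplies approximants with |u i| <= 2 |f|, hence the dominating
    function 3 |f|.\<close>
  have "(\<lambda>i. \<integral>x. \<bar>f x - u i x\<bar> \<partial>\<nu>) \<longlonglongrightarrow> (\<integral>x. 0 \<partial>\<nu>)"
  proof (rule integral_dominated_convergence[where w = "\<lambda>x. 3 * \<bar>f x\<bar>"])
    show "AE x in \<nu>. (\<lambda>i. \<bar>f x - u i x\<bar>) \<longlonglongrightarrow> 0"
    proof (intro AE_I2)
      fix x assume "x \<in> space \<nu>"
      then have "(\<lambda>i. \<bar>f x - u i x\<bar>) \<longlonglongrightarrow> \<bar>f x - f x\<bar>" by (intro tendsto_intros lim.hyps(2))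
      then show "(\<lambda>i. \<bar>f x - u i x\<bar>) \<longlonglongrightarrow> 0" by simp
    qed
    show "AE x in \<nu>. norm \<bar>f x - u i x\<bar> \<le> 3 * \<bar>f x\<bar>" for i
    proof (intro AE_I2)
      fix x assume "x \<in> space \<nu>"
      then have "\<bar>u i x\<bar> \<le> 2 * \<bar>f x\<bar>" using lim.hyps(3) by simp
      then show "norm \<bar>f x - u i x\<bar> \<le> 3 * \<bar>f x\<bar>" unfolding real_norm_def by linarith
    qed
    show "(\<lambda>x. \<bar>f x - u i x\<bar>) \<in> borel_measurable \<nu>" for i
      using lim.hyps(1)[of i] lim.hyps(4) by (intro borel_measurable_abs borel_measurable_diff) (auto intro: borel_measurable_integrable)
  qed (use lim.hyps in auto)
  then have conv: "(\<lambda>i. \<integral>x. \<bar>f x - u i x\<bar> \<partial>\<nu>) \<longlonglongrightarrow> 0" by simp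
  show ?case
  proof (intro allI impI)
    fix e :: real assume e: "e > 0"
    obtain i where i: "(\<integral>x. \<bar>f x - u i x\<bar> \<partial>\<nu>) < e / 2"
      using order_tendstoD(2)[OF conv, of "e/2"] e eventually_happens'[OF sequentially_bot] by fastforce
    obtain g where g: "bounded_lipschitz g" "(\<integral>x. \<bar>u i x - g x\<bar> \<partial>\<nu>) \<le> e/2" using lim.IH[of i] e half_gt_zero by blast
    have "(\<integral>x. \<bar>f x - g x\<bar> \<partial>\<nu>) \<le> (\<integral>x. \<bar>f x - u i x\<bar> + \<bar>u i x - g x\<bar> \<partial>\<nu>)"
      using lim.hyps(1)[of i] lim.hyps(4) int[OF g(1)] by (intro integral_mono) auto
    also have "\<dots> \<le> e" using lim.hyps(1)[of i] lim.hyps(4) int[OF g(1)] g(2) i by simp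
    finally show "\<exists>g. bounded_lipschitz g \<and> (\<integral>x. \<bar>f x - g x\<bar> \<partial>\<nu>) \<le> e" using g(1) by blast
  qed
qed

text \<open>Witnessed by \<mu> + \<gamma>. Approximating in L1 of this measure gives a single
  sequence that converges almost everywhere for both.\<close>

lemma common_dominating_measure:
  fixes \<mu> \<gamma> :: "'a measure"
  assumes "finite_measure \<mu>" "finite_measure \<gamma>" and s: "sets \<gamma> = sets \<mu>"
  shows "\<exists>\<nu>. finite_measure \<nu> \<and> sets \<nu> = sets \<mu> \<and>
    (\<forall>P. (AE x in \<nu>. P x) \<longrightarrow> (AE x in \<mu>. P x) \<and> (AE x in \<gamma>. P x))"
proof -
  interpret \<mu>: finite_measure \<mu> by fact
  interpret \<gamma>: finite_measure \<gamma> by fact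
  define \<nu> where "\<nu> = measure_of (space \<mu>) (sets \<mu>) (\<lambda>A. emeasure \<mu> A + emeasure \<gamma> A)"
  have sn: "sets \<nu> = sets \<mu>" by (simp add: \<nu>_def)
  have em: "emeasure \<nu> A = emeasure \<mu> A + emeasure \<gamma> A" if "A \<in> sets \<mu>" for A
    unfolding \<nu>_def
  proof (rule emeasure_measure_of_sigma)
    show "sigma_algebra (space \<mu>) (sets \<mu>)" by (rule sets.sigma_algebra_axioms)
    show "positive (sets \<mu>) (\<lambda>A. emeasure \<mu> A + emeasure \<gamma> A)" by (simp add: positive_def)
    show "countably_additive (sets \<mu>) (\<lambda>A. emeasure \<mu> A + emeasure \<gamma> A)"
      using s by (auto simp: countably_additive_def suminf_add[symmetric] suminf_emeasure)
  qed fact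
  have spn: "space \<nu> = space \<mu>" by (simp add: \<nu>_def)
  have fin: "finite_measure \<nu>"
    using em[of "space \<mu>"] s by (intro finite_measureI) (auto simp: spn \<mu>.emeasure_eq_measure \<gamma>.emeasure_eq_measure)
  have "(AE x in \<mu>. P x) \<and> (AE x in \<gamma>. P x)" if "AE x in \<nu>. P x" for P
  proof -
    from that obtain N where N: "N \<in> sets \<mu>" "emeasure \<nu> N = 0" "\<And>x. x \<in> space \<mu> - N \<Longrightarrow> P x"
    using sn spn by (auto elim!: AE_E3 simp: null_sets_def)
  then have "N \<in> null_sets \<mu>" "N \<in> null_sets \<gamma>" using em[of N] s by (auto simp: null_sets_def)
  then show ?thesis
    using N(3) sets_eq_imp_space_eq[OF s] by (auto intro!: AE_I'[of N])
  qed
  then show ?thesis using sn fin by blast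
qed

text \<open>The approximants are clamped to [-B, B], so that their exponentials stay below exp B. A
  subsequence converges almost everywhere for both measures, and dominated convergence passes to the
  limit in both integrals.\<close>

lemma exponential_bound_extends_to_bounded_measurable:
  fixes \<mu> \<gamma> :: "'a::euclidean_space measure" and f :: "'a \<Rightarrow> real"
  assumes \<mu>: "finite_measure \<mu>" "sets \<mu> = sets borel" and \<gamma>: "finite_measure \<gamma>" "sets \<gamma> = sets borel"
    and bl: "\<And>b. bounded_lipschitz b \<Longrightarrow> (\<integral>x. b x \<partial>\<mu>) - (\<integral>x. exp (b x) \<partial>\<gamma>) \<le> L"
    and f[measurable]: "f \<in> borel_measurable borel" and B: "\<And>x. \<bar>f x\<bar> \<le> B"
  shows "(\<integral>x. f x \<partial>\<mu>) - (\<integral>x. exp (f x) \<partial>\<gamma>) \<le> L"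
proof -
  interpret \<mu>: finite_measure \<mu> by (rule \<mu>)
  interpret \<gamma>: finite_measure \<gamma> by (rule \<gamma>)
  have B0: "B \<ge> 0" using B[of 0] by linarith
  have sgm: "sets \<gamma> = sets \<mu>" using \<mu> \<gamma> by simp
  obtain \<nu> where \<nu>: "finite_measure \<nu>" "sets \<nu> = sets \<mu>"
    and AE: "\<And>P. AE x in \<nu>. P x \<Longrightarrow> (AE x in \<mu>. P x) \<and> (AE x in \<gamma>. P x)"
    using common_dominating_measure[OF \<mu>(1) \<gamma>(1) sgm] by blast
  interpret \<nu>: finite_measure \<nu> by (rule \<nu>)
  have sn: "sets \<nu> = sets borel" using \<nu> \<mu> by simp
  note [measurable_cong] = \<mu>(2) \<gamma>(2) sn
  have "integrable \<nu> f" using B by (intro \<nu>.integrable_const_bound[of _ B]) auto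
  then have "\<exists>g. bounded_lipschitz g \<and> (\<integral>x. \<bar>f x - g x\<bar> \<partial>\<nu>) \<le> 1 / real (Suc n)" for n
    using L1_approx_bounded_lipschitz[OF \<nu>(1) sn, of f] by simp
  then obtain g0 where g0: "\<And>n. bounded_lipschitz (g0 n)" "\<And>n. (\<integral>x. \<bar>f x - g0 n x\<bar> \<partial>\<nu>) \<le> 1 / real (Suc n)" by metis
  define g where "g n x = max (- B) (min B (g0 n x))" for n x
  have g: "bounded_lipschitz (g n)" for n
    using bounded_lipschitz_clamp[OF g0(1)[of n] B0] by (simp add: g_def[abs_def])
  note gm[measurable] = bounded_lipschitz_measurable[OF g] bounded_lipschitz_measurable[OF g0(1)]
  have gB: "\<bar>g n x\<bar> \<le> B" for n x using B0 by (auto simp: g_def)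
  have ig0: "integrable \<nu> (g0 n)" for n
  proof -
    obtain B' where "\<And>x. \<bar>g0 n x\<bar> \<le> B'" using g0(1)[of n] unfolding bounded_lipschitz_def by blast
    then show ?thesis by (intro \<nu>.integrable_const_bound[of _ B']) auto
  qed
  have ig: "integrable \<nu> (g n)" for n using gB by (intro \<nu>.integrable_const_bound[of _ B]) auto
  have iff: "integrable \<nu> f" by fact
  have le: "(\<integral>x. norm (f x - g n x) \<partial>\<nu>) \<le> 1 / real (Suc n)" for n
  proof -
    \<comment> \<open>Clamping does not increase the error because f itself takes values in
      [-B, B].\<close>
    have "\<bar>f x - g n x\<bar> \<le> \<bar>f x - g0 n x\<bar>" for x using B[of x] by (auto simp: g_def)
    then have "(\<integral>x. norm (f x - g n x) \<partial>\<nu>) \<le> (\<integral>x. \<bar>f x - g0 n x\<bar> \<partial>\<nu>)"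
      using ig[of n] ig0[of n] iff by (intro integral_mono) auto
    then show ?thesis using g0(2)[of n] by simp
  qed
  have "(\<lambda>n. \<integral>x. norm (f x - g n x) \<partial>\<nu>) \<longlonglongrightarrow> 0"
    by (rule tendsto_sandwich[OF _ _ tendsto_const LIMSEQ_Suc[OF lim_1_over_n]]) (use le in \<open>auto intro!: always_eventually integral_nonneg_AE\<close>)
  then obtain r where r: "strict_mono r" "AE x in \<nu>. (\<lambda>n. f x - g (r n) x) \<longlonglongrightarrow> 0"
    using tendsto_L1_AE_subseq[of \<nu> "\<lambda>n x. f x - g n x"] ig iff by auto
  have "AE x in \<nu>. (\<lambda>n. g (r n) x) \<longlonglongrightarrow> f x"
    using r(2)
  proof eventually_elim
    case (elim x)
    then have "(\<lambda>n. f x - (f x - g (r n) x)) \<longlonglongrightarrow> f x - 0" by (intro tendsto_diff tendsto_const)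
    then show ?case by simp
  qed
  then have ae: "AE x in \<mu>. (\<lambda>n. g (r n) x) \<longlonglongrightarrow> f x" "AE x in \<gamma>. (\<lambda>n. g (r n) x) \<longlonglongrightarrow> f x"
    using AE by blast+
  have 1: "(\<lambda>n. \<integral>x. g (r n) x \<partial>\<mu>) \<longlonglongrightarrow> (\<integral>x. f x \<partial>\<mu>)"
    by (rule integral_dominated_convergence[where w = "\<lambda>_. B"]) (use ae(1) gB in auto)
  have 2: "(\<lambda>n. \<integral>x. exp (g (r n) x) \<partial>\<gamma>) \<longlonglongrightarrow> (\<integral>x. exp (f x) \<partial>\<gamma>)"
  proof (rule integral_dominated_convergence[where w = "\<lambda>_. exp B"])
    show "AE x in \<gamma>. (\<lambda>n. exp (g (r n) x)) \<longlonglongrightarrow> exp (f x)"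
      using ae(2) by eventually_elim (rule tendsto_exp)
    show "AE x in \<gamma>. norm (exp (g (r n) x)) \<le> exp B" for n
      using gB[of "r n"] by (auto simp: abs_le_iff)
  qed auto
  show ?thesis
    by (rule LIMSEQ_le_const2[OF tendsto_diff[OF 1 2]]) (use bl g in blast)
qed

section \<open>Passing to the limit in the dual bound and recovering the relative entropy\<close>

context
  fixes U :: "'a::euclidean_space \<Rightarrow> real" and C c :: real
  assumes U: "quad_potential U C c"
begin

lemma integrable_excess_potential: "m \<in> P2 \<Longrightarrow> integrable m (\<lambda>x. U x - c * (norm x)\<^sup>2)"
  by (intro Bochner_Integration.integrable_diff integrable_mult_right integrable_potential[OF U] P2_D(5))

lemma smoothed_energy_ge_bounded_lipschitz:
  assumes m: "m \<in> P2" and e: "\<epsilon> > 0" and b: "bounded_lipschitz b"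
    and L: "L \<ge> 0" "\<And>x y. \<bar>b x - b y\<bar> \<le> L * norm (x - y)"
  shows "smoothed_energy U \<epsilon> m \<ge> (\<integral>x. b x \<partial>m) + (\<integral>x. U x - c * (norm x)\<^sup>2 \<partial>m) + 1
     - (\<integral>y. exp (b y - c * (norm y)\<^sup>2) \<partial>lborel)
     - (L * (\<epsilon> * (1 + gauss_moment TYPE('a))) + c * \<epsilon>\<^sup>2 * gauss_moment TYPE('a))"
proof -
  note D = P2_D[OF m]
  let ?N = "gauss_meas \<epsilon> :: 'a measure" and ?S = "gauss_moment TYPE('a)"
  interpret m: prob_space m by (rule D)
  interpret N: prob_space ?N by (rule prob_space_gauss_meas[OF e])
  interpret P: pair_prob_space m ?N by standard
  have [measurable_cong]: "sets m = sets borel" by (rule D)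
  note bm[measurable] = bounded_lipschitz_measurable[OF b]
  obtain B where B: "\<And>x. \<bar>b x\<bar> \<le> B" using b unfolding bounded_lipschitz_def by blast
  have iP: "integrable (m \<Otimes>\<^sub>M ?N) (\<lambda>p. b (fst p + snd p))"
    using B by (intro P.P.integrable_const_bound[of _ B]) auto
  have iI: "integrable m (\<lambda>x. \<integral>z. b (x + z) \<partial>?N)"
    using P.integrable_fst'[OF iP] by simp
  have ib: "integrable m b" using B by (intro m.integrable_const_bound[of _ B]) auto
  have low: "b x - L * (\<epsilon> * (1 + ?S)) \<le> (\<integral>z. b (x + z) \<partial>?N)" for x
  proof -
    have i2: "integrable ?N (\<lambda>z. (norm z)\<^sup>2)" by (rule integrable_gauss_sq[OF e])
    have "(\<integral>z. b x - L * (\<epsilon> + (norm z)\<^sup>2 / \<epsilon>) \<partial>?N) \<le> (\<integral>z. b (x + z) \<partial>?N)"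
    proof (rule integral_mono)
      show "integrable ?N (\<lambda>z. b x - L * (\<epsilon> + (norm z)\<^sup>2 / \<epsilon>))" using i2 by auto
      show "integrable ?N (\<lambda>z. b (x + z))" using B by (intro N.integrable_const_bound[of _ B]) auto
      fix z :: 'a
      \<comment> \<open>Trades the first moment of the Gaussian for the second, which is known: eps
        + |z|^2 / eps has mean eps (1 + S), still of order eps.\<close>
      have "\<epsilon> * norm z \<le> \<epsilon>\<^sup>2 + (norm z)\<^sup>2"
        using sum_squares_bound[of \<epsilon> "norm z"] mult_nonneg_nonneg[OF less_imp_le[OF e] norm_ge_zero[of z]]
        by linarith
      then have "norm z \<le> \<epsilon> + (norm z)\<^sup>2 / \<epsilon>" using e by (simp add: field_simps power2_eq_square)
      then have "L * norm z \<le> L * (\<epsilon> + (norm z)\<^sup>2 / \<epsilon>)" using L(1) by (rule mult_left_mono)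
      then show "b x - L * (\<epsilon> + (norm z)\<^sup>2 / \<epsilon>) \<le> b (x + z)"
        using L(2)[of x "x + z"] by simp
    qed
    also have "(\<integral>z. b x - L * (\<epsilon> + (norm z)\<^sup>2 / \<epsilon>) \<partial>?N) = b x - L * (\<epsilon> + \<epsilon>\<^sup>2 * ?S / \<epsilon>)"
      using i2 by (simp add: integral_gauss_sq[OF e] N.prob_space[unfolded space_gauss_meas])
    also have "\<epsilon> + \<epsilon>\<^sup>2 * ?S / \<epsilon> = \<epsilon> * (1 + ?S)" using e by (simp add: field_simps power2_eq_square)
    finally show ?thesis .
  qed
  have "(\<integral>x. b x - L * (\<epsilon> * (1 + ?S)) \<partial>m) \<le> (\<integral>x. (\<integral>z. b (x + z) \<partial>?N) \<partial>m)"
    using ib iI low by (intro integral_mono) auto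
  then have 1: "(\<integral>x. b x \<partial>m) - L * (\<epsilon> * (1 + ?S)) \<le> (\<integral>x. (\<integral>z. b (x + z) \<partial>?N) \<partial>m)"
    using ib by (simp add: m.prob_space)
  have "(\<integral>x. U x - c * (norm x)\<^sup>2 \<partial>m) = (\<integral>x. U x \<partial>m) - c * (\<integral>x. (norm x)\<^sup>2 \<partial>m)"
    using integrable_potential[OF U m] D(5) by simp
  then show ?thesis
    using 1 entropy_lower_bound_gauss[OF D(2,3) e measurable_K_conv[OF D(2,3) e] K_conv_pos[OF m e]
      order_refl integrable_ln_K_conv[OF m e] D(5) bm B quad_potentialD(1)[OF U]] D(6)
    unfolding smoothed_energy_def by simp
qed

lemma smoothed_energy_liminf:
  assumes w: "weak_conv_seq ms m" and ms: "\<And>n. ms n \<in> P2" and m: "m \<in> P2"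
    and e: "\<And>n. \<epsilon> n > 0" "\<epsilon> \<longlonglongrightarrow> 0" and b: "bounded_lipschitz b" and \<delta>: "\<delta> > 0"
  shows "\<forall>\<^sub>F n in sequentially. smoothed_energy U (\<epsilon> n) (ms n) > (\<integral>x. b x \<partial>m) + (\<integral>x. U x - c * (norm x)\<^sup>2 \<partial>m) + 1
     - (\<integral>y. exp (b y - c * (norm y)\<^sup>2) \<partial>lborel) - \<delta>"
proof -
  note D = P2_D[OF m] and Ds = P2_D[OF ms]
  let ?S = "gauss_moment TYPE('a)"
  obtain L where L: "L \<ge> 0" "\<And>x y. \<bar>b x - b y\<bar> \<le> L * norm (x - y)"
    using b unfolding bounded_lipschitz_def by blast
  have "(\<lambda>n. L * (\<epsilon> n * (1 + ?S)) + c * (\<epsilon> n)\<^sup>2 * ?S) \<longlonglongrightarrow> L * (0 * (1 + ?S)) + c * 0\<^sup>2 * ?S"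
    by (intro tendsto_intros e(2))
  then have "(\<lambda>n. L * (\<epsilon> n * (1 + ?S)) + c * (\<epsilon> n)\<^sup>2 * ?S) \<longlonglongrightarrow> 0" by simp
  then have ev1: "\<forall>\<^sub>F n in sequentially. L * (\<epsilon> n * (1 + ?S)) + c * (\<epsilon> n)\<^sup>2 * ?S < \<delta> / 3"
    by (rule order_tendstoD(2)) (use \<delta> in simp)
  have "(\<lambda>n. \<integral>x. b x \<partial>ms n) \<longlonglongrightarrow> (\<integral>x. b x \<partial>m)"
  proof (rule w[unfolded weak_conv_seq_def, rule_format], intro conjI)
    show "continuous_on UNIV b" by (rule bounded_lipschitz_continuous[OF b])
    show "bounded (range b)" using b by (auto simp: bounded_lipschitz_def bounded_iff)
  qed
  then have ev2: "\<forall>\<^sub>F n in sequentially. (\<integral>x. b x \<partial>ms n) > (\<integral>x. b x \<partial>m) - \<delta> / 3"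
    by (rule order_tendstoD(1)) (use \<delta> in simp)
  \<comment> \<open>Unbounded above, so only a lower limit is available under weak convergence;
    subtracting C makes it nonnegative, as truncation from above requires.\<close>
  let ?g = "\<lambda>x. U x - c * (norm x)\<^sup>2 - C"
  have ev3: "\<forall>\<^sub>F n in sequentially. (\<integral>x. ?g x \<partial>ms n) > (\<integral>x. ?g x \<partial>m) - \<delta> / 3"
  proof (rule weak_liminf_nonneg[OF w D(2,3) Ds(2,3)])
    show "continuous_on UNIV ?g" by (intro continuous_intros quad_potentialD[OF U])
    show "?g x \<ge> 0" for x
    proof -
      have "c * (norm x)\<^sup>2 \<ge> 0" using quad_potentialD(1)[OF U] by simp
      then show ?thesis using quad_potentialD(5)[OF U, of x] by linarith
    qed
    have *: "integrable \<mu> ?g" if \<mu>: "\<mu> \<in> P2" for \<mu>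
    proof -
      interpret prob_space \<mu> by (rule P2_D[OF \<mu>])
      show ?thesis by (intro Bochner_Integration.integrable_diff[OF integrable_excess_potential[OF \<mu>]]) simp
    qed
    show "integrable m ?g" "integrable (ms n) ?g" for n by (intro * m ms)+
  qed (use \<delta> in simp)
  have g: "(\<integral>x. ?g x \<partial>\<mu>) = (\<integral>x. U x - c * (norm x)\<^sup>2 \<partial>\<mu>) - C" if \<mu>: "\<mu> \<in> P2" for \<mu>
  proof -
    interpret prob_space \<mu> by (rule P2_D[OF \<mu>])
    show ?thesis
      by (subst Bochner_Integration.integral_diff[OF integrable_excess_potential[OF \<mu>]]) (auto simp: prob_space)
  qed
  show ?thesis using ev1 ev2 ev3
  proof eventually_elim
    case (elim n)
    then show ?case
      using smoothed_energy_ge_bounded_lipschitz[OF ms e(1) b L, of n n] unfolding g[OF m] g[OF ms] by linarith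
  qed
qed

text \<open>The optimal test function is \<open>q = ln (d\<mu>/d\<gamma>)\<close>, up to truncation; it takes the value \<open>-n\<close> where the density vanishes,
  because \<open>ln 0 = 0\<close>.\<close>

lemma KL_le_of_dual_bound:
  assumes \<mu>: "\<mu> \<in> P2"
    and dual: "\<And>b. bounded_lipschitz b \<Longrightarrow>
      (\<integral>x. b x \<partial>\<mu>) + (\<integral>x. U x - c * (norm x)\<^sup>2 \<partial>\<mu>) + 1 - (\<integral>y. exp (b y - c * (norm y)\<^sup>2) \<partial>lborel) \<le> L"
  shows "KL \<mu> (pi_meas U) \<le> ereal L"
proof -
  note D = P2_D[OF \<mu>]
  interpret \<mu>: prob_space \<mu> by (rule D)
  have [measurable_cong]: "sets \<mu> = sets borel" by (rule D)
  have c: "c > 0" by (rule quad_potentialD[OF U])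
  note Um[measurable] = quad_potentialD(3)[OF U]
  define \<gamma> :: "'a measure" where "\<gamma> = density lborel (\<lambda>x. ennreal (exp (- c * (norm x)\<^sup>2)))"
  have sg: "sets \<gamma> = sets borel" by (simp add: \<gamma>_def)
  have spg: "space \<gamma> = UNIV" by (simp add: \<gamma>_def)
  let ?Z = "gauss_const TYPE('a) c"
  have Z: "emeasure \<gamma> UNIV = ennreal ?Z"
    unfolding \<gamma>_def gauss_const_def using integrable_exp_neg_sq[OF c, where 'a='a]
    by (subst emeasure_density) (auto simp: nn_integral_eq_integral)
  have Z0: "?Z \<ge> 0" unfolding gauss_const_def by (rule integral_nonneg_AE) simp
  have fg: "finite_measure \<gamma>" by (rule finite_measureI) (simp add: spg Z)
  interpret \<gamma>: finite_measure \<gamma> by (rule fg)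
  have mZ: "measure \<gamma> UNIV = ?Z" using Z Z0 by (simp add: measure_def)
  let ?W = "\<integral>x. U x - c * (norm x)\<^sup>2 \<partial>\<mu>"
  have dual_bounded: "(\<integral>x. f x \<partial>\<mu>) - (\<integral>x. exp (f x) \<partial>\<gamma>) \<le> L - 1 - ?W"
    if f: "f \<in> borel_measurable borel" "\<And>x. \<bar>f x\<bar> \<le> B" for f B
  proof (rule exponential_bound_extends_to_bounded_measurable[OF D(2,3) fg sg _ f])
    fix b :: "'a \<Rightarrow> real" assume b: "bounded_lipschitz b"
    note [measurable] = bounded_lipschitz_measurable[OF b]
    have "(\<integral>x. exp (b x) \<partial>\<gamma>) = (\<integral>y. exp (b y - c * (norm y)\<^sup>2) \<partial>lborel)"
      unfolding \<gamma>_def by (subst integral_density) (auto simp: mult_exp_exp)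
    then show "(\<integral>x. b x \<partial>\<mu>) - (\<integral>x. exp (b x) \<partial>\<gamma>) \<le> L - 1 - ?W" using dual[OF b] by simp
  qed
  have ac: "absolutely_continuous (pi_meas U) \<mu>"
    unfolding absolutely_continuous_def
  proof
    fix A assume "A \<in> null_sets (pi_meas U)"
    then have A: "A \<in> sets borel" and "AE x in lborel. x \<in> A \<longrightarrow> ennreal (exp (- U x)) = 0"
      unfolding pi_meas_def pi_dens_def by (auto simp: null_sets_density_iff)
    then have AE: "AE x in lborel. x \<notin> A" by (auto elim!: eventually_mono)
    note [measurable] = A
    have AEg: "AE x in \<gamma>. x \<notin> A" unfolding \<gamma>_def using AE by (subst AE_density) (auto elim!: eventually_mono)
    \<comment> \<open>On a null set A the function t 1_A costs nothing in the exponential term,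
      while its \<mu>-integral grows linearly in t. Since t is arbitrary, \<mu> cannot charge
      A.\<close>
    have t: "t * measure \<mu> A \<le> L - 1 - ?W + ?Z" if "t > 0" for t
    proof -
      have "(\<integral>x. t * indicator A x \<partial>\<mu>) - (\<integral>x. exp (t * indicator A x) \<partial>\<gamma>) \<le> L - 1 - ?W"
        by (rule dual_bounded[of _ t]) (use that in \<open>auto simp: indicator_def\<close>)
      moreover have "(\<integral>x. exp (t * indicator A x) \<partial>\<gamma>) = (\<integral>x. 1 \<partial>\<gamma>)"
      proof (rule integral_cong_AE)
        show "AE x in \<gamma>. exp (t * indicator A x) = 1" using AEg by eventually_elim simp
      qed (use sg in \<open>auto cong: measurable_cong_sets\<close>)
      ultimately show ?thesis by (simp add: spg mZ D)
    qed
    have "measure \<mu> A = 0"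
    proof (rule ccontr)
      assume "measure \<mu> A \<noteq> 0"
      then have p: "measure \<mu> A > 0" by (simp add: zero_less_measure_iff)
      let ?t = "(\<bar>L - 1 - ?W + ?Z\<bar> + 1) / measure \<mu> A"
      have "?t > 0" using p by (simp add: add_nonneg_pos)
      from t[OF this] show False using p by simp
    qed
    then show "A \<in> null_sets \<mu>" using A D(3) by (simp add: null_sets_def \<mu>.emeasure_eq_measure)
  qed
  let ?p = "pi_meas U"
  have s: "sets \<mu> = sets ?p" by (simp add: D sets_pi_meas)
  define \<rho> where "\<rho> x = enn2real (RN_deriv ?p \<mu> x)" for x
  have rm[measurable]: "\<rho> \<in> borel_measurable borel"
    using borel_measurable_RN_deriv[of ?p \<mu>] sets_pi_meas[of U] unfolding \<rho>_def[abs_def] by (simp cong: measurable_cong_sets)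
  have r0: "\<rho> x \<ge> 0" for x by (simp add: \<rho>_def)
  have "\<mu> = density ?p (\<lambda>x. ennreal (\<rho> x))"
    unfolding \<rho>_def by (rule RN_deriv_real_density[OF prob_space_pi_meas[OF U] D(1) s ac])
  then have dens: "\<mu> = density lborel (\<lambda>x. ennreal (exp (- U x)) * ennreal (\<rho> x))"
    by (simp add: pi_meas_def pi_dens_def density_density_eq)
  have nn: "(\<integral>\<^sup>+x. f x \<partial>\<mu>) = (\<integral>\<^sup>+x. (ennreal (exp (- U x)) * ennreal (\<rho> x)) * f x \<partial>lborel)"
    if "f \<in> borel_measurable borel" for f
    by (subst dens, rule nn_integral_density) (use that in auto)
  have "AE x in density lborel (\<lambda>x. ennreal (exp (- U x)) * ennreal (\<rho> x)). \<rho> x > 0"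
    using r0 by (subst AE_density) (auto intro!: AE_I2 simp: less_le)
  then have rpos: "AE x in \<mu>. \<rho> x > 0" by (subst dens)
  have total: "(\<integral>\<^sup>+x. ennreal (exp (- U x)) * ennreal (\<rho> x) \<partial>lborel) = 1"
    using nn[of "\<lambda>_. 1"] D(4,7) by simp
  define q where "q x = ln (\<rho> x) - U x + c * (norm x)\<^sup>2" for x
  have qm[measurable]: "q \<in> borel_measurable borel" unfolding q_def[abs_def] by measurable
  have eq: "exp (q x) = \<rho> x * exp (- U x) * exp (c * (norm x)\<^sup>2)" if "\<rho> x > 0" for x
    using that by (simp add: q_def exp_add exp_diff exp_minus field_simps)
  \<comment> \<open>With respect to \<gamma> the density of \<mu> is exp q, so the integrand is
    again r times the negative part of ln r, with r = exp q; this gives the mass of \<gamma> as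
    bound.\<close>
  have negq: "(\<integral>\<^sup>+x. ennreal (max 0 (- q x)) \<partial>\<mu>) \<le> ennreal ?Z"
  proof -
    have "(\<integral>\<^sup>+x. ennreal (max 0 (- q x)) \<partial>\<mu>) = (\<integral>\<^sup>+x. (ennreal (exp (- U x)) * ennreal (\<rho> x)) * ennreal (max 0 (- q x)) \<partial>lborel)"
      by (rule nn) measurable
    also have "\<dots> \<le> (\<integral>\<^sup>+x. ennreal (exp (- c * (norm (x::'a))\<^sup>2)) \<partial>lborel)"
    proof (intro nn_integral_mono)
      fix x
      have "exp (- U x) * \<rho> x * max 0 (- q x) \<le> exp (- c * (norm x)\<^sup>2)"
      proof (cases "\<rho> x = 0")
        case False
        then have r: "\<rho> x > 0" using r0[of x] by simp
        have "exp (- U x) * \<rho> x = exp (q x) * exp (- c * (norm x)\<^sup>2)"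
          unfolding eq[OF r] by (simp add: exp_minus field_simps)
        moreover have "exp (q x) * max 0 (- q x) \<le> 1"
          using ln_neg_part_times_le[of "exp (q x)"] by simp
        then have "exp (- c * (norm x)\<^sup>2) * (exp (q x) * max 0 (- q x)) \<le> exp (- c * (norm x)\<^sup>2) * 1"
          by (intro mult_left_mono) auto
        ultimately show ?thesis by (simp only: mult_ac mult_1_right)
      qed simp
      moreover have "(ennreal (exp (- U x)) * ennreal (\<rho> x)) * ennreal (max 0 (- q x)) = ennreal (exp (- U x) * \<rho> x * max 0 (- q x))"
        using r0 by (simp only: ennreal_mult[symmetric] exp_ge_zero max.cobounded1 mult_nonneg_nonneg)
      ultimately show "(ennreal (exp (- U x)) * ennreal (\<rho> x)) * ennreal (max 0 (- q x)) \<le> ennreal (exp (- c * (norm x)\<^sup>2))"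
        by (simp only: ennreal_leI)
    qed
    also have "\<dots> = ennreal ?Z"
      unfolding gauss_const_def using integrable_exp_neg_sq[OF c, where 'a='a] by (intro nn_integral_eq_integral) auto
    finally show ?thesis .
  qed
  have ineg: "integrable \<mu> (\<lambda>x. max 0 (- q x))"
    using le_less_trans[OF negq, of \<infinity>] by (intro integrableI_nonneg) auto
  define f where "f n x = (if \<rho> x > 0 then max (- real n) (min (real n) (q x)) else - real n)" for n x
  have fm[measurable]: "f n \<in> borel_measurable borel" for n unfolding f_def[abs_def] by measurable
  have fB: "\<bar>f n x\<bar> \<le> real n" for n x by (auto simp: f_def)
  have ifn: "integrable \<mu> (f n)" for n using fB[of n] by (intro \<mu>.integrable_const_bound[of _ "real n"]) auto
  \<comment> \<open>Where \<rho> > 0, exp f is at most exp (-n) + exp q, and exp q integrates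
    against \<gamma> to the mass 1 of \<mu>; elsewhere exp f is just exp (-n).\<close>
  have expf: "(\<integral>x. exp (f n x) \<partial>\<gamma>) \<le> exp (- real n) * ?Z + 1" for n
  proof -
    have "ennreal (\<integral>x. exp (f n x) \<partial>\<gamma>) = (\<integral>\<^sup>+x. ennreal (exp (f n x)) \<partial>\<gamma>)"
    proof (rule nn_integral_eq_integral[symmetric])
      show "integrable \<gamma> (\<lambda>x. exp (f n x))"
        using fB[of n] sg by (intro \<gamma>.integrable_const_bound[of _ "exp (real n)"]) (auto simp: abs_le_iff cong: measurable_cong_sets)
    qed simp
    also have "\<dots> = (\<integral>\<^sup>+x. ennreal (exp (- c * (norm x)\<^sup>2)) * ennreal (exp (f n x)) \<partial>lborel)"
      unfolding \<gamma>_def by (rule nn_integral_density) measurable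
    also have "\<dots> \<le> (\<integral>\<^sup>+x. ennreal (exp (- real n)) * ennreal (exp (- c * (norm x)\<^sup>2)) + ennreal (exp (- U x)) * ennreal (\<rho> x) \<partial>lborel)"
    proof (intro nn_integral_mono)
      fix x
      have "exp (- c * (norm x)\<^sup>2) * exp (f n x) \<le> exp (- real n) * exp (- c * (norm x)\<^sup>2) + exp (- U x) * \<rho> x"
      proof (cases "\<rho> x > 0")
        case True
        have "f n x \<le> max (- real n) (q x)" using True by (auto simp: f_def)
        then have "exp (f n x) \<le> exp (- real n) + exp (q x)"
          by (smt (verit) exp_le_cancel_iff exp_ge_zero)
        then have "exp (- c * (norm x)\<^sup>2) * exp (f n x) \<le> exp (- c * (norm x)\<^sup>2) * (exp (- real n) + exp (q x))"
          by (intro mult_left_mono) auto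
        also have "\<dots> = exp (- real n) * exp (- c * (norm x)\<^sup>2) + exp (- U x) * \<rho> x"
          unfolding eq[OF True] by (simp add: exp_minus field_simps)
        finally show ?thesis .
      next
        case False
        then show ?thesis using r0[of x] by (simp add: f_def)
      qed
      then have "ennreal (exp (- c * (norm x)\<^sup>2) * exp (f n x)) \<le> ennreal (exp (- real n) * exp (- c * (norm x)\<^sup>2) + exp (- U x) * \<rho> x)"
        by (rule ennreal_leI)
      then show "ennreal (exp (- c * (norm x)\<^sup>2)) * ennreal (exp (f n x))
          \<le> ennreal (exp (- real n)) * ennreal (exp (- c * (norm x)\<^sup>2)) + ennreal (exp (- U x)) * ennreal (\<rho> x)"
        using r0[of x] by (simp add: ennreal_mult' ennreal_plus)
    qed
    also have "\<dots> = ennreal (exp (- real n)) * (\<integral>\<^sup>+x. ennreal (exp (- c * (norm (x::'a))\<^sup>2)) \<partial>lborel) + 1"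
      by (subst nn_integral_add) (auto simp: nn_integral_cmult total)
    also have "(\<integral>\<^sup>+x. ennreal (exp (- c * (norm (x::'a))\<^sup>2)) \<partial>lborel) = ennreal ?Z"
      unfolding gauss_const_def using integrable_exp_neg_sq[OF c, where 'a='a] by (intro nn_integral_eq_integral) auto
    also have "ennreal (exp (- real n)) * ennreal ?Z + 1 = ennreal (exp (- real n) * ?Z + 1)"
      using Z0 by (simp add: ennreal_mult' ennreal_plus)
    finally show ?thesis using Z0 by (subst (asm) ennreal_le_iff) (auto intro: add_nonneg_nonneg)
  qed
  \<comment> \<open>The mass 1 from \<open>expf\<close> cancels the 1 in the dual bound exactly, so
    no constant is lost in the limit.\<close>
  have fint: "(\<integral>x. f n x \<partial>\<mu>) \<le> L - ?W + exp (- real n) * ?Z" for n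
    using dual_bounded[OF fm fB, of n] expf[of n] by linarith
  \<comment> \<open>Integrability of q is not yet known. The truncated positive part is bounded by f
    plus the negative part of q, whose integral is already finite; this makes the positive part
    integrable as well.\<close>
  have trunc: "(\<integral>x. min (max 0 (q x)) (real n) \<partial>\<mu>) \<le> L - ?W + ?Z + (\<integral>x. max 0 (- q x) \<partial>\<mu>)" for n
  proof -
    have "(\<integral>x. min (max 0 (q x)) (real n) \<partial>\<mu>) \<le> (\<integral>x. f n x + max 0 (- q x) \<partial>\<mu>)"
    proof (rule integral_mono_AE)
      show "integrable \<mu> (\<lambda>x. min (max 0 (q x)) (real n))" by (intro \<mu>.integrable_const_bound[of _ "real n"]) auto
      show "AE x in \<mu>. min (max 0 (q x)) (real n) \<le> f n x + max 0 (- q x)"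
        using rpos by eventually_elim (auto simp: f_def)
    qed (use ifn[of n] ineg in auto)
    also have "\<dots> = (\<integral>x. f n x \<partial>\<mu>) + (\<integral>x. max 0 (- q x) \<partial>\<mu>)" using ifn[of n] ineg by simp
    also have "exp (- real n) * ?Z \<le> 1 * ?Z" using Z0 by (intro mult_right_mono) auto
    then have "(\<integral>x. f n x \<partial>\<mu>) \<le> L - ?W + ?Z" using fint[of n] by linarith
    finally show ?thesis by linarith
  qed
  have "(\<integral>\<^sup>+x. ennreal (max 0 (q x)) \<partial>\<mu>) \<le> ennreal (L - ?W + ?Z + (\<integral>x. max 0 (- q x) \<partial>\<mu>))"
    by (rule nn_integral_le_of_truncations[OF D(2) _ _ trunc]) auto
  then have "(\<integral>\<^sup>+x. ennreal (max 0 (q x)) \<partial>\<mu>) < \<infinity>" by (rule le_less_trans) simp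
  then have ipos: "integrable \<mu> (\<lambda>x. max 0 (q x))" by (intro integrableI_nonneg) auto
  have "integrable \<mu> (\<lambda>x. max 0 (q x) - max 0 (- q x))" by (intro Bochner_Integration.integrable_diff ipos ineg)
  moreover have "(\<lambda>x. max 0 (q x) - max 0 (- q x)) = q" by auto
  ultimately have iq: "integrable \<mu> q" by simp
  have lim1: "(\<lambda>n. \<integral>x. f n x \<partial>\<mu>) \<longlonglongrightarrow> (\<integral>x. q x \<partial>\<mu>)"
  proof (rule integral_dominated_convergence[where w = "\<lambda>x. \<bar>q x\<bar>"])
    show "AE x in \<mu>. (\<lambda>n. f n x) \<longlonglongrightarrow> q x"
      using rpos
    proof eventually_elim
      case (elim x)
      obtain N :: nat where "\<bar>q x\<bar> \<le> real N" using real_arch_simple by blast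
      then have "\<forall>\<^sub>F n in sequentially. f n x = q x"
        using elim by (intro eventually_sequentiallyI[of N]) (auto simp: f_def min_def max_def)
      then show ?case by (rule tendsto_eventually)
    qed
    show "AE x in \<mu>. norm (f n x) \<le> \<bar>q x\<bar>" for n
      using rpos by eventually_elim (auto simp: f_def)
  qed (use iq in auto)
  have "(\<lambda>n. exp (- real n)) \<longlonglongrightarrow> 0"
    by (intro filterlim_compose[OF exp_at_bot] filterlim_compose[OF filterlim_uminus_at_bot_at_top filterlim_real_sequentially])
  then have "(\<lambda>n. L - ?W + exp (- real n) * ?Z) \<longlonglongrightarrow> L - ?W + 0 * ?Z" by (intro tendsto_intros)
  then have qle: "(\<integral>x. q x \<partial>\<mu>) \<le> L - ?W" using LIMSEQ_le[OF lim1] fint by fastforce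
  \<comment> \<open>Going back from \<gamma> to \<pi>: adding the excess potential to q restores the
    log-density with respect to \<pi>, and its integral cancels the subtracted one.\<close>
  have ln_eq: "(\<lambda>x. ln (\<rho> x)) = (\<lambda>x. q x + (U x - c * (norm x)\<^sup>2))" by (auto simp: q_def)
  have iln: "integrable \<mu> (\<lambda>x. ln (\<rho> x))"
    unfolding ln_eq by (intro Bochner_Integration.integrable_add iq integrable_excess_potential \<mu>)
  have "(\<integral>x. ln (\<rho> x) \<partial>\<mu>) = (\<integral>x. q x \<partial>\<mu>) + ?W"
    unfolding ln_eq by (intro Bochner_Integration.integral_add iq integrable_excess_potential \<mu>)
  then have "(\<integral>x. ln (\<rho> x) \<partial>\<mu>) \<le> L" using qle by linarith
  moreover have "KL \<mu> ?p = ereal (\<integral>x. ln (\<rho> x) \<partial>\<mu>)"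
    using KL_eq_integral[OF ac] iln unfolding \<rho>_def by simp
  ultimately show ?thesis by simp
qed

end

theorem mainTheorem9:
  fixes F :: "'a::euclidean_space measure \<Rightarrow> real"
    and U :: "'a \<Rightarrow> real"
    and Fmin CF LF \<sigma> :: real
  assumes hF: "F_assumption F Fmin CF LF"
    and hpi: "pi_assumption U"
    and h\<sigma>: "\<sigma> > 0"
  shows "(\<forall>\<epsilon>>0. \<exists>\<mu>\<in>P2. \<forall>m\<in>P2. V_eps F U \<sigma> \<epsilon> \<mu> \<le> V_eps F U \<sigma> \<epsilon> m)
    \<and> (\<forall>\<mu>e :: real \<Rightarrow> 'a measure.
          (\<forall>\<epsilon>>0. \<mu>e \<epsilon> \<in> P2 \<and> (\<forall>m\<in>P2. V_eps F U \<sigma> \<epsilon> (\<mu>e \<epsilon>) \<le> V_eps F U \<sigma> \<epsilon> m)) \<longrightarrow>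
          (\<exists>\<epsilon>k :: nat \<Rightarrow> real. \<exists>\<mu>\<in>P2. (\<forall>k. \<epsilon>k k > 0) \<and> \<epsilon>k \<longlonglongrightarrow> 0 \<and>
             weak_conv_seq (\<lambda>k. \<mu>e (\<epsilon>k k)) \<mu> \<and>
             (\<forall>m\<in>P2. V F U \<sigma> \<mu> \<le> V F U \<sigma> m)))"
proof -
  obtain C c where U: "quad_potential U C c" using pi_assumption_quad_potential[OF hpi] by blast
  have c: "c > 0" by (rule quad_potentialD[OF U])
  show ?thesis
  proof (intro conjI allI impI)
    fix \<epsilon> :: real assume "\<epsilon> > 0"
    then show "\<exists>\<mu>\<in>P2. \<forall>m\<in>P2. V_eps F U \<sigma> \<epsilon> \<mu> \<le> V_eps F U \<sigma> \<epsilon> m"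
      by (rule V_eps_minimizer_exists[OF U hF h\<sigma>])
  next
    fix \<mu>e :: "real \<Rightarrow> 'a measure"
    assume min: "\<forall>\<epsilon>>0. \<mu>e \<epsilon> \<in> P2 \<and> (\<forall>m\<in>P2. V_eps F U \<sigma> \<epsilon> (\<mu>e \<epsilon>) \<le> V_eps F U \<sigma> \<epsilon> m)"
    let ?S = "gauss_moment TYPE('a)" and ?Z = "gauss_const TYPE('a) c"
    define ms where "ms n = \<mu>e (1 / real (Suc n))" for n
    have ms: "ms n \<in> P2" for n using min by (simp add: ms_def)
    \<comment> \<open>The competitor \<pi> has value at most F(\<pi>) for every eps, and eps =
      1/(n+1) <= 1 bounds the eps^2 term by its value at 1. Hence M does not depend on n.\<close>
    define M where "M = (F (pi_meas U) - (Fmin + \<sigma> * (C - c * ?S - ?Z))) / (\<sigma> * c)"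
    have M: "(\<integral>x. (norm x)\<^sup>2 \<partial>ms n) \<le> M" for n
    proof -
      let ?e = "1 / real (Suc n)"
      have e: "?e > 0" by simp
      have "V_eps F U \<sigma> ?e (ms n) \<le> V_eps F U \<sigma> ?e (pi_meas U)"
        using min e pi_meas_P2[OF U] unfolding ms_def by blast
      also have "\<dots> \<le> F (pi_meas U)"
        using mult_nonneg_nonpos[of \<sigma>, OF _ smoothed_energy_pi_meas_le[OF U e]] h\<sigma>
        unfolding V_eps_eq[OF U pi_meas_P2[OF U] e] by linarith
      finally have 1: "V_eps F U \<sigma> ?e (ms n) \<le> F (pi_meas U)" .
      have "?e\<^sup>2 \<le> 1" by (rule power_le_one) auto
      then have "c * ?e\<^sup>2 * ?S \<le> c * 1 * ?S"
        using c gauss_moment_nonneg[where 'a='a] by (intro mult_right_mono mult_left_mono) auto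
      then have "\<sigma> * (C - c * ?S - ?Z) \<le> \<sigma> * (C - c * ?e\<^sup>2 * ?S - ?Z)"
        using h\<sigma> by (intro mult_left_mono) auto
      then have "\<sigma> * c * (\<integral>x. (norm x)\<^sup>2 \<partial>ms n) \<le> F (pi_meas U) - (Fmin + \<sigma> * (C - c * ?S - ?Z))"
        using V_eps_lower[OF U hF h\<sigma> ms e, of n] 1 by linarith
      then show ?thesis using h\<sigma> c by (simp add: M_def pos_le_divide_eq mult.commute)
    qed
    obtain r \<mu> where r: "strict_mono r" and \<mu>: "\<mu> \<in> P2" and w: "weak_conv_seq (ms \<circ> r) \<mu>"
      by (rule P2_weakly_compact[OF ms M])
    define \<epsilon>k where "\<epsilon>k k = 1 / real (Suc (r k))" for k
    have e0: "\<epsilon>k k > 0" for k by (simp add: \<epsilon>k_def)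
    have elim0: "\<epsilon>k \<longlonglongrightarrow> 0"
      using LIMSEQ_subseq_LIMSEQ[OF LIMSEQ_Suc[OF lim_1_over_n] r] by (simp add: \<epsilon>k_def[abs_def] o_def)
    have msr: "(ms \<circ> r) k = \<mu>e (\<epsilon>k k)" for k by (simp add: ms_def \<epsilon>k_def)
    have msrP: "(ms \<circ> r) k \<in> P2" for k using ms by simp
    have "V F U \<sigma> \<mu> \<le> V F U \<sigma> m" if m: "m \<in> P2" for m
    proof (cases "KL m (pi_meas U) = \<infinity>")
      case True
      then show ?thesis using h\<sigma> by (simp add: V_def)
    next
      case False
      \<comment> \<open>Any smoothed energy is a real lower bound; eps = 1 is an arbitrary
        choice.\<close>
      moreover have "KL m (pi_meas U) \<noteq> - \<infinity>" using smoothed_energy_le_KL[OF U m zero_less_one] by auto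
      ultimately obtain \<kappa> where \<kappa>: "KL m (pi_meas U) = ereal \<kappa>" by (cases "KL m (pi_meas U)") auto
      define v where "v = F m + \<sigma> * \<kappa>"
      have up: "F ((ms \<circ> r) k) + \<sigma> * smoothed_energy U (\<epsilon>k k) ((ms \<circ> r) k) \<le> v" for k
      proof -
        have "V_eps F U \<sigma> (\<epsilon>k k) ((ms \<circ> r) k) \<le> V_eps F U \<sigma> (\<epsilon>k k) m"
          unfolding msr using min e0 m by blast
        moreover have "smoothed_energy U (\<epsilon>k k) m \<le> \<kappa>" using smoothed_energy_le_KL[OF U m e0, of k] \<kappa> by simp
        then have "\<sigma> * smoothed_energy U (\<epsilon>k k) m \<le> \<sigma> * \<kappa>" using h\<sigma> by (intro mult_left_mono) auto
        ultimately show ?thesis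
          unfolding v_def V_eps_eq[OF U msrP e0] V_eps_eq[OF U m e0] by linarith
      qed
      \<comment> \<open>F and the energy have separate lower limits along the sequence. With F moved
        to the other side of \<open>up\<close>, every dual value at \<mu> is at most (v - F \<mu>) /
        \<sigma>, and the supremum over b is the relative entropy.\<close>
      have "KL \<mu> (pi_meas U) \<le> ereal ((v - F \<mu>) / \<sigma>)"
      proof (rule KL_le_of_dual_bound[OF U \<mu>], rule field_le_epsilon)
        fix b :: "'a \<Rightarrow> real" and \<delta> :: real assume b: "bounded_lipschitz b" and \<delta>: "\<delta> > 0"
        let ?D = "(\<integral>x. b x \<partial>\<mu>) + (\<integral>x. U x - c * (norm x)\<^sup>2 \<partial>\<mu>) + 1 - (\<integral>y. exp (b y - c * (norm y)\<^sup>2) \<partial>lborel)"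
        have "\<forall>\<^sub>F k in sequentially. F ((ms \<circ> r) k) > F \<mu> - \<sigma> * \<delta> / 2 \<and> smoothed_energy U (\<epsilon>k k) ((ms \<circ> r) k) > ?D - \<delta> / 2"
          using \<delta> h\<sigma>
          by (intro eventually_conj F_assumption_lsc[OF hF msrP \<mu> w] smoothed_energy_liminf[OF U w msrP \<mu> e0 elim0 b]) auto
        then obtain k where k: "F ((ms \<circ> r) k) > F \<mu> - \<sigma> * \<delta> / 2" "smoothed_energy U (\<epsilon>k k) ((ms \<circ> r) k) > ?D - \<delta> / 2"
          using eventually_happens'[OF sequentially_bot] by blast
        have "\<sigma> * (?D - \<delta> / 2) \<le> \<sigma> * smoothed_energy U (\<epsilon>k k) ((ms \<circ> r) k)"
          using k(2) h\<sigma> by (intro mult_left_mono) auto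
        then have "\<sigma> * (?D - \<delta> / 2) \<le> v - F \<mu> + \<sigma> * \<delta> / 2" using up[of k] k(1) by linarith
        then have "?D * \<sigma> \<le> v - F \<mu> + \<delta> * \<sigma>" by (simp add: algebra_simps)
        then show "?D \<le> (v - F \<mu>) / \<sigma> + \<delta>" using h\<sigma> by (simp add: pos_le_divide_eq[symmetric] add_divide_distrib)
      qed
      then have "ereal \<sigma> * KL \<mu> (pi_meas U) \<le> ereal \<sigma> * ereal ((v - F \<mu>) / \<sigma>)"
        using h\<sigma> by (intro ereal_mult_left_mono) auto
      also have "\<dots> = ereal (v - F \<mu>)" using h\<sigma> by simp
      finally have "V F U \<sigma> \<mu> \<le> ereal (F \<mu>) + ereal (v - F \<mu>)" unfolding V_def by (intro add_left_mono)
      also have "\<dots> = V F U \<sigma> m" by (simp add: V_def \<kappa> v_def)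
      finally show ?thesis .
    qed
    moreover have "weak_conv_seq (\<lambda>k. \<mu>e (\<epsilon>k k)) \<mu>"
      using w unfolding weak_conv_seq_def msr .
    ultimately show "\<exists>\<epsilon>k :: nat \<Rightarrow> real. \<exists>\<mu>\<in>P2. (\<forall>k. \<epsilon>k k > 0) \<and> \<epsilon>k \<longlonglongrightarrow> 0 \<and>
       weak_conv_seq (\<lambda>k. \<mu>e (\<epsilon>k k)) \<mu> \<and> (\<forall>m\<in>P2. V F U \<sigma> \<mu> \<le> V F U \<sigma> m)"
      using e0 elim0 \<mu> by blast
  qed
qed

end
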